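(* Let $\Gamma$ be a discrete group. If $\Lambda$ is a co-amenable subgroup of $\Gamma$ and $\pi$ is a unitary representation of $\Gamma$, then there is a $\Gamma$-isomorphism $\mathcal{B}_{\mathrm{ind}_\Lambda^\Gamma(\pi|_\Lambda)}\cong\mathcal{B}_\pi$.
   Context: For a unitary representation $\pi:\Gamma\to\mathcal{U}(\mathcal{H}_\pi)$, $\Gamma$ acts on $B(\mathcal{H}_\pi)$ by $g\cdot x=\pi(g)x\pi(g^{-1})$. A $\Gamma$-map between operator systems carrying $\Gamma$-actions is a unital completely positive $\Gamma$-equivariant linear map; a $\Gamma$-isomorphism is a bijective completely isometric $\Gamma$-map. Furstenberg--Hamana (FH) boundary: on the set $\mathcal{G}$ of all $\Gamma$-maps $\phi:B(\mathcal{H}_\pi)\to B(\mathcal{H}_\pi)$ put the preorder $\phi\le\psi$ iff $\|\phi(x)\|\le\|\psi(x)\|$ for all $x$. Then $\mathcal{G}$ has minimal elements, every minimal element is idempotent, and its image is unique up to $\Gamma$-isomorphism. $\mathcal{B}_\pi$ is the image of a minimal $\phi\in\mathcal{G}$, with the Choi--Effros product $a\cdot b=\phi(ab)$ and the restricted $\Gamma$-action; it is a $\Gamma$-$C^*$-algebra. A subgroup $\Lambda\le\Gamma$ is co-amenable if the trivial representation $1_\Gamma$ is weakly contained in the quasi-regular representation $\lambda_{\Gamma/\Lambda}$ on $\ell^2(\Gamma/\Lambda)$; equivalently there is a $\Gamma$-invariant state on $\ell^\infty(\Gamma/\Lambda)$. $\mathrm{ind}_\Lambda^\Gamma$ denotes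 the (unitarily) induced representation. *)

theory Defs
  imports
    "HOL-Analysis.Analysis"
    "HOL-Library.Function_Algebras"
    "HOL-Algebra.Group_Action"
    "HOL-Algebra.Left_Coset"
begin

section \<open>Complex Hilbert spaces\<close>

text \<open>
  The Hilbert space of an induced representation depends on the representation one induces from,
  so it cannot be a type.  A Hilbert space is therefore a subspace \<^term>\<open>carrier H\<close> of an ambient
  complex vector space; its addition is that of the ambient type.
  Inner products are linear in the first argument.
\<close>

record 'a hilbert = "'a partial_object" +
  cscale :: "complex \<Rightarrow> 'a \<Rightarrow> 'a"
  cinner :: "'a \<Rightarrow> 'a \<Rightarrow> complex"

definition hnorm :: "'a hilbert \<Rightarrow> 'a \<Rightarrow> real" where
  "hnorm H x = sqrt (Re (cinner H x x))"

locale hilbert_space =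
  fixes H :: "'a::ab_group_add hilbert"
  assumes vector_space: "vector_space (cscale H)"
    and subspace: "Modules.module.subspace (cscale H) (carrier H)"
    and cinner_add: "\<lbrakk>x \<in> carrier H; y \<in> carrier H; z \<in> carrier H\<rbrakk>
          \<Longrightarrow> cinner H (x + y) z = cinner H x z + cinner H y z"
    and cinner_scale: "\<lbrakk>x \<in> carrier H; y \<in> carrier H\<rbrakk>
          \<Longrightarrow> cinner H (cscale H c x) y = c * cinner H x y"
    and cinner_commute: "\<lbrakk>x \<in> carrier H; y \<in> carrier H\<rbrakk> \<Longrightarrow> cinner H y x = cnj (cinner H x y)"
    and cinner_nonneg: "x \<in> carrier H \<Longrightarrow> 0 \<le> Re (cinner H x x)"
    and cinner_definite: "\<lbrakk>x \<in> carrier H; cinner H x x = 0\<rbrakk> \<Longrightarrow> x = 0"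
    and complete: "\<lbrakk>\<And>n::nat. X n \<in> carrier H;
            \<And>e. 0 < e \<Longrightarrow> \<exists>N. \<forall>m\<ge>N. \<forall>n\<ge>N. hnorm H (X m - X n) < e\<rbrakk>
          \<Longrightarrow> \<exists>l\<in>carrier H. (\<lambda>n. hnorm H (X n - l)) \<longlonglongrightarrow> 0"

text \<open>The \<open>n\<close>-fold direct sum; its elements are sequences vanishing from index \<open>n\<close> on.\<close>

definition hpower :: "'a::ab_group_add hilbert \<Rightarrow> nat \<Rightarrow> (nat \<Rightarrow> 'a) hilbert" where
  "hpower H n =
    \<lparr>carrier = {x. (\<forall>i<n. x i \<in> carrier H) \<and> (\<forall>i\<ge>n. x i = 0)},
     cscale = (\<lambda>c x i. cscale H c (x i)),
     cinner = (\<lambda>x y. \<Sum>i<n. cinner H (x i) (y i))\<rparr>"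

definition ell2 :: "'x set \<Rightarrow> ('x \<Rightarrow> complex) hilbert" where
  "ell2 X =
    \<lparr>carrier = {f. (\<forall>x. x \<notin> X \<longrightarrow> f x = 0) \<and> (\<lambda>x. (cmod (f x))\<^sup>2) summable_on X},
     cscale = (\<lambda>c f x. c * f x),
     cinner = (\<lambda>f g. \<Sum>\<^sub>\<infinity>x\<in>X. f x * cnj (g x))\<rparr>"

definition complex_line :: "complex hilbert" where
  "complex_line = \<lparr>carrier = UNIV, cscale = (*), cinner = (\<lambda>x y. x * cnj y)\<rparr>"


section \<open>Bounded operators\<close>

definition clinear_on :: "'a::ab_group_add hilbert \<Rightarrow> ('a \<Rightarrow> 'a) \<Rightarrow> bool" where
  "clinear_on H T \<longleftrightarrow>
    (\<forall>x\<in>carrier H. \<forall>y\<in>carrier H. T (x + y) = T x + T y) \<and>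
    (\<forall>c. \<forall>x\<in>carrier H. T (cscale H c x) = cscale H c (T x))"

text \<open>
  Operators are extensional functions, as in \<^const>\<open>BijGroup\<close>, so that equality of operators
  is equality of functions; the composition is \<^term>\<open>compose (carrier H)\<close>.
\<close>

definition bounded_ops :: "'a::ab_group_add hilbert \<Rightarrow> ('a \<Rightarrow> 'a) set" where
  "bounded_ops H = {T \<in> carrier H \<rightarrow>\<^sub>E carrier H.
     clinear_on H T \<and> (\<exists>M. \<forall>x\<in>carrier H. hnorm H (T x) \<le> M * hnorm H x)}"

definition op_norm :: "'a hilbert \<Rightarrow> ('a \<Rightarrow> 'a) \<Rightarrow> real" where
  "op_norm H T = Inf {M. 0 \<le> M \<and> (\<forall>x\<in>carrier H. hnorm H (T x) \<le> M * hnorm H x)}"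

definition op_one :: "'a hilbert \<Rightarrow> 'a \<Rightarrow> 'a" where
  "op_one H = (\<lambda>x\<in>carrier H. x)"

definition op_add :: "'a::ab_group_add hilbert \<Rightarrow> ('a \<Rightarrow> 'a) \<Rightarrow> ('a \<Rightarrow> 'a) \<Rightarrow> 'a \<Rightarrow> 'a" where
  "op_add H S T = (\<lambda>x\<in>carrier H. S x + T x)"

definition op_scale :: "'a hilbert \<Rightarrow> complex \<Rightarrow> ('a \<Rightarrow> 'a) \<Rightarrow> 'a \<Rightarrow> 'a" where
  "op_scale H c T = (\<lambda>x\<in>carrier H. cscale H c (T x))"

definition positive_op :: "'a hilbert \<Rightarrow> ('a \<Rightarrow> 'a) \<Rightarrow> bool" where
  "positive_op H T \<longleftrightarrow> (\<forall>x\<in>carrier H. cinner H (T x) x \<in> \<real>\<^sub>\<ge>\<^sub>0)"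

text \<open>
  The operator on \<^term>\<open>hpower H n\<close> given by an \<open>n \<times> n\<close> matrix of operators on \<open>H\<close>.  The order and
  the norm on \<open>n \<times> n\<close> matrices over an operator system in \<^term>\<open>bounded_ops H\<close> are
  those of these operators.
\<close>

definition matrix_op ::
  "'a::ab_group_add hilbert \<Rightarrow> nat \<Rightarrow> (nat \<Rightarrow> nat \<Rightarrow> 'a \<Rightarrow> 'a) \<Rightarrow> (nat \<Rightarrow> 'a) \<Rightarrow> nat \<Rightarrow> 'a" where
  "matrix_op H n a = (\<lambda>x\<in>carrier (hpower H n). \<lambda>i. if i < n then \<Sum>j<n. a i j (x j) else 0)"


section \<open>Unitary representations\<close>

text \<open>
  \<^const>\<open>group_action\<close> says that \<open>\<pi>\<close> is a homomorphism into the bijections of \<^term>\<open>carrier H\<close>.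
\<close>

locale unitary_rep = hilbert_space H + group_action G "carrier H" \<pi>
  for G :: "('g, 'm) monoid_scheme" (structure) and H :: "'a::ab_group_add hilbert" and \<pi> +
  assumes linear: "g \<in> carrier G \<Longrightarrow> clinear_on H (\<pi> g)"
    and isometric: "\<lbrakk>g \<in> carrier G; x \<in> carrier H; y \<in> carrier H\<rbrakk>
          \<Longrightarrow> cinner H (\<pi> g x) (\<pi> g y) = cinner H x y"

definition trivial_rep :: "'g \<Rightarrow> complex \<Rightarrow> complex" where
  "trivial_rep g = (\<lambda>x. x)"

definition quasi_regular ::
  "('g, 'm) monoid_scheme \<Rightarrow> 'g set \<Rightarrow> 'g \<Rightarrow> ('g set \<Rightarrow> complex) \<Rightarrow> 'g set \<Rightarrow> complex" where
  "quasi_regular G \<Lambda> g =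
    (\<lambda>f\<in>carrier (ell2 (lcosets\<^bsub>G\<^esub> \<Lambda>)).
      \<lambda>C. if C \<in> lcosets\<^bsub>G\<^esub> \<Lambda> then f (inv\<^bsub>G\<^esub> g <#\<^bsub>G\<^esub> C) else 0)"

text \<open>
  The representation of the complex group algebra on \<open>H\<close>, evaluated at \<open>\<Sum>g\<in>F. f g \<cdot> g\<close>.
\<close>

definition group_algebra_op ::
  "'a::ab_group_add hilbert \<Rightarrow> ('g \<Rightarrow> 'a \<Rightarrow> 'a) \<Rightarrow> 'g set \<Rightarrow> ('g \<Rightarrow> complex) \<Rightarrow> 'a \<Rightarrow> 'a" where
  "group_algebra_op H \<pi> F f = (\<lambda>x\<in>carrier H. \<Sum>g\<in>F. cscale H (f g) (\<pi> g x))"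

text \<open>
  \<open>\<pi>\<close> is weakly contained in \<open>\<rho>\<close> if \<open>\<rho>(g) \<mapsto> \<pi>(g)\<close> extends to a \<open>*\<close>-homomorphism between the
  C*-algebras generated by \<open>\<rho>\<close> and \<open>\<pi>\<close>, that is, if \<open>\<parallel>\<pi>(f)\<parallel> \<le> \<parallel>\<rho>(f)\<parallel>\<close> on the group algebra.
\<close>

definition weakly_contained ::
  "('g, 'm) monoid_scheme \<Rightarrow> 'a::ab_group_add hilbert \<Rightarrow> ('g \<Rightarrow> 'a \<Rightarrow> 'a) \<Rightarrow>
   'b::ab_group_add hilbert \<Rightarrow> ('g \<Rightarrow> 'b \<Rightarrow> 'b) \<Rightarrow> bool" where
  "weakly_contained G H \<pi> K \<rho> \<longleftrightarrow>
    (\<forall>F f. finite F \<and> F \<subseteq> carrier G \<longrightarrow>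
      op_norm H (group_algebra_op H \<pi> F f) \<le> op_norm K (group_algebra_op K \<rho> F f))"

definition co_amenable :: "('g, 'm) monoid_scheme \<Rightarrow> 'g set \<Rightarrow> bool" where
  "co_amenable G \<Lambda> \<longleftrightarrow>
    weakly_contained G complex_line trivial_rep (ell2 (lcosets\<^bsub>G\<^esub> \<Lambda>)) (quasi_regular G \<Lambda>)"

text \<open>
  For a unitary representation \<open>\<sigma>\<close> of \<open>\<Lambda>\<close> on \<open>H\<close>, the induced representation acts by left translation
  on the functions \<open>f\<close> on \<open>G\<close> with \<open>f (x h) = \<sigma> (h\<inverse>) (f x)\<close> for \<open>h \<in> \<Lambda>\<close> that are square summable
  over the left cosets.  The terms \<open>\<langle>f x, f' x\<rangle>\<close> depend on the coset \<open>x \<Lambda>\<close> only, so they may be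
  evaluated at an arbitrary representative.
\<close>

definition induced_space ::
  "('g, 'm) monoid_scheme \<Rightarrow> 'g set \<Rightarrow> 'a::ab_group_add hilbert \<Rightarrow> ('g \<Rightarrow> 'a \<Rightarrow> 'a) \<Rightarrow>
   ('g \<Rightarrow> 'a) hilbert" where
  "induced_space G \<Lambda> H \<sigma> =
    \<lparr>carrier = {f. (\<forall>x. x \<notin> carrier G \<longrightarrow> f x = 0) \<and>
                   (\<forall>x\<in>carrier G. f x \<in> carrier H) \<and>
                   (\<forall>x\<in>carrier G. \<forall>h\<in>\<Lambda>. f (x \<otimes>\<^bsub>G\<^esub> h) = \<sigma> (inv\<^bsub>G\<^esub> h) (f x)) \<and>
                   (\<lambda>C. (hnorm H (f (SOME x. x \<in> C)))\<^sup>2) summable_on (lcosets\<^bsub>G\<^esub> \<Lambda>)},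
     cscale = (\<lambda>c f x. cscale H c (f x)),
     cinner = (\<lambda>f f'. \<Sum>\<^sub>\<infinity>C\<in>lcosets\<^bsub>G\<^esub> \<Lambda>. cinner H (f (SOME x. x \<in> C)) (f' (SOME x. x \<in> C)))\<rparr>"

definition induced_rep ::
  "('g, 'm) monoid_scheme \<Rightarrow> 'g set \<Rightarrow> 'a::ab_group_add hilbert \<Rightarrow> ('g \<Rightarrow> 'a \<Rightarrow> 'a) \<Rightarrow>
   'g \<Rightarrow> ('g \<Rightarrow> 'a) \<Rightarrow> 'g \<Rightarrow> 'a" where
  "induced_rep G \<Lambda> H \<sigma> g =
    (\<lambda>f\<in>carrier (induced_space G \<Lambda> H \<sigma>).
      \<lambda>x. if x \<in> carrier G then f (inv\<^bsub>G\<^esub> g \<otimes>\<^bsub>G\<^esub> x) else 0)"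


section \<open>\<open>\<Gamma>\<close>-maps and the Furstenberg--Hamana boundary\<close>

definition op_action ::
  "('g, 'm) monoid_scheme \<Rightarrow> 'a hilbert \<Rightarrow> ('g \<Rightarrow> 'a \<Rightarrow> 'a) \<Rightarrow> 'g \<Rightarrow> ('a \<Rightarrow> 'a) \<Rightarrow> 'a \<Rightarrow> 'a" where
  "op_action G H \<pi> g T =
    compose (carrier H) (\<pi> g) (compose (carrier H) T (\<pi> (inv\<^bsub>G\<^esub> g)))"

text \<open>
  \<open>S\<close> and \<open>S'\<close> are operator systems in \<^term>\<open>bounded_ops H\<close> and \<^term>\<open>bounded_ops K\<close>, invariant under
  the actions given by \<open>\<pi>\<close> and \<open>\<rho>\<close>.
\<close>

locale gamma_map =
  fixes G :: "('g, 'm) monoid_scheme" (structure)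
    and H :: "'a::ab_group_add hilbert" and \<pi> :: "'g \<Rightarrow> 'a \<Rightarrow> 'a" and S :: "('a \<Rightarrow> 'a) set"
    and K :: "'b::ab_group_add hilbert" and \<rho> :: "'g \<Rightarrow> 'b \<Rightarrow> 'b" and S' :: "('b \<Rightarrow> 'b) set"
    and \<theta> :: "('a \<Rightarrow> 'a) \<Rightarrow> ('b \<Rightarrow> 'b)"
  assumes maps_to: "\<theta> \<in> S \<rightarrow> S'"
    and additive: "\<lbrakk>x \<in> S; y \<in> S\<rbrakk> \<Longrightarrow> \<theta> (op_add H x y) = op_add K (\<theta> x) (\<theta> y)"
    and homogeneous: "x \<in> S \<Longrightarrow> \<theta> (op_scale H c x) = op_scale K c (\<theta> x)"
    and unital: "\<theta> (op_one H) = op_one K"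
    and completely_positive: "\<lbrakk>\<And>i j. \<lbrakk>i < n; j < n\<rbrakk> \<Longrightarrow> a i j \<in> S;
            positive_op (hpower H n) (matrix_op H n a)\<rbrakk>
          \<Longrightarrow> positive_op (hpower K n) (matrix_op K n (\<lambda>i j. \<theta> (a i j)))"
    and equivariant: "\<lbrakk>g \<in> carrier G; x \<in> S\<rbrakk>
          \<Longrightarrow> \<theta> (op_action G H \<pi> g x) = op_action G K \<rho> g (\<theta> x)"

locale gamma_isomorphism = gamma_map +
  assumes bijective: "bij_betw \<theta> S S'"
    and completely_isometric: "(\<And>i j. \<lbrakk>i < n; j < n\<rbrakk> \<Longrightarrow> a i j \<in> S)
          \<Longrightarrow> op_norm (hpower K n) (matrix_op K n (\<lambda>i j. \<theta> (a i j)))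
            = op_norm (hpower H n) (matrix_op H n a)"

abbreviation gamma_endo ::
  "('g, 'm) monoid_scheme \<Rightarrow> 'a::ab_group_add hilbert \<Rightarrow> ('g \<Rightarrow> 'a \<Rightarrow> 'a) \<Rightarrow>
   (('a \<Rightarrow> 'a) \<Rightarrow> 'a \<Rightarrow> 'a) \<Rightarrow> bool" where
  "gamma_endo G H \<pi> \<equiv> gamma_map G H \<pi> (bounded_ops H) H \<pi> (bounded_ops H)"

definition map_le ::
  "'a::ab_group_add hilbert \<Rightarrow> (('a \<Rightarrow> 'a) \<Rightarrow> 'a \<Rightarrow> 'a) \<Rightarrow> (('a \<Rightarrow> 'a) \<Rightarrow> 'a \<Rightarrow> 'a) \<Rightarrow> bool" where
  "map_le H \<phi> \<psi> \<longleftrightarrow> (\<forall>x\<in>bounded_ops H. op_norm H (\<phi> x) \<le> op_norm H (\<psi> x))"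

text \<open>Minimality is with respect to a preorder, hence the conclusion \<open>map_le H \<phi> \<psi>\<close>.\<close>

definition minimal_gamma_endo ::
  "('g, 'm) monoid_scheme \<Rightarrow> 'a::ab_group_add hilbert \<Rightarrow> ('g \<Rightarrow> 'a \<Rightarrow> 'a) \<Rightarrow>
   (('a \<Rightarrow> 'a) \<Rightarrow> 'a \<Rightarrow> 'a) \<Rightarrow> bool" where
  "minimal_gamma_endo G H \<pi> \<phi> \<longleftrightarrow>
    gamma_endo G H \<pi> \<phi> \<and> (\<forall>\<psi>. gamma_endo G H \<pi> \<psi> \<longrightarrow> map_le H \<psi> \<phi> \<longrightarrow> map_le H \<phi> \<psi>)"

text \<open>
  \<open>B\<close> is a realisation of the Furstenberg--Hamana boundary of \<open>\<pi>\<close>: the image of a minimal map.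
  It is determined up to \<open>\<Gamma>\<close>-isomorphism only.  A \<open>\<Gamma>\<close>-isomorphism concerns the operator system
  structure and the action, both restricted from \<^term>\<open>bounded_ops H\<close>; the Choi--Effros product
  \<open>a \<cdot> b = \<phi> (a b)\<close> makes \<open>B\<close> a C*-algebra with these same matrix norms and matrix order,
  and is not recorded.
\<close>

definition FH_boundary ::
  "('g, 'm) monoid_scheme \<Rightarrow> 'a::ab_group_add hilbert \<Rightarrow> ('g \<Rightarrow> 'a \<Rightarrow> 'a) \<Rightarrow>
   ('a \<Rightarrow> 'a) set \<Rightarrow> bool" where
  "FH_boundary G H \<pi> B \<longleftrightarrow> (\<exists>\<phi>. minimal_gamma_endo G H \<pi> \<phi> \<and> B = \<phi> ` bounded_ops H)"

end

theory Submission
  imports Defs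
begin

text \<open>
  Write \<open>\<rho>\<close> for the induced representation, on the space \<open>K\<close>.  The boundary of a representation depends
  only on which \<open>\<Gamma>\<close>-maps exist: if there are \<open>\<Gamma>\<close>-maps \<open>\<alpha> : B(H) \<rightarrow> B(K)\<close> and \<open>\<beta> : B(K) \<rightarrow> B(H)\<close>, then the
  boundaries of \<open>\<pi>\<close> and \<open>\<rho>\<close> are isomorphic (\<open>FH_boundary_isomorphic\<close>).  The reason is rigidity
  (\<open>minimal_gamma_endo_rigid\<close>): if \<open>\<phi>\<close> is minimal and \<open>\<theta>\<close> is any \<open>\<Gamma>\<close>-map on \<open>B(H)\<close>, then \<open>\<phi> \<theta> \<phi> = \<phi>\<close>.  So
  for minimal maps \<open>\<phi>\<close> on \<open>B(H)\<close> and \<open>\<psi>\<close> on \<open>B(K)\<close>, the maps \<open>\<phi> \<beta>\<close> and \<open>\<psi> \<alpha>\<close> restrict to mutually inverse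
  \<open>\<Gamma>\<close>-maps between the two boundaries, and these are completely isometric because unital completely
  positive maps are completely contractive (\<open>ucp_op_bounds\<close>).

  Rigidity needs no limit points of iterates.  A minimal \<open>\<phi>\<close> is idempotent because the averages \<open>A\<^sub>n\<close> of
  \<open>\<phi>, \<dots>, \<phi>\<^sup>n\<close> are below \<open>\<phi>\<close>, hence by minimality \<open>\<parallel>\<phi> (x - \<phi> x)\<parallel> \<le> \<parallel>A\<^sub>n (x - \<phi> x)\<parallel> \<le> 2 \<parallel>x\<parallel> / n\<close>.  Now \<open>\<eta> = \<phi> \<theta> \<phi>\<close> is below
  \<open>\<phi>\<close>, so it is minimal too, and hence idempotent; as \<open>\<eta>\<close> kills \<open>x - \<eta> x\<close>, so does \<open>\<phi>\<close>, that is,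
  \<open>\<phi> x = \<phi> (\<eta> x) = \<eta> x\<close>.

  The two \<open>\<Gamma>\<close>-maps come from the unitary equivalence of \<open>\<rho>\<close> with \<open>\<lambda> \<otimes> \<pi>\<close>, where \<open>\<lambda>\<close> is the quasi-regular
  representation on \<open>\<ell>\<^sup>2(G/\<Lambda>)\<close>.  One is \<open>T \<mapsto> 1 \<otimes> T\<close> (\<open>amplify_gamma_map\<close>).  For the other, co-amenability
  gives almost invariant unit vectors \<open>u\<close> in \<open>\<ell>\<^sup>2(G/\<Lambda>)\<close> (\<open>co_amenable_almost_invariant\<close>), and a pointwise
  limit of the compressions \<open>S \<mapsto> ((\<xi>, \<eta>) \<mapsto> \<langle>S (u \<otimes> \<xi>), u \<otimes> \<eta>\<rangle>)\<close> exists by Tychonoff's theorem; it is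
  equivariant because \<open>u\<close> is almost invariant (\<open>compression_gamma_map\<close>).
\<close>

section \<open>Geometry of Hilbert spaces\<close>

context hilbert_space
begin

lemma zero_closed: "0 \<in> carrier H"
  and add_closed: "\<lbrakk>x \<in> carrier H; y \<in> carrier H\<rbrakk> \<Longrightarrow> x + y \<in> carrier H"
  and scale_closed: "x \<in> carrier H \<Longrightarrow> cscale H c x \<in> carrier H"
proof -
  interpret V: vector_space "cscale H" by (rule vector_space)
  show "0 \<in> carrier H"
    "\<lbrakk>x \<in> carrier H; y \<in> carrier H\<rbrakk> \<Longrightarrow> x + y \<in> carrier H"
    "x \<in> carrier H \<Longrightarrow> cscale H c x \<in> carrier H"
    using subspace by (simp_all add: V.subspace_def)
qed

lemma scale_minus_one: "cscale H (- 1) x = - x"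
  and scale_zero_right: "cscale H c 0 = 0"
  and scale_one: "cscale H 1 x = x"
  and scale_scale: "cscale H a (cscale H b x) = cscale H (a * b) x"
  and scale_add_right: "cscale H a (x + y) = cscale H a x + cscale H a y"
  and scale_add_left: "cscale H (a + b) x = cscale H a x + cscale H b x"
  and scale_zero_left: "cscale H 0 x = 0"
proof -
  interpret V: vector_space "cscale H" by (rule vector_space)
  show "cscale H (- 1) x = - x" "cscale H c 0 = 0" "cscale H 1 x = x"
    "cscale H a (cscale H b x) = cscale H (a * b) x"
    "cscale H a (x + y) = cscale H a x + cscale H a y"
    "cscale H (a + b) x = cscale H a x + cscale H b x" "cscale H 0 x = 0"
    by (simp_all add: V.scale_right_distrib V.scale_left_distrib)
qed

lemma minus_closed: "x \<in> carrier H \<Longrightarrow> - x \<in> carrier H"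
  using scale_closed[of x "- 1"] by (simp add: scale_minus_one)

lemma diff_closed: "\<lbrakk>x \<in> carrier H; y \<in> carrier H\<rbrakk> \<Longrightarrow> x - y \<in> carrier H"
  using add_closed[of x "- y"] minus_closed by simp

lemma sum_closed: "(\<And>i. i \<in> I \<Longrightarrow> f i \<in> carrier H) \<Longrightarrow> sum f I \<in> carrier H"
  by (induction I rule: infinite_finite_induct) (auto intro: add_closed zero_closed)

lemmas closed = zero_closed add_closed scale_closed minus_closed diff_closed sum_closed

lemma cinner_add_right:
  "\<lbrakk>x \<in> carrier H; y \<in> carrier H; z \<in> carrier H\<rbrakk> \<Longrightarrow> cinner H x (y + z) = cinner H x y + cinner H x z"
  by (metis add_closed cinner_add cinner_commute complex_cnj_add)

lemma cinner_scale_right: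
  "\<lbrakk>x \<in> carrier H; y \<in> carrier H\<rbrakk> \<Longrightarrow> cinner H x (cscale H c y) = cnj c * cinner H x y"
  by (metis scale_closed cinner_scale cinner_commute complex_cnj_mult)

lemma cinner_minus_left:
  "\<lbrakk>x \<in> carrier H; y \<in> carrier H\<rbrakk> \<Longrightarrow> cinner H (- x) y = - cinner H x y"
  using cinner_scale[of x y "- 1"] by (simp add: scale_minus_one)

lemma cinner_minus_right:
  "\<lbrakk>x \<in> carrier H; y \<in> carrier H\<rbrakk> \<Longrightarrow> cinner H x (- y) = - cinner H x y"
  using cinner_scale_right[of x y "- 1"] by (simp add: scale_minus_one)

lemma cinner_diff_left:
  "\<lbrakk>x \<in> carrier H; y \<in> carrier H; z \<in> carrier H\<rbrakk> \<Longrightarrow> cinner H (x - y) z = cinner H x z - cinner H y z"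
  using cinner_add[of x "- y" z] by (simp add: minus_closed cinner_minus_left)

lemma cinner_diff_right:
  "\<lbrakk>x \<in> carrier H; y \<in> carrier H; z \<in> carrier H\<rbrakk> \<Longrightarrow> cinner H x (y - z) = cinner H x y - cinner H x z"
  using cinner_add_right[of x y "- z"] by (simp add: minus_closed cinner_minus_right)

lemma cinner_zero_left: "x \<in> carrier H \<Longrightarrow> cinner H 0 x = 0"
  using cinner_diff_left[of x x x] by simp

lemma cinner_zero_right: "x \<in> carrier H \<Longrightarrow> cinner H x 0 = 0"
  using cinner_diff_right[of x x x] by simp

lemma cinner_sum_left:
  assumes "\<And>i. i \<in> I \<Longrightarrow> f i \<in> carrier H" "y \<in> carrier H"
  shows "cinner H (sum f I) y = (\<Sum>i\<in>I. cinner H (f i) y)"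
  using assms
  by (induction I rule: infinite_finite_induct)
    (auto simp: cinner_zero_left cinner_add sum_closed)

lemma cinner_self: "x \<in> carrier H \<Longrightarrow> cinner H x x = of_real ((hnorm H x)\<^sup>2)"
  using cinner_commute[of x x] cinner_nonneg[of x]
  by (auto simp: hnorm_def complex_eq_iff)

lemma hnorm_power2: "x \<in> carrier H \<Longrightarrow> (hnorm H x)\<^sup>2 = Re (cinner H x x)"
  using cinner_nonneg by (simp add: hnorm_def)

lemma hnorm_nonneg: "x \<in> carrier H \<Longrightarrow> 0 \<le> hnorm H x"
  using cinner_nonneg by (simp add: hnorm_def)

lemma hnorm_zero: "hnorm H 0 = 0"
  by (simp add: hnorm_def cinner_zero_left zero_closed)

lemma hnorm_eq_0_iff: "x \<in> carrier H \<Longrightarrow> hnorm H x = 0 \<longleftrightarrow> x = 0"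
  using cinner_self[of x] cinner_definite[of x] hnorm_zero by auto

lemma hnorm_scale: "x \<in> carrier H \<Longrightarrow> hnorm H (cscale H c x) = cmod c * hnorm H x"
proof -
  assume x: "x \<in> carrier H"
  have "(hnorm H (cscale H c x))\<^sup>2 = Re (c * cnj c * cinner H x x)"
    using x by (simp add: hnorm_power2 closed cinner_scale cinner_scale_right algebra_simps)
  also have "\<dots> = (cmod c * hnorm H x)\<^sup>2"
    using x by (simp add: cinner_self power_mult_distrib flip: complex_norm_square)
  finally show ?thesis
    using x by (simp add: hnorm_nonneg closed power2_eq_iff_nonneg)
qed

lemma hnorm_minus: "x \<in> carrier H \<Longrightarrow> hnorm H (- x) = hnorm H x"
  using hnorm_scale[of x "- 1"] by (simp add: scale_minus_one)

lemma hnorm_minus_commute: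
  "\<lbrakk>x \<in> carrier H; y \<in> carrier H\<rbrakk> \<Longrightarrow> hnorm H (x - y) = hnorm H (y - x)"
  using hnorm_minus[of "x - y"] by (simp add: closed)

lemma hnorm_add_power2:
  assumes "x \<in> carrier H" "y \<in> carrier H"
  shows "(hnorm H (x + y))\<^sup>2 = (hnorm H x)\<^sup>2 + (hnorm H y)\<^sup>2 + 2 * Re (cinner H x y)"
proof -
  have "Re (cinner H y x) = Re (cinner H x y)"
    using cinner_commute[of x y] assms by simp
  then show ?thesis
    using assms by (simp add: hnorm_power2 closed cinner_add cinner_add_right)
qed

lemma parallelogram:
  assumes "x \<in> carrier H" "y \<in> carrier H"
  shows "(hnorm H (x + y))\<^sup>2 + (hnorm H (x - y))\<^sup>2 = 2 * (hnorm H x)\<^sup>2 + 2 * (hnorm H y)\<^sup>2"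
  using hnorm_add_power2[of x y] hnorm_add_power2[of x "- y"] assms
  by (simp add: closed cinner_minus_right hnorm_minus)

lemma cauchy_schwarz:
  assumes x: "x \<in> carrier H" and y: "y \<in> carrier H"
  shows "cmod (cinner H x y) \<le> hnorm H x * hnorm H y"
proof (cases "y = 0")
  case True
  then show ?thesis using x by (simp add: cinner_zero_right hnorm_zero)
next
  case False
  define c where "c = cinner H x y"
  define r where "r = (hnorm H y)\<^sup>2"
  have r: "r > 0" using False hnorm_eq_0_iff[OF y] by (simp add: r_def)
  define z where "z = cscale H (- (c / of_real r)) y"
  have z: "z \<in> carrier H" using y by (simp add: z_def closed)
  have cc: "cnj c * c = of_real ((cmod c)\<^sup>2)"
    by (simp only: complex_norm_square mult.commute)
  have "0 \<le> (hnorm H (x + z))\<^sup>2" by simp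
  also have "\<dots> = (hnorm H x)\<^sup>2 + (hnorm H z)\<^sup>2 + 2 * Re (cinner H x z)"
    by (rule hnorm_add_power2[OF x z])
  also have "(hnorm H z)\<^sup>2 = (cmod c)\<^sup>2 / r"
    using r y by (simp add: z_def hnorm_scale norm_divide power_mult_distrib power_divide
        flip: r_def) (simp add: power2_eq_square)
  also have "cinner H x z = - (cnj c * c) / of_real r"
    using x y by (simp add: z_def cinner_scale_right c_def[symmetric])
  also have "\<dots> = of_real (- ((cmod c)\<^sup>2 / r))"
    by (simp only: cc of_real_minus of_real_divide minus_divide_left)
  finally have "(cmod c)\<^sup>2 / r \<le> (hnorm H x)\<^sup>2"
    by simp
  then have "(cmod c)\<^sup>2 \<le> (hnorm H x * hnorm H y)\<^sup>2"
    using r by (simp add: field_simps power_mult_distrib r_def)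
  then show ?thesis
    unfolding c_def by (rule power2_le_imp_le) (simp add: hnorm_nonneg x y)
qed

lemma hnorm_triangle:
  assumes x: "x \<in> carrier H" and y: "y \<in> carrier H"
  shows "hnorm H (x + y) \<le> hnorm H x + hnorm H y"
proof (rule power2_le_imp_le)
  have "Re (cinner H x y) \<le> hnorm H x * hnorm H y"
    using complex_Re_le_cmod cauchy_schwarz[OF x y] by (rule order_trans)
  then show "(hnorm H (x + y))\<^sup>2 \<le> (hnorm H x + hnorm H y)\<^sup>2"
    by (simp add: hnorm_add_power2 x y power2_sum)
qed (simp add: hnorm_nonneg x y)

lemma hnorm_diff_triangle:
  "\<lbrakk>x \<in> carrier H; y \<in> carrier H\<rbrakk> \<Longrightarrow> hnorm H (x - y) \<le> hnorm H x + hnorm H y"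
  using hnorm_triangle[of x "- y"] by (simp add: hnorm_minus closed)

lemma hnorm_diff_ineq:
  assumes "x \<in> carrier H" "y \<in> carrier H"
  shows "\<bar>hnorm H x - hnorm H y\<bar> \<le> hnorm H (x - y)"
  using hnorm_triangle[of "x - y" y] hnorm_triangle[of "y - x" x] assms
    hnorm_minus_commute[of x y] by (simp add: closed)

lemma hnorm_add_power2_le:
  assumes "x \<in> carrier H" "y \<in> carrier H"
  shows "(hnorm H (x + y))\<^sup>2 \<le> 2 * (hnorm H x)\<^sup>2 + 2 * (hnorm H y)\<^sup>2"
  using parallelogram[OF assms] zero_le_power2[of "hnorm H (x - y)"] by linarith

lemma norm_limit_tendsto:
  assumes "\<And>n. X n \<in> carrier H" "l \<in> carrier H" "(\<lambda>n. hnorm H (X n - l)) \<longlonglongrightarrow> 0"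
  shows "(\<lambda>n. hnorm H (X n)) \<longlonglongrightarrow> hnorm H l"
proof (rule LIM_zero_cancel, rule Lim_null_comparison[OF _ assms(3)])
  show "\<forall>\<^sub>F n in sequentially. norm (hnorm H (X n) - hnorm H l) \<le> hnorm H (X n - l)"
    using hnorm_diff_ineq[OF assms(1,2)] by simp
qed

lemma norm_limit_unique:
  assumes X: "\<And>n. X n \<in> carrier H" and l: "l \<in> carrier H" "l' \<in> carrier H"
    and "(\<lambda>n. hnorm H (X n - l)) \<longlonglongrightarrow> 0" "(\<lambda>n. hnorm H (X n - l')) \<longlonglongrightarrow> 0"
  shows "l = l'"
proof -
  have "(\<lambda>n. hnorm H (X n - l) + hnorm H (X n - l')) \<longlonglongrightarrow> 0 + 0"
    by (intro tendsto_add assms)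
  moreover have "hnorm H (l - l') \<le> hnorm H (X n - l) + hnorm H (X n - l')" for n
    using hnorm_diff_triangle[of "X n - l'" "X n - l"] X l by (simp add: closed)
  ultimately have "hnorm H (l - l') \<le> 0"
    by (intro LIMSEQ_le_const[of _ 0]) auto
  then have "l - l' = 0"
    using hnorm_nonneg[of "l - l'"] hnorm_eq_0_iff[of "l - l'"] l by (simp add: closed)
  then show ?thesis by simp
qed

text \<open>
  The vector representing \<open>f\<close> is the minimiser of \<open>\<parallel>x\<parallel>\<^sup>2 - 2 Re (f x)\<close>, which exists by the parallelogram
  law and completeness.
\<close>

theorem riesz_representation:
  assumes add: "\<And>x y. \<lbrakk>x \<in> carrier H; y \<in> carrier H\<rbrakk> \<Longrightarrow> f (x + y) = f x + f y"
    and scale: "\<And>c x. x \<in> carrier H \<Longrightarrow> f (cscale H c x) = c * f x"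
    and bdd: "\<And>x. x \<in> carrier H \<Longrightarrow> cmod (f x) \<le> M * hnorm H x"
  obtains z where "z \<in> carrier H" "\<And>x. x \<in> carrier H \<Longrightarrow> f x = cinner H x z"
proof -
  define J where "J x = (hnorm H x)\<^sup>2 - 2 * Re (f x)" for x
  have lower: "- M\<^sup>2 \<le> J x" if "x \<in> carrier H" for x
  proof -
    have "Re (f x) \<le> M * hnorm H x"
      using complex_Re_le_cmod bdd[OF that] by (rule order_trans)
    moreover have "0 \<le> (hnorm H x - M)\<^sup>2" by simp
    ultimately show ?thesis by (simp add: J_def power2_diff mult_ac)
  qed
  define d where "d = Inf (J ` carrier H)"
  have bb: "bdd_below (J ` carrier H)"
    using lower by (auto simp: bdd_below_def)
  have d: "d \<le> J x" if "x \<in> carrier H" for x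
    unfolding d_def using that bb by (intro cInf_lower) auto
  have "\<exists>x\<in>carrier H. J x < d + 1 / real (Suc n)" for n
  proof -
    have "Inf (J ` carrier H) < d + 1 / real (Suc n)" by (simp add: d_def)
    then show ?thesis
      using zero_closed by (subst (asm) cInf_less_iff[OF _ bb]) auto
  qed
  then obtain X where X: "\<And>n. X n \<in> carrier H" "\<And>n. J (X n) < d + 1 / real (Suc n)"
    by metis
  have conv: "(hnorm H (x - y))\<^sup>2 \<le> 2 * (J x - d) + 2 * (J y - d)"
    if "x \<in> carrier H" "y \<in> carrier H" for x y
  proof -
    define m where "m = cscale H (1/2) (x + y)"
    have m: "m \<in> carrier H" using that by (simp add: m_def closed)
    have "J m = (hnorm H (x + y))\<^sup>2 / 4 - Re (f x) - Re (f y)"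
      using that
      by (simp add: J_def m_def hnorm_scale add scale closed power_mult_distrib power_divide norm_divide field_simps)
    then show ?thesis
      using parallelogram[OF that] d[OF m] unfolding J_def by (simp add: field_simps)
  qed
  have "\<exists>l\<in>carrier H. (\<lambda>n. hnorm H (X n - l)) \<longlonglongrightarrow> 0"
  proof (rule complete[OF X(1)])
    fix e :: real assume e: "0 < e"
    obtain N where N: "4 / e\<^sup>2 < real (Suc N)"
      using reals_Archimedean2 by (metis less_Suc_eq of_nat_less_iff less_trans)
    define r where "r = 1 / real (Suc N)"
    have small: "J (X k) - d < r" if "k \<ge> N" for k
    proof -
      have "1 / real (Suc k) \<le> r" using that by (simp add: r_def field_simps)
      then show ?thesis using X(2)[of k] by linarith
    qed
    have "hnorm H (X m - X n) < e" if "m \<ge> N" "n \<ge> N" for m n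
    proof (rule power2_less_imp_less)
      have "(hnorm H (X m - X n))\<^sup>2 \<le> 2 * (J (X m) - d) + 2 * (J (X n) - d)"
        by (rule conv) (simp_all add: X)
      also have "\<dots> < 4 * r"
        using small[OF that(1)] small[OF that(2)] by argo
      also have "\<dots> < e\<^sup>2"
        using N e by (simp add: r_def field_simps)
      finally show "(hnorm H (X m - X n))\<^sup>2 < e\<^sup>2" .
    qed (use e in simp)
    then show "\<exists>N. \<forall>m\<ge>N. \<forall>n\<ge>N. hnorm H (X m - X n) < e" by blast
  qed
  then obtain z where z: "z \<in> carrier H" "(\<lambda>n. hnorm H (X n - z)) \<longlonglongrightarrow> 0" by blast
  have "(\<lambda>n. f (X n) - f z) \<longlonglongrightarrow> 0"
  proof (rule Lim_null_comparison)
    have "f (X n) - f z = f (X n - z)" for n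
      using add[of "X n - z" z] X(1) z(1) by (simp add: closed)
    then show "\<forall>\<^sub>F n in sequentially. norm (f (X n) - f z) \<le> M * hnorm H (X n - z)"
      using bdd X(1) z(1) by (simp add: closed)
    show "(\<lambda>n. M * hnorm H (X n - z)) \<longlonglongrightarrow> 0"
      using tendsto_mult[OF tendsto_const z(2)] by simp
  qed
  then have "(\<lambda>n. f (X n)) \<longlonglongrightarrow> f z" by (simp add: LIM_zero_iff)
  then have "(\<lambda>n. J (X n)) \<longlonglongrightarrow> J z"
    unfolding J_def by (intro tendsto_intros norm_limit_tendsto[OF X(1) z])
  moreover have "(\<lambda>n. d + 1 / real (Suc n)) \<longlonglongrightarrow> d + 0"
    by (intro tendsto_add tendsto_const LIMSEQ_Suc[OF lim_1_over_n])
  ultimately have Jz: "J z \<le> d"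
    using X(2) by (intro LIMSEQ_le[of "\<lambda>n. J (X n)"]) (auto intro: less_imp_le)
  have "f x = cinner H x z" if x: "x \<in> carrier H" for x
  proof -
    define w where "w = cinner H x z - f x"
    have quad: "2 * s * (cmod w)\<^sup>2 \<le> s\<^sup>2 * (cmod w)\<^sup>2 * (hnorm H x)\<^sup>2" for s :: real
    proof -
      define t where "t = - of_real s * cnj w"
      have tw: "t * w = of_real (- s * (cmod w)\<^sup>2)"
      proof -
        have "t * w = - of_real s * (w * cnj w)" by (simp add: t_def)
        also have "\<dots> = of_real (- s * (cmod w)\<^sup>2)"
          by (simp only: complex_norm_square[symmetric] of_real_mult of_real_minus)
        finally show ?thesis .
      qed
      have tx: "cscale H t x \<in> carrier H" using x by (simp add: closed)
      have "J z \<le> J (z + cscale H t x)"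
        using Jz d[of "z + cscale H t x"] z x by (simp add: closed)
      also have "J (z + cscale H t x)
          = J z + (cmod t)\<^sup>2 * (hnorm H x)\<^sup>2 + 2 * (Re (cinner H z (cscale H t x)) - Re (t * f x))"
        using z x by (simp add: J_def hnorm_add_power2 closed hnorm_scale power_mult_distrib add scale)
      also have "Re (cinner H z (cscale H t x)) = Re (t * cinner H x z)"
        using cinner_commute[OF tx z(1)] cinner_scale[OF x z(1), of t] by simp
      also have "Re (t * cinner H x z) - Re (t * f x) = Re (t * w)"
        by (simp add: w_def right_diff_distrib)
      also have "(cmod t)\<^sup>2 = s\<^sup>2 * (cmod w)\<^sup>2"
        by (simp add: t_def norm_mult power_mult_distrib)
      finally show ?thesis by (simp only: tw) simp
    qed
    have "w = 0"
    proof (rule ccontr)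
      assume "w \<noteq> 0"
      then have w: "(cmod w)\<^sup>2 > 0" by simp
      define s where "s = 1 / ((hnorm H x)\<^sup>2 + 1)"
      have p: "(hnorm H x)\<^sup>2 + 1 > 0" using zero_le_power2[of "hnorm H x"] by linarith
      then have s: "s > 0" "s * (hnorm H x)\<^sup>2 < 1" by (auto simp: s_def field_simps)
      have "s * (2 * (cmod w)\<^sup>2) \<le> s * ((s * (hnorm H x)\<^sup>2) * (cmod w)\<^sup>2)"
        using quad[of s] by (simp add: power2_eq_square mult_ac)
      then have "2 * (cmod w)\<^sup>2 \<le> (s * (hnorm H x)\<^sup>2) * (cmod w)\<^sup>2"
        using s by simp
      also have "\<dots> \<le> 1 * (cmod w)\<^sup>2"
        using s w by (intro mult_right_mono) auto
      finally show False using w by simp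
    qed
    then show ?thesis by (simp add: w_def)
  qed
  then show thesis using that z by blast
qed

end


section \<open>Bounded operators and forms\<close>

lemma op_add_eval: "v \<in> carrier H \<Longrightarrow> op_add H S T v = S v + T v"
  and op_scale_eval: "v \<in> carrier H \<Longrightarrow> op_scale H c T v = cscale H c (T v)"
  and op_one_eval: "v \<in> carrier H \<Longrightarrow> op_one H v = v"
  by (simp_all add: op_add_def op_scale_def op_one_def)

context hilbert_space
begin

lemma bounded_opsE:
  assumes "T \<in> bounded_ops H"
  obtains M where "0 \<le> M" "\<And>x. x \<in> carrier H \<Longrightarrow> hnorm H (T x) \<le> M * hnorm H x"
proof -
  obtain M where M: "\<And>x. x \<in> carrier H \<Longrightarrow> hnorm H (T x) \<le> M * hnorm H x"
    using assms unfolding bounded_ops_def by blast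
  show thesis
    by (rule that[of "max M 0"])
      (auto intro!: order_trans[OF M] mult_right_mono simp: hnorm_nonneg)
qed

lemma op_closed: "\<lbrakk>T \<in> bounded_ops H; x \<in> carrier H\<rbrakk> \<Longrightarrow> T x \<in> carrier H"
  by (auto simp: bounded_ops_def)

lemma op_add_apply:
  "\<lbrakk>T \<in> bounded_ops H; x \<in> carrier H; y \<in> carrier H\<rbrakk> \<Longrightarrow> T (x + y) = T x + T y"
  by (auto simp: bounded_ops_def clinear_on_def)

lemma op_scale_apply:
  "\<lbrakk>T \<in> bounded_ops H; x \<in> carrier H\<rbrakk> \<Longrightarrow> T (cscale H c x) = cscale H c (T x)"
  by (auto simp: bounded_ops_def clinear_on_def)

lemma op_diff_apply:
  assumes "T \<in> bounded_ops H" "x \<in> carrier H" "y \<in> carrier H"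
  shows "T (x - y) = T x - T y"
  using op_add_apply[of T "x - y" y] assms by (simp add: closed)

lemma op_eqI:
  "\<lbrakk>S \<in> bounded_ops H; T \<in> bounded_ops H; \<And>x. x \<in> carrier H \<Longrightarrow> S x = T x\<rbrakk> \<Longrightarrow> S = T"
  by (rule extensionalityI[of _ "carrier H"]) (auto simp: bounded_ops_def PiE_def)

lemma op_eqI_inner:
  assumes "S \<in> bounded_ops H" "T \<in> bounded_ops H"
    and "\<And>x y. \<lbrakk>x \<in> carrier H; y \<in> carrier H\<rbrakk> \<Longrightarrow> cinner H (S x) y = cinner H (T x) y"
  shows "S = T"
proof (rule op_eqI[OF assms(1,2)])
  fix x assume x: "x \<in> carrier H"
  have "cinner H (S x - T x) (S x - T x) = 0"
    using x assms by (simp add: closed cinner_diff_left op_closed)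
  then show "S x = T x"
    using cinner_definite[of "S x - T x"] x assms by (simp add: closed op_closed)
qed

lemma bounded_opsI:
  assumes "\<And>x. x \<in> carrier H \<Longrightarrow> T x \<in> carrier H"
    and "\<And>x y. \<lbrakk>x \<in> carrier H; y \<in> carrier H\<rbrakk> \<Longrightarrow> T (x + y) = T x + T y"
    and "\<And>c x. x \<in> carrier H \<Longrightarrow> T (cscale H c x) = cscale H c (T x)"
    and "\<And>x. x \<in> carrier H \<Longrightarrow> hnorm H (T x) \<le> M * hnorm H x"
  shows "restrict T (carrier H) \<in> bounded_ops H"
  using assms unfolding bounded_ops_def clinear_on_def by (auto simp: closed intro!: exI[of _ M])

lemma op_one_closed: "op_one H \<in> bounded_ops H"
  unfolding op_one_def by (rule bounded_opsI[where M = 1]) auto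

lemma op_add_closed:
  assumes S: "S \<in> bounded_ops H" and T: "T \<in> bounded_ops H"
  shows "op_add H S T \<in> bounded_ops H"
proof -
  obtain M where M: "\<And>x. x \<in> carrier H \<Longrightarrow> hnorm H (S x) \<le> M * hnorm H x"
    using bounded_opsE[OF S] by blast
  obtain N where N: "\<And>x. x \<in> carrier H \<Longrightarrow> hnorm H (T x) \<le> N * hnorm H x"
    using bounded_opsE[OF T] by blast
  show ?thesis
    unfolding op_add_def
  proof (rule bounded_opsI[where M = "M + N"])
    show "hnorm H (S x + T x) \<le> (M + N) * hnorm H x" if "x \<in> carrier H" for x
      using hnorm_triangle[of "S x" "T x"] M[OF that] N[OF that] that S T
      by (simp add: op_closed distrib_right)
  qed (use S T in \<open>simp_all add: op_closed closed op_add_apply op_scale_apply scale_add_right\<close>)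
qed

lemma op_scale_closed:
  assumes S: "S \<in> bounded_ops H"
  shows "op_scale H c S \<in> bounded_ops H"
proof -
  obtain M where M: "\<And>x. x \<in> carrier H \<Longrightarrow> hnorm H (S x) \<le> M * hnorm H x"
    using bounded_opsE[OF S] by blast
  show ?thesis
    unfolding op_scale_def
  proof (rule bounded_opsI[where M = "cmod c * M"])
    show "hnorm H (cscale H c (S x)) \<le> cmod c * M * hnorm H x" if "x \<in> carrier H" for x
      using M[OF that] that S by (simp add: op_closed hnorm_scale mult.assoc mult_left_mono)
  qed (use S in \<open>simp_all add: op_closed closed op_add_apply op_scale_apply scale_add_right
        scale_scale mult.commute\<close>)
qed

text \<open>A bounded sesquilinear form is given by an operator: represent \<open>y \<mapsto> cnj (b x y)\<close> for each \<open>x\<close>.\<close>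

theorem form_operator:
  assumes "\<And>x y z. \<lbrakk>x \<in> carrier H; y \<in> carrier H; z \<in> carrier H\<rbrakk> \<Longrightarrow> b (x + y) z = b x z + b y z"
    and "\<And>c x z. \<lbrakk>x \<in> carrier H; z \<in> carrier H\<rbrakk> \<Longrightarrow> b (cscale H c x) z = c * b x z"
    and "\<And>x y z. \<lbrakk>x \<in> carrier H; y \<in> carrier H; z \<in> carrier H\<rbrakk> \<Longrightarrow> b x (y + z) = b x y + b x z"
    and "\<And>c x z. \<lbrakk>x \<in> carrier H; z \<in> carrier H\<rbrakk> \<Longrightarrow> b x (cscale H c z) = cnj c * b x z"
    and bdd: "\<And>x y. \<lbrakk>x \<in> carrier H; y \<in> carrier H\<rbrakk> \<Longrightarrow> cmod (b x y) \<le> M * hnorm H x * hnorm H y"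
  shows "\<exists>T\<in>bounded_ops H. \<forall>x\<in>carrier H. \<forall>y\<in>carrier H. cinner H (T x) y = b x y"
proof -
  have "\<exists>z\<in>carrier H. \<forall>y\<in>carrier H. cinner H z y = b x y" if x: "x \<in> carrier H" for x
  proof -
    obtain z where z: "z \<in> carrier H" "\<And>y. y \<in> carrier H \<Longrightarrow> cnj (b x y) = cinner H y z"
      by (rule riesz_representation[of "\<lambda>y. cnj (b x y)" "M * hnorm H x"])
        (use x assms in auto)
    have "cinner H z y = b x y" if "y \<in> carrier H" for y
      using cinner_commute[OF that z(1)] z(2)[OF that] by (metis complex_cnj_cnj)
    then show ?thesis using z(1) by blast
  qed
  then obtain T where T: "\<And>x. x \<in> carrier H \<Longrightarrow> T x \<in> carrier H"
    "\<And>x y. \<lbrakk>x \<in> carrier H; y \<in> carrier H\<rbrakk> \<Longrightarrow> cinner H (T x) y = b x y"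
    by metis
  have eqI: "u = v" if "u \<in> carrier H" "v \<in> carrier H" "\<And>y. y \<in> carrier H \<Longrightarrow> cinner H u y = cinner H v y"
    for u v
    using cinner_definite[of "u - v"] that by (simp add: closed cinner_diff_left)
  have "restrict T (carrier H) \<in> bounded_ops H"
  proof (rule bounded_opsI[where M = M])
    show "T (x + y) = T x + T y" if "x \<in> carrier H" "y \<in> carrier H" for x y
      by (rule eqI) (use that assms T in \<open>simp_all add: closed cinner_add\<close>)
    show "T (cscale H c x) = cscale H c (T x)" if "x \<in> carrier H" for x c
      by (rule eqI) (use that assms T in \<open>simp_all add: closed cinner_scale\<close>)
    show "hnorm H (T x) \<le> M * hnorm H x" if x: "x \<in> carrier H" for x
    proof (cases "hnorm H (T x) = 0")
      case False
      then have pos: "hnorm H (T x) > 0" using hnorm_nonneg T x by (simp add: less_le)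
      have "hnorm H (T x) * hnorm H (T x) = cmod (cinner H (T x) (T x))"
        using T(1)[OF x] by (simp add: cinner_self power2_eq_square norm_mult hnorm_nonneg)
      also have "\<dots> \<le> (M * hnorm H x) * hnorm H (T x)"
        using T x bdd[OF x, of "T x"] by simp
      finally show ?thesis using pos by simp
    next
      case True
      have "0 \<le> M * hnorm H x * hnorm H x"
        using norm_ge_zero bdd[OF x x] by (rule order_trans)
      then show ?thesis
        using True hnorm_nonneg[OF x] by (cases "hnorm H x = 0") (auto simp: zero_le_mult_iff)
    qed
  qed (use T in simp)
  then show ?thesis using T by (intro bexI[of _ "restrict T (carrier H)"]) auto
qed

lemma adjoint_exists:
  assumes A: "A \<in> bounded_ops H"
  shows "\<exists>T\<in>bounded_ops H. \<forall>x\<in>carrier H. \<forall>y\<in>carrier H. cinner H (T x) y = cinner H x (A y)"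
proof -
  obtain M where M: "0 \<le> M" "\<And>x. x \<in> carrier H \<Longrightarrow> hnorm H (A x) \<le> M * hnorm H x"
    using bounded_opsE[OF A] by blast
  show ?thesis
  proof (rule form_operator[where M = M])
    show "cmod (cinner H x (A y)) \<le> M * hnorm H x * hnorm H y" if "x \<in> carrier H" "y \<in> carrier H" for x y
      using cauchy_schwarz[of x "A y"] mult_left_mono[OF M(2)[OF that(2)] hnorm_nonneg[OF that(1)]]
        that A by (simp add: op_closed mult_ac)
  qed (use A in \<open>simp_all add: op_closed op_add_apply op_scale_apply cinner_add cinner_add_right
        cinner_scale cinner_scale_right\<close>)
qed

end

section \<open>Matrices of operators\<close>

lemma sum_lessThan_add:
  "(\<Sum>i<n + m. f i) = (\<Sum>i<n. f i) + (\<Sum>i<m. f (n + i))" for n m :: nat and f :: "nat \<Rightarrow> 'b::comm_monoid_add"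
  by (induction m) (simp_all add: add.assoc)

lemma carrier_hpower:
  "x \<in> carrier (hpower H n) \<longleftrightarrow> (\<forall>i<n. x i \<in> carrier H) \<and> (\<forall>i\<ge>n. x i = 0)"
  by (simp add: hpower_def)

lemma cinner_hpower: "cinner (hpower H n) x y = (\<Sum>i<n. cinner H (x i) (y i))"
  by (simp add: hpower_def)

text \<open>The sesquilinear form of a matrix of operators; positivity of the matrix is positivity on the diagonal.\<close>

definition matrix_form ::
  "'a::ab_group_add hilbert \<Rightarrow> nat \<Rightarrow> (nat \<Rightarrow> nat \<Rightarrow> 'a \<Rightarrow> 'a) \<Rightarrow> (nat \<Rightarrow> 'a) \<Rightarrow> (nat \<Rightarrow> 'a) \<Rightarrow> complex" where
  "matrix_form H n a x y = (\<Sum>i<n. \<Sum>j<n. cinner H (a i j (x j)) (y i))"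

text \<open>The bounds whose infimum is the operator norm.\<close>

definition op_bounds :: "'a hilbert \<Rightarrow> ('a \<Rightarrow> 'a) \<Rightarrow> real set" where
  "op_bounds H T = {M. 0 \<le> M \<and> (\<forall>x\<in>carrier H. hnorm H (T x) \<le> M * hnorm H x)}"

lemma op_norm_eq_Inf: "op_norm H T = Inf (op_bounds H T)"
  by (simp add: op_norm_def op_bounds_def)

lemma op_norm_le: "M \<in> op_bounds H T \<Longrightarrow> op_norm H T \<le> M"
  unfolding op_norm_eq_Inf by (rule cInf_lower) (auto simp: op_bounds_def bdd_below_def)

text \<open>The \<open>2n \<times> 2n\<close> matrix with the \<open>n \<times> n\<close> blocks \<open>A\<close>, \<open>B\<close> in the first row and \<open>C\<close>, \<open>D\<close> in the second.\<close>

definition block_matrix :: "nat \<Rightarrow> (nat \<Rightarrow> nat \<Rightarrow> 'b) \<Rightarrow> (nat \<Rightarrow> nat \<Rightarrow> 'b) \<Rightarrow> (nat \<Rightarrow> nat \<Rightarrow> 'b) \<Rightarrow>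
    (nat \<Rightarrow> nat \<Rightarrow> 'b) \<Rightarrow> nat \<Rightarrow> nat \<Rightarrow> 'b" where
  "block_matrix n A B C D i j =
    (if i < n then if j < n then A i j else B i (j - n)
     else if j < n then C (i - n) j else D (i - n) (j - n))"

lemma matrix_form_block:
  "matrix_form H (n + n) (block_matrix n A B C D) x x =
    matrix_form H n A x x + matrix_form H n B (\<lambda>i. x (n + i)) x +
    matrix_form H n C x (\<lambda>i. x (n + i)) + matrix_form H n D (\<lambda>i. x (n + i)) (\<lambda>i. x (n + i))"
  unfolding matrix_form_def sum_lessThan_add
  by (simp add: block_matrix_def sum.distrib add_ac)

context hilbert_space
begin

lemma hnorm_hpower:
  assumes "\<And>i. i < n \<Longrightarrow> x i \<in> carrier H"
  shows "hnorm (hpower H n) x = sqrt (\<Sum>i<n. (hnorm H (x i))\<^sup>2)"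
  using assms by (simp add: hnorm_def[of "hpower H n"] cinner_hpower hnorm_power2)

lemma matrix_form_eq:
  assumes a: "\<And>i j. \<lbrakk>i < n; j < n\<rbrakk> \<Longrightarrow> a i j \<in> bounded_ops H"
    and x: "\<And>i. i < n \<Longrightarrow> x i \<in> carrier H" and y: "\<And>i. i < n \<Longrightarrow> y i \<in> carrier H"
    and w: "\<And>i. i < n \<Longrightarrow> w i = (\<Sum>j<n. a i j (x j))"
  shows "matrix_form H n a x y = (\<Sum>i<n. cinner H (w i) (y i))"
proof -
  have ac: "a i j (x j) \<in> carrier H" if "i < n" "j < n" for i j
    using op_closed[OF a x] that by blast
  have "cinner H (w i) (y i) = (\<Sum>j<n. cinner H (a i j (x j)) (y i))" if "i < n" for i
    unfolding w[OF that] by (rule cinner_sum_left) (use y ac that in auto)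
  then show ?thesis by (simp add: matrix_form_def)
qed

lemma op_bounds_hpower_iff:
  assumes "\<And>i j. \<lbrakk>i < n; j < n\<rbrakk> \<Longrightarrow> a i j \<in> bounded_ops H"
  shows "M \<in> op_bounds (hpower H n) (matrix_op H n a) \<longleftrightarrow> 0 \<le> M \<and>
    (\<forall>x. (\<forall>i<n. x i \<in> carrier H) \<longrightarrow>
      (\<Sum>i<n. (hnorm H (\<Sum>j<n. a i j (x j)))\<^sup>2) \<le> M\<^sup>2 * (\<Sum>i<n. (hnorm H (x i))\<^sup>2))"
    (is "_ \<longleftrightarrow> 0 \<le> M \<and> (\<forall>x. _ \<longrightarrow> ?le x)")
proof -
  have eq: "hnorm (hpower H n) (matrix_op H n a x) \<le> M * hnorm (hpower H n) x \<longleftrightarrow> ?le x"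
    if x: "x \<in> carrier (hpower H n)" and M: "0 \<le> M" for x
  proof -
    have c: "\<And>i. i < n \<Longrightarrow> x i \<in> carrier H" using x by (simp add: carrier_hpower)
    have ac: "\<And>i j. \<lbrakk>i < n; j < n\<rbrakk> \<Longrightarrow> a i j (x j) \<in> carrier H"
      using assms c by (rule op_closed)
    have 1: "hnorm (hpower H n) (matrix_op H n a x) = sqrt (\<Sum>i<n. (hnorm H (\<Sum>j<n. a i j (x j)))\<^sup>2)"
      by (subst hnorm_hpower) (use x ac in \<open>auto simp: matrix_op_def intro!: sum_closed\<close>)
    have 2: "M * hnorm (hpower H n) x = sqrt (M\<^sup>2 * (\<Sum>i<n. (hnorm H (x i))\<^sup>2))"
      using M c by (subst hnorm_hpower) (simp_all add: real_sqrt_mult)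
    show ?thesis unfolding 1 2 by simp
  qed
  show ?thesis
  proof
    assume L: "M \<in> op_bounds (hpower H n) (matrix_op H n a)"
    have "?le x" if x: "\<forall>i<n. x i \<in> carrier H" for x
    proof -
      let ?x = "\<lambda>i. if i < n then x i else 0"
      have xc: "?x \<in> carrier (hpower H n)" using x by (simp add: carrier_hpower)
      then have "?le ?x" using eq[OF xc] L unfolding op_bounds_def by blast
      then show ?thesis by (simp)
    qed
    then show "0 \<le> M \<and> (\<forall>x. (\<forall>i<n. x i \<in> carrier H) \<longrightarrow> ?le x)"
      using L by (auto simp: op_bounds_def)
  next
    assume "0 \<le> M \<and> (\<forall>x. (\<forall>i<n. x i \<in> carrier H) \<longrightarrow> ?le x)"
    then show "M \<in> op_bounds (hpower H n) (matrix_op H n a)"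
      using eq by (auto simp: op_bounds_def carrier_hpower)
  qed
qed

lemma op_bounds_hpowerD:
  assumes "\<And>i j. \<lbrakk>i < n; j < n\<rbrakk> \<Longrightarrow> a i j \<in> bounded_ops H"
    and "M \<in> op_bounds (hpower H n) (matrix_op H n a)"
    and "\<And>i. i < n \<Longrightarrow> x i \<in> carrier H"
  shows "(\<Sum>i<n. (hnorm H (\<Sum>j<n. a i j (x j)))\<^sup>2) \<le> M\<^sup>2 * (\<Sum>i<n. (hnorm H (x i))\<^sup>2)"
  using op_bounds_hpower_iff[of n a M] assms by blast

lemma positive_matrix_op_iff:
  assumes "\<And>i j. \<lbrakk>i < n; j < n\<rbrakk> \<Longrightarrow> a i j \<in> bounded_ops H"
  shows "positive_op (hpower H n) (matrix_op H n a) \<longleftrightarrow>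
    (\<forall>x. (\<forall>i<n. x i \<in> carrier H) \<longrightarrow> matrix_form H n a x x \<in> \<real>\<^sub>\<ge>\<^sub>0)"
proof -
  have eq: "cinner (hpower H n) (matrix_op H n a x) x = matrix_form H n a x x"
    if x: "x \<in> carrier (hpower H n)" for x
  proof -
    have c: "x i \<in> carrier H" if "i < n" for i using x that by (simp add: carrier_hpower)
    have "matrix_form H n a x x = (\<Sum>i<n. cinner H (\<Sum>j<n. a i j (x j)) (x i))"
      by (rule matrix_form_eq) (use assms c in auto)
    then show ?thesis using x by (simp add: cinner_hpower matrix_op_def)
  qed
  show ?thesis
  proof
    assume L: "positive_op (hpower H n) (matrix_op H n a)"
    show "\<forall>x. (\<forall>i<n. x i \<in> carrier H) \<longrightarrow> matrix_form H n a x x \<in> \<real>\<^sub>\<ge>\<^sub>0"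
    proof (intro allI impI)
      fix x assume x: "\<forall>i<n. x i \<in> carrier H"
      let ?x = "\<lambda>i. if i < n then x i else 0"
      have xc: "?x \<in> carrier (hpower H n)" using x by (simp add: carrier_hpower)
      then have "matrix_form H n a ?x ?x \<in> \<real>\<^sub>\<ge>\<^sub>0"
        using L unfolding positive_op_def eq[OF xc, symmetric] by blast
      also have "matrix_form H n a ?x ?x = matrix_form H n a x x"
        by (simp add: matrix_form_def)
      finally show "matrix_form H n a x x \<in> \<real>\<^sub>\<ge>\<^sub>0" .
    qed
  next
    assume "\<forall>x. (\<forall>i<n. x i \<in> carrier H) \<longrightarrow> matrix_form H n a x x \<in> \<real>\<^sub>\<ge>\<^sub>0"
    then show "positive_op (hpower H n) (matrix_op H n a)"
      by (auto simp: positive_op_def eq) (simp add: carrier_hpower)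
  qed
qed

lemma op_bounds_hpower_one:
  assumes T: "T \<in> bounded_ops H"
  shows "op_bounds (hpower H 1) (matrix_op H 1 (\<lambda>_ _. T)) = op_bounds H T"
proof -
  have "M \<in> op_bounds (hpower H 1) (matrix_op H 1 (\<lambda>_ _. T)) \<longleftrightarrow> M \<in> op_bounds H T" for M
  proof -
  have sq: "(hnorm H (T x))\<^sup>2 \<le> M\<^sup>2 * (hnorm H x)\<^sup>2 \<longleftrightarrow> hnorm H (T x) \<le> M * hnorm H x"
    if "0 \<le> M" "x \<in> carrier H" for x
    using that T by (simp add: hnorm_nonneg op_closed power_mono_iff flip: power_mult_distrib)
  have ex: "(\<forall>f. f 0 \<in> carrier H \<longrightarrow> P (f 0)) \<longleftrightarrow> (\<forall>x\<in>carrier H. P x)" for P :: "'a \<Rightarrow> bool"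
    by (auto dest: spec[of _ "\<lambda>_. x" for x])
  have "M \<in> op_bounds (hpower H 1) (matrix_op H 1 (\<lambda>_ _. T)) \<longleftrightarrow> 0 \<le> M \<and>
    (\<forall>f :: nat \<Rightarrow> 'a. f 0 \<in> carrier H \<longrightarrow> (hnorm H (T (f 0)))\<^sup>2 \<le> M\<^sup>2 * (hnorm H (f 0))\<^sup>2)"
    by (subst op_bounds_hpower_iff) (use T in auto)
  also have "\<dots> \<longleftrightarrow> M \<in> op_bounds H T"
    unfolding ex[of "\<lambda>x. (hnorm H (T x))\<^sup>2 \<le> M\<^sup>2 * (hnorm H x)\<^sup>2"]
    using sq by (auto simp: op_bounds_def)
  finally show ?thesis .
  qed
  then show ?thesis by blast
qed

lemma op_bounds_nonempty: "T \<in> bounded_ops H \<Longrightarrow> op_bounds H T \<noteq> {}"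
  by (rule bounded_opsE[of T]) (auto simp: op_bounds_def)

lemma op_norm_nonneg: "T \<in> bounded_ops H \<Longrightarrow> 0 \<le> op_norm H T"
  unfolding op_norm_eq_Inf
  using op_bounds_nonempty by (intro cInf_greatest) (auto simp: op_bounds_def)

lemma hnorm_op_le:
  assumes T: "T \<in> bounded_ops H" and x: "x \<in> carrier H"
  shows "hnorm H (T x) \<le> op_norm H T * hnorm H x"
proof (cases "hnorm H x = 0")
  case True
  obtain M where "hnorm H (T x) \<le> M * hnorm H x"
    using bounded_opsE[OF T] x by metis
  then show ?thesis using True by simp
next
  case False
  then have pos: "hnorm H x > 0" using hnorm_nonneg[OF x] by simp
  have "hnorm H (T x) / hnorm H x \<le> op_norm H T"
    unfolding op_norm_eq_Inf
    using op_bounds_nonempty[OF T] pos x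
    by (intro cInf_greatest) (auto simp: op_bounds_def divide_le_eq)
  then show ?thesis using pos by (simp add: divide_le_eq)
qed

lemma op_norm_in_bounds: "T \<in> bounded_ops H \<Longrightarrow> op_norm H T \<in> op_bounds H T"
  using hnorm_op_le op_norm_nonneg by (auto simp: op_bounds_def)

lemma op_norm_eq_0_imp:
  assumes "T \<in> bounded_ops H" "op_norm H T \<le> 0" "x \<in> carrier H"
  shows "T x = 0"
proof -
  have "hnorm H (T x) \<le> op_norm H T * hnorm H x" by (rule hnorm_op_le[OF assms(1,3)])
  also have "\<dots> \<le> 0" using assms by (simp add: mult_le_0_iff hnorm_nonneg)
  finally show ?thesis
    using hnorm_nonneg[of "T x"] hnorm_eq_0_iff[of "T x"] assms by (simp add: op_closed)
qed

lemma matrix_form_scalar: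
  assumes "\<And>i. i < n \<Longrightarrow> x i \<in> carrier H"
  shows "matrix_form H n (\<lambda>i j. op_scale H (if i = j then of_real M else 0) (op_one H)) x x
    = of_real (M * (\<Sum>i<n. (hnorm H (x i))\<^sup>2))"
proof -
  have "matrix_form H n (\<lambda>i j. op_scale H (if i = j then of_real M else 0) (op_one H)) x x
    = (\<Sum>i<n. \<Sum>j<n. if i = j then of_real (M * (hnorm H (x i))\<^sup>2) else 0)"
    unfolding matrix_form_def
    using assms by (intro sum.cong)
      (auto simp: op_scale_def op_one_def cinner_scale cinner_self scale_zero_left cinner_zero_left closed)
  then show ?thesis by (simp add: sum_distrib_left)
qed

end


section \<open>Unital completely positive maps are completely contractive\<close>

text \<open>
  If \<open>a\<close> is bounded by \<open>M\<close>, then the block matrix with diagonal blocks \<open>M\<close> and off-diagonal blocks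
  \<open>a\<close> and its adjoint is positive, hence so is its image.  Only positivity of the image is used, not
  that \<open>\<theta>\<close> preserves adjoints.
\<close>

lemma ucp_op_bounds:
  assumes H: "hilbert_space H" and K: "hilbert_space K"
    and \<theta>: "gamma_map G H \<pi> (bounded_ops H) K \<rho> (bounded_ops K) \<theta>"
    and a: "\<And>i j. \<lbrakk>i < n; j < n\<rbrakk> \<Longrightarrow> a i j \<in> bounded_ops H"
    and M: "M \<in> op_bounds (hpower H n) (matrix_op H n a)"
  shows "M \<in> op_bounds (hpower K n) (matrix_op K n (\<lambda>i j. \<theta> (a i j)))"
proof -
  interpret H: hilbert_space H by fact
  interpret K: hilbert_space K by fact
  interpret \<theta>: gamma_map G H \<pi> "bounded_ops H" K \<rho> "bounded_ops K" \<theta> by fact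
  have \<theta>_closed: "\<theta> T \<in> bounded_ops K" if "T \<in> bounded_ops H" for T
    using \<theta>.maps_to that by auto
  have M0: "0 \<le> M" using M by (simp add: op_bounds_def)
  obtain adj where adj: "\<And>A. A \<in> bounded_ops H \<Longrightarrow> adj A \<in> bounded_ops H"
    "\<And>A x y. \<lbrakk>A \<in> bounded_ops H; x \<in> carrier H; y \<in> carrier H\<rbrakk>
      \<Longrightarrow> cinner H (adj A x) y = cinner H x (A y)"
    using H.adjoint_exists by metis
  define D where "D = (\<lambda>i j :: nat. op_scale H (if i = j then of_real M else 0) (op_one H))"
  define P where "P = block_matrix n D a (\<lambda>i j. adj (a j i)) D"
  have P: "P i j \<in> bounded_ops H" if "i < n + n" "j < n + n" for i j
    using that a adj(1) unfolding P_def block_matrix_def D_def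
    by (auto intro!: H.op_scale_closed H.op_one_closed)
  have "positive_op (hpower H (n + n)) (matrix_op H (n + n) P)"
  proof (subst H.positive_matrix_op_iff[OF P], assumption, assumption, intro allI impI)
    fix x assume x: "\<forall>i<n + n. x i \<in> carrier H"
    define v where "v i = x (n + i)" for i
    have u: "x i \<in> carrier H" and v: "v i \<in> carrier H" if "i < n" for i
      using x that by (simp_all add: v_def)
    define w where "w i = (\<Sum>j<n. a i j (v j))" for i
    have w: "w i \<in> carrier H" if "i < n" for i
      unfolding w_def by (rule H.sum_closed, rule H.op_closed) (use that a v in auto)
    define U where "U = (\<Sum>i<n. (hnorm H (x i))\<^sup>2)"
    define V where "V = (\<Sum>i<n. (hnorm H (v i))\<^sup>2)"
    define W where "W = (\<Sum>i<n. (hnorm H (w i))\<^sup>2)"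
    define p where "p = matrix_form H n a v x"
    have "W \<le> M\<^sup>2 * V"
      unfolding W_def V_def w_def by (rule H.op_bounds_hpowerD[OF _ M]) (use a v in auto)
    have p: "p = (\<Sum>i<n. cinner H (w i) (x i))"
      unfolding p_def by (rule H.matrix_form_eq) (use a u v in \<open>auto simp: w_def\<close>)
    have "cinner H (adj (a j i) (x j)) (v i) = cnj (cinner H (a j i (v i)) (x j))"
      if "i < n" "j < n" for i j
      using adj(2)[OF a u v, of j i j i] H.cinner_commute[OF H.op_closed[OF a v] u, of j i i j] that
      by simp
    then have "matrix_form H n (\<lambda>i j. adj (a j i)) x v = (\<Sum>i<n. \<Sum>j<n. cnj (cinner H (a j i (v i)) (x j)))"
      by (simp add: matrix_form_def)
    also have "\<dots> = cnj p"
      unfolding p_def matrix_form_def cnj_sum by (rule sum.swap)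
    finally have "matrix_form H (n + n) P x x = of_real (M * U) + p + cnj p + of_real (M * V)"
      unfolding P_def matrix_form_block v_def[symmetric] D_def p_def[symmetric]
      using u v by (simp add: H.matrix_form_scalar U_def V_def)
    also have "\<dots> = of_real (M * U + M * V + 2 * Re p)"
      by (simp add: complex_eq_iff)
    finally have form: "matrix_form H (n + n) P x x = of_real (M * U + M * V + 2 * Re p)" .
    have "0 \<le> M * U + M * V + 2 * Re p"
    proof (cases "M = 0")
      case True
      have "W = 0" using \<open>W \<le> M\<^sup>2 * V\<close> True by (simp add: W_def sum_nonneg antisym)
      then have "w i = 0" if "i < n" for i
        using that w H.hnorm_eq_0_iff by (simp add: W_def sum_nonneg_eq_0_iff)
      then have "p = 0" using u by (simp add: p H.cinner_zero_left)
      then show ?thesis using True by simp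
    next
      case False
      have "0 \<le> (\<Sum>i<n. (hnorm H (w i + cscale H (of_real M) (x i)))\<^sup>2)"
        by (simp add: sum_nonneg)
      also have "\<dots> = (\<Sum>i<n. (hnorm H (w i))\<^sup>2 + M\<^sup>2 * (hnorm H (x i))\<^sup>2 + 2 * M * Re (cinner H (w i) (x i)))"
        using w u by (intro sum.cong refl)
          (simp add: H.hnorm_add_power2 H.closed H.hnorm_scale power_mult_distrib H.cinner_scale_right)
      also have "\<dots> = W + M\<^sup>2 * U + 2 * M * Re p"
        by (simp add: sum.distrib W_def U_def p sum_distrib_left)
      also have "\<dots> \<le> M * (M * U + M * V + 2 * Re p)"
        using \<open>W \<le> M\<^sup>2 * V\<close> by (simp add: algebra_simps power2_eq_square)
      finally show ?thesis using False M0 by (simp add: zero_le_mult_iff)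
    qed
    then show "matrix_form H (n + n) P x x \<in> \<real>\<^sub>\<ge>\<^sub>0"
      unfolding form by (simp add: complex_nonneg_Reals_iff)
  qed
  then have "positive_op (hpower K (n + n)) (matrix_op K (n + n) (\<lambda>i j. \<theta> (P i j)))"
    using P by (rule \<theta>.completely_positive[rotated])
  then have pos: "matrix_form K (n + n) (\<lambda>i j. \<theta> (P i j)) x x \<in> \<real>\<^sub>\<ge>\<^sub>0"
    if "\<forall>i<n + n. x i \<in> carrier K" for x
    using that P \<theta>_closed by (subst (asm) K.positive_matrix_op_iff) auto
  define D' where "D' = (\<lambda>i j :: nat. op_scale K (if i = j then of_real M else 0) (op_one K))"
  define A where "A i j = \<theta> (a i j)" for i j
  define B where "B i j = \<theta> (adj (a j i))" for i j
  have A: "A i j \<in> bounded_ops K" and B: "B i j \<in> bounded_ops K" if "i < n" "j < n" for i j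
    using that a adj by (auto simp: A_def B_def intro!: \<theta>_closed)
  have "\<theta> (D i j) = D' i j" for i j
    by (simp add: D_def D'_def \<theta>.homogeneous H.op_one_closed \<theta>.unital)
  then have "(\<lambda>i j. \<theta> (P i j)) = block_matrix n D' A B D'"
    by (intro ext) (simp add: P_def block_matrix_def A_def B_def)
  note pos = pos[unfolded this matrix_form_block]
  have pos: "of_real (M * (\<Sum>i<n. (hnorm K (u i))\<^sup>2)) + matrix_form K n A v u + matrix_form K n B u v
      + of_real (M * (\<Sum>i<n. (hnorm K (v i))\<^sup>2)) \<in> \<real>\<^sub>\<ge>\<^sub>0"
    if u: "\<And>i. i < n \<Longrightarrow> u i \<in> carrier K" and v: "\<And>i. i < n \<Longrightarrow> v i \<in> carrier K" for u v
  proof -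
    define x where "x i = (if i < n then u i else v (i - n))" for i
    have "\<forall>i<n + n. x i \<in> carrier K" using u v by (auto simp: x_def)
    then have p: "matrix_form K n D' x x + matrix_form K n A (\<lambda>i. x (n + i)) x
      + matrix_form K n B x (\<lambda>i. x (n + i)) + matrix_form K n D' (\<lambda>i. x (n + i)) (\<lambda>i. x (n + i)) \<in> \<real>\<^sub>\<ge>\<^sub>0"
      by (rule pos)
    have e: "matrix_form K n D' x x = matrix_form K n D' u u"
      "matrix_form K n A v x = matrix_form K n A v u"
      "matrix_form K n B x v = matrix_form K n B u v"
      "(\<lambda>i. x (n + i)) = v"
      by (auto simp: matrix_form_def x_def)
    show ?thesis
      using p u v unfolding e unfolding D'_def by (simp only: K.matrix_form_scalar)
  qed
  show ?thesis
    unfolding A_def[symmetric]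
  proof (subst K.op_bounds_hpower_iff[OF A], assumption, assumption, intro conjI allI impI M0)
    fix v assume "\<forall>i<n. v i \<in> carrier K"
    then have v: "\<And>i. i < n \<Longrightarrow> v i \<in> carrier K" by blast
    define w where "w i = (\<Sum>j<n. A i j (v j))" for i
    have w: "w i \<in> carrier K" if "i < n" for i
      unfolding w_def by (rule K.sum_closed, rule K.op_closed) (use that A v in auto)
    \<comment> \<open>For \<open>M > 0\<close> this multiple of \<open>w\<close> minimises the quadratic form; for \<open>M = 0\<close> any positive multiple
      shows that \<open>w\<close> vanishes.\<close>
    define s where "s = (if M = 0 then 1 else 1 / M)"
    define u where "u i = cscale K (- of_real s) (w i)" for i
    have u: "u i \<in> carrier K" if "i < n" for i
      using w[OF that] by (simp add: u_def K.closed)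
    define V where "V = (\<Sum>i<n. (hnorm K (v i))\<^sup>2)"
    define W where "W = (\<Sum>i<n. (hnorm K (w i))\<^sup>2)"
    have U: "(\<Sum>i<n. (hnorm K (u i))\<^sup>2) = s\<^sup>2 * W"
      using w by (simp add: u_def W_def K.hnorm_scale power_mult_distrib sum_distrib_left)
    have "matrix_form K n A v u = (\<Sum>i<n. cinner K (w i) (u i))"
      by (rule K.matrix_form_eq) (use A u v in \<open>auto simp: w_def\<close>)
    also have "\<dots> = of_real (- s * W)"
      using w by (simp add: u_def W_def K.cinner_scale_right K.cinner_self sum_distrib_left sum_negf)
    finally have p: "matrix_form K n A v u = of_real (- s * W)" .
    define q where "q = matrix_form K n B u v"
    have r1: "of_real (M * (s\<^sup>2 * W)) + of_real (- s * W) + q + of_real (M * V) \<in> \<real>\<^sub>\<ge>\<^sub>0"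
      unfolding p[symmetric] U[symmetric] q_def V_def using u v by (rule pos)
    \<comment> \<open>Multiplying \<open>v\<close> by the imaginary unit shows that \<open>q\<close> has the same real part as the form of \<open>A\<close>.\<close>
    define v' where "v' i = cscale K \<i> (v i)" for i
    have v': "v' i \<in> carrier K" if "i < n" for i
      using v[OF that] by (simp add: v'_def K.closed)
    have "matrix_form K n A v' u = \<i> * matrix_form K n A v u"
      "matrix_form K n B u v' = - \<i> * matrix_form K n B u v"
      using A B u v by (simp_all add: matrix_form_def v'_def K.op_scale_apply K.op_closed
          K.cinner_scale K.cinner_scale_right sum_distrib_left sum_negf)
    moreover have "(\<Sum>i<n. (hnorm K (v' i))\<^sup>2) = V"
      using v by (simp add: v'_def V_def K.hnorm_scale)
    moreover have "of_real (M * (\<Sum>i<n. (hnorm K (u i))\<^sup>2)) + matrix_form K n A v' u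
        + matrix_form K n B u v' + of_real (M * (\<Sum>i<n. (hnorm K (v' i))\<^sup>2)) \<in> \<real>\<^sub>\<ge>\<^sub>0"
      using u v' by (rule pos)
    ultimately have "of_real (M * (s\<^sup>2 * W)) + \<i> * of_real (- s * W) + - \<i> * q + of_real (M * V) \<in> \<real>\<^sub>\<ge>\<^sub>0"
      by (simp only: U p q_def)
    then have "Re q = - s * W"
      by (simp add: complex_nonneg_Reals_iff)
    with r1 have "0 \<le> M * (s\<^sup>2 * W) - 2 * s * W + M * V"
      by (simp add: complex_nonneg_Reals_iff mult_ac)
    then have "W \<le> M\<^sup>2 * V"
      using M0 by (cases "M = 0") (auto simp: s_def field_simps power2_eq_square)
    then show "(\<Sum>i<n. (hnorm K (\<Sum>j<n. A i j (v j)))\<^sup>2) \<le> M\<^sup>2 * (\<Sum>i<n. (hnorm K (v i))\<^sup>2)"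
      by (simp add: W_def V_def w_def)
  qed
qed

corollary ucp_contractive:
  assumes H: "hilbert_space H" and K: "hilbert_space K"
    and \<theta>: "gamma_map G H \<pi> (bounded_ops H) K \<rho> (bounded_ops K) \<theta>"
    and T: "T \<in> bounded_ops H"
  shows "op_norm K (\<theta> T) \<le> op_norm H T"
proof -
  interpret H: hilbert_space H by fact
  interpret K: hilbert_space K by fact
  have "\<theta> T \<in> bounded_ops K" using gamma_map.maps_to[OF \<theta>] T by auto
  then show ?thesis
    using ucp_op_bounds[OF H K \<theta>, of 1 "\<lambda>_ _. T" "op_norm H T"] T
    by (simp only: H.op_bounds_hpower_one K.op_bounds_hpower_one H.op_norm_in_bounds op_norm_le)
qed

section \<open>Composing \<open>\<Gamma>\<close>-maps\<close>

context unitary_rep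
begin

lemma group_G: "group G"
  using group_hom group_hom.axioms(1) by blast

lemma inv_closed: "g \<in> carrier G \<Longrightarrow> inv g \<in> carrier G"
  using group_G by (rule group.inv_closed)

lemma rep_closed: "\<lbrakk>g \<in> carrier G; x \<in> carrier H\<rbrakk> \<Longrightarrow> \<pi> g x \<in> carrier H"
  using element_image by blast

lemma rep_inv: "\<lbrakk>g \<in> carrier G; x \<in> carrier H\<rbrakk> \<Longrightarrow> \<pi> (inv g) (\<pi> g x) = x"
  using orbit_sym_aux by blast

lemma rep_inv': "\<lbrakk>g \<in> carrier G; x \<in> carrier H\<rbrakk> \<Longrightarrow> \<pi> g (\<pi> (inv g) x) = x"
  using rep_inv[of "inv g" x] by (simp add: inv_closed group.inv_inv[OF group_G])

lemma rep_add: "\<lbrakk>g \<in> carrier G; x \<in> carrier H; y \<in> carrier H\<rbrakk> \<Longrightarrow> \<pi> g (x + y) = \<pi> g x + \<pi> g y"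
  using linear by (simp add: clinear_on_def)

lemma rep_scale: "\<lbrakk>g \<in> carrier G; x \<in> carrier H\<rbrakk> \<Longrightarrow> \<pi> g (cscale H c x) = cscale H c (\<pi> g x)"
  using linear by (simp add: clinear_on_def)

lemma rep_diff: "\<lbrakk>g \<in> carrier G; x \<in> carrier H; y \<in> carrier H\<rbrakk> \<Longrightarrow> \<pi> g (x - y) = \<pi> g x - \<pi> g y"
  using rep_add[of g "x - y" y] by (simp add: closed)

lemma hnorm_rep: "\<lbrakk>g \<in> carrier G; x \<in> carrier H\<rbrakk> \<Longrightarrow> hnorm H (\<pi> g x) = hnorm H x"
  by (simp add: hnorm_def isometric)

lemma cinner_rep_left:
  "\<lbrakk>g \<in> carrier G; x \<in> carrier H; y \<in> carrier H\<rbrakk> \<Longrightarrow> cinner H (\<pi> g x) y = cinner H x (\<pi> (inv g) y)"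
  using isometric[of g x "\<pi> (inv g) y"] by (simp add: rep_inv' rep_closed inv_closed)

lemma op_action_apply:
  "\<lbrakk>g \<in> carrier G; x \<in> carrier H\<rbrakk> \<Longrightarrow> op_action G H \<pi> g T x = \<pi> g (T (\<pi> (inv g) x))"
  by (simp add: op_action_def compose_def)

lemma op_action_closed:
  assumes g: "g \<in> carrier G" and T: "T \<in> bounded_ops H"
  shows "op_action G H \<pi> g T \<in> bounded_ops H"
proof -
  obtain M where M: "\<And>x. x \<in> carrier H \<Longrightarrow> hnorm H (T x) \<le> M * hnorm H x"
    using bounded_opsE[OF T] by blast
  have "op_action G H \<pi> g T = restrict (\<lambda>x. \<pi> g (T (\<pi> (inv g) x))) (carrier H)"
    by (rule ext) (simp add: op_action_def compose_def restrict_def)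
  also have "\<dots> \<in> bounded_ops H"
  proof (rule bounded_opsI[where M = M])
    show "hnorm H (\<pi> g (T (\<pi> (inv g) x))) \<le> M * hnorm H x" if "x \<in> carrier H" for x
      using M[of "\<pi> (inv g) x"] that g by (simp add: hnorm_rep rep_closed op_closed[OF T] inv_closed)
  qed (use g in \<open>simp_all add: rep_closed rep_add rep_scale op_closed[OF T] op_add_apply[OF T]
        op_scale_apply[OF T] inv_closed\<close>)
  finally show ?thesis .
qed

lemma op_action_add:
  assumes "g \<in> carrier G" "S \<in> bounded_ops H" "T \<in> bounded_ops H"
  shows "op_action G H \<pi> g (op_add H S T) = op_add H (op_action G H \<pi> g S) (op_action G H \<pi> g T)"
  using assms
  by (intro op_eqI op_action_closed op_add_closed)
    (simp_all add: op_action_apply op_add_eval rep_closed inv_closed rep_add op_closed)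

lemma op_action_scale:
  assumes "g \<in> carrier G" "T \<in> bounded_ops H"
  shows "op_action G H \<pi> g (op_scale H c T) = op_scale H c (op_action G H \<pi> g T)"
  using assms
  by (intro op_eqI op_action_closed op_scale_closed)
    (simp_all add: op_action_apply op_scale_eval rep_closed inv_closed rep_scale op_closed)

end

lemma gamma_map_compose:
  assumes "gamma_map G H \<pi> S K \<rho> S' \<theta>" "gamma_map G K \<rho> S' L \<sigma> S'' \<eta>"
  shows "gamma_map G H \<pi> S L \<sigma> S'' (\<lambda>x. \<eta> (\<theta> x))"
proof -
  interpret \<theta>: gamma_map G H \<pi> S K \<rho> S' \<theta> by fact
  interpret \<eta>: gamma_map G K \<rho> S' L \<sigma> S'' \<eta> by fact
  have m: "\<theta> x \<in> S'" if "x \<in> S" for x using \<theta>.maps_to that by auto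
  show ?thesis
  proof
    show "(\<lambda>x. \<eta> (\<theta> x)) \<in> S \<rightarrow> S''" using \<theta>.maps_to \<eta>.maps_to by auto
    show "positive_op (hpower L n) (matrix_op L n (\<lambda>i j. \<eta> (\<theta> (a i j))))"
      if "\<And>i j. \<lbrakk>i < n; j < n\<rbrakk> \<Longrightarrow> a i j \<in> S" "positive_op (hpower H n) (matrix_op H n a)" for n a
    proof (rule \<eta>.completely_positive)
      show "\<theta> (a i j) \<in> S'" if "i < n" "j < n" for i j using m \<open>\<And>i j. \<lbrakk>i < n; j < n\<rbrakk> \<Longrightarrow> a i j \<in> S\<close> that by blast
      show "positive_op (hpower K n) (matrix_op K n (\<lambda>i j. \<theta> (a i j)))"
        by (rule \<theta>.completely_positive) (use that in auto)
    qed
  qed (simp_all add: m \<theta>.additive \<eta>.additive \<theta>.homogeneous \<eta>.homogeneous \<theta>.unital \<eta>.unital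
      \<theta>.equivariant \<eta>.equivariant)
qed

lemma gamma_map_restrict:
  assumes "gamma_map G H \<pi> S K \<rho> S' \<theta>" "T \<subseteq> S" "\<theta> ` T \<subseteq> T'"
  shows "gamma_map G H \<pi> T K \<rho> T' \<theta>"
proof -
  interpret \<theta>: gamma_map G H \<pi> S K \<rho> S' \<theta> by fact
  show ?thesis
  proof
    show "positive_op (hpower K n) (matrix_op K n (\<lambda>i j. \<theta> (a i j)))"
      if "\<And>i j. \<lbrakk>i < n; j < n\<rbrakk> \<Longrightarrow> a i j \<in> T" "positive_op (hpower H n) (matrix_op H n a)" for n a
      using that assms(2) by (intro \<theta>.completely_positive) auto
  qed (use assms in \<open>auto simp: \<theta>.additive \<theta>.homogeneous \<theta>.unital \<theta>.equivariant subset_iff\<close>)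
qed

lemma (in unitary_rep) gamma_endo_convex:
  assumes \<phi>: "gamma_endo G H \<pi> \<phi>" and \<psi>: "gamma_endo G H \<pi> \<psi>" and t: "0 \<le> t" "t \<le> 1"
  shows "gamma_endo G H \<pi>
    (\<lambda>x. op_add H (op_scale H (of_real t) (\<phi> x)) (op_scale H (of_real (1 - t)) (\<psi> x)))"
    (is "gamma_endo G H \<pi> ?\<chi>")
proof -
  interpret \<phi>: gamma_map G H \<pi> "bounded_ops H" H \<pi> "bounded_ops H" \<phi> by fact
  interpret \<psi>: gamma_map G H \<pi> "bounded_ops H" H \<pi> "bounded_ops H" \<psi> by fact
  have m: "\<phi> x \<in> bounded_ops H" "\<psi> x \<in> bounded_ops H" if "x \<in> bounded_ops H" for x
    using \<phi>.maps_to \<psi>.maps_to that by auto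
  have mc: "?\<chi> x \<in> bounded_ops H" if "x \<in> bounded_ops H" for x
    using m[OF that] by (intro op_add_closed op_scale_closed)
  show ?thesis
  proof
    show "?\<chi> \<in> bounded_ops H \<rightarrow> bounded_ops H" using mc by blast
    show "?\<chi> (op_add H x y) = op_add H (?\<chi> x) (?\<chi> y)"
      if "x \<in> bounded_ops H" "y \<in> bounded_ops H" for x y
      using that m
      by (intro op_eqI mc op_add_closed)
        (simp_all add: \<phi>.additive \<psi>.additive op_add_eval op_scale_eval op_closed scale_add_right algebra_simps)
    show "?\<chi> (op_scale H c x) = op_scale H c (?\<chi> x)" if "x \<in> bounded_ops H" for x c
      using that m
      by (intro op_eqI mc op_scale_closed)
        (simp_all add: \<phi>.homogeneous \<psi>.homogeneous op_add_eval op_scale_eval op_closed scale_add_right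
          scale_scale mult.commute)
    show "?\<chi> (op_one H) = op_one H"
      by (intro op_eqI mc op_one_closed)
        (simp add: \<phi>.unital \<psi>.unital op_add_eval op_scale_eval op_one_eval scale_one flip: scale_add_left)
    show "?\<chi> (op_action G H \<pi> g x) = op_action G H \<pi> g (?\<chi> x)"
      if "g \<in> carrier G" "x \<in> bounded_ops H" for g x
      using that m
      by (simp add: \<phi>.equivariant \<psi>.equivariant op_action_add op_action_scale op_scale_closed)
    show "positive_op (hpower H n) (matrix_op H n (\<lambda>i j. ?\<chi> (a i j)))"
      if a: "\<And>i j. \<lbrakk>i < n; j < n\<rbrakk> \<Longrightarrow> a i j \<in> bounded_ops H"
        and pos: "positive_op (hpower H n) (matrix_op H n a)" for n a
    proof (subst positive_matrix_op_iff)
      show "?\<chi> (a i j) \<in> bounded_ops H" if "i < n" "j < n" for i j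
        using a[OF that] by (rule mc)
      show "\<forall>x. (\<forall>i<n. x i \<in> carrier H) \<longrightarrow> matrix_form H n (\<lambda>i j. ?\<chi> (a i j)) x x \<in> \<real>\<^sub>\<ge>\<^sub>0"
      proof (intro allI impI)
        fix x assume x: "\<forall>i<n. x i \<in> carrier H"
        have "positive_op (hpower H n) (matrix_op H n (\<lambda>i j. \<phi> (a i j)))"
          "positive_op (hpower H n) (matrix_op H n (\<lambda>i j. \<psi> (a i j)))"
          using a pos by (blast intro: \<phi>.completely_positive \<psi>.completely_positive)+
        then have f: "matrix_form H n (\<lambda>i j. \<phi> (a i j)) x x \<in> \<real>\<^sub>\<ge>\<^sub>0"
          "matrix_form H n (\<lambda>i j. \<psi> (a i j)) x x \<in> \<real>\<^sub>\<ge>\<^sub>0"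
          using positive_matrix_op_iff[of n "\<lambda>i j. \<phi> (a i j)"] positive_matrix_op_iff[of n "\<lambda>i j. \<psi> (a i j)"]
            m a x by blast+
        have "cinner H (?\<chi> (a i j) (x j)) (x i) = of_real t * cinner H (\<phi> (a i j) (x j)) (x i)
            + of_real (1 - t) * cinner H (\<psi> (a i j) (x j)) (x i)" if "i < n" "j < n" for i j
        proof -
          have "\<phi> (a i j) (x j) \<in> carrier H" "\<psi> (a i j) (x j) \<in> carrier H"
            using op_closed[OF m(1)[OF a[OF that]]] op_closed[OF m(2)[OF a[OF that]]] x that by blast+
          then show ?thesis
            using x that by (simp add: op_add_eval op_scale_eval closed cinner_add cinner_scale)
        qed
        then have "matrix_form H n (\<lambda>i j. ?\<chi> (a i j)) x x
          = of_real t * matrix_form H n (\<lambda>i j. \<phi> (a i j)) x x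
            + of_real (1 - t) * matrix_form H n (\<lambda>i j. \<psi> (a i j)) x x"
          by (simp add: matrix_form_def sum_distrib_left sum.distrib)
        also have "\<dots> \<in> \<real>\<^sub>\<ge>\<^sub>0"
          using f t by (intro nonneg_Reals_add_I nonneg_Reals_mult_I) (simp_all add: complex_nonneg_Reals_iff)
        finally show "matrix_form H n (\<lambda>i j. ?\<chi> (a i j)) x x \<in> \<real>\<^sub>\<ge>\<^sub>0" .
      qed
    qed
  qed
qed


section \<open>Minimal \<open>\<Gamma>\<close>-maps\<close>

context unitary_rep
begin

lemma gamma_endo_closed: "\<lbrakk>gamma_endo G H \<pi> \<phi>; x \<in> bounded_ops H\<rbrakk> \<Longrightarrow> \<phi> x \<in> bounded_ops H"
  using gamma_map.maps_to[of G H \<pi> "bounded_ops H" H \<pi> "bounded_ops H" \<phi>] by auto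

lemma gamma_endo_contractive:
  "\<lbrakk>gamma_endo G H \<pi> \<phi>; x \<in> bounded_ops H\<rbrakk> \<Longrightarrow> op_norm H (\<phi> x) \<le> op_norm H x"
  using ucp_contractive hilbert_space_axioms by blast

lemma gamma_endo_diff:
  assumes "gamma_endo G H \<pi> \<phi>" "x \<in> bounded_ops H" "y \<in> bounded_ops H"
  shows "\<phi> (op_add H x (op_scale H (- 1) y)) = op_add H (\<phi> x) (op_scale H (- 1) (\<phi> y))"
  using gamma_map.additive[OF assms(1,2)] gamma_map.homogeneous[OF assms(1,3)] assms(3)
  by (simp add: op_scale_closed)

lemma op_diff_apply_eq:
  "v \<in> carrier H \<Longrightarrow> op_add H x (op_scale H (- 1) y) v = x v - y v"
  by (simp add: op_add_eval op_scale_eval scale_minus_one)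

text \<open>The averages of \<open>\<phi>, \<phi>\<^sup>2, \<dots>, \<phi>\<^sup>n\<close> telescope on the elements \<open>x - \<phi> x\<close>.\<close>

lemma gamma_endo_averages:
  assumes \<phi>: "gamma_endo G H \<pi> \<phi>"
  shows "\<exists>A. gamma_endo G H \<pi> A \<and> map_le H A \<phi> \<and>
    (\<forall>x\<in>bounded_ops H. \<forall>v\<in>carrier H.
      cscale H (of_nat (Suc n)) (A (op_add H x (op_scale H (- 1) (\<phi> x))) v) = \<phi> x v - (\<phi> ^^ (n + 2)) x v)"
proof (induction n)
  case 0
  have "cscale H (of_nat 1) (\<phi> (op_add H x (op_scale H (- 1) (\<phi> x))) v) = \<phi> x v - (\<phi> ^^ 2) x v"
    if "x \<in> bounded_ops H" "v \<in> carrier H" for x v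
    using that gamma_endo_diff[OF \<phi> that(1) gamma_endo_closed[OF \<phi> that(1)]]
    by (simp add: op_diff_apply_eq scale_one numeral_2_eq_2)
  then show ?case using \<phi> by (intro exI[of _ \<phi>]) (simp add: map_le_def numeral_2_eq_2)
next
  case (Suc n)
  then obtain A where A: "gamma_endo G H \<pi> A" "map_le H A \<phi>"
    "\<And>x v. \<lbrakk>x \<in> bounded_ops H; v \<in> carrier H\<rbrakk> \<Longrightarrow>
      cscale H (of_nat (Suc n)) (A (op_add H x (op_scale H (- 1) (\<phi> x))) v) = \<phi> x v - (\<phi> ^^ (n + 2)) x v"
    by blast
  have pow: "gamma_endo G H \<pi> (\<phi> ^^ Suc k) \<and> map_le H (\<phi> ^^ Suc k) \<phi>" for k
  proof (induction k)
    case 0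
    then show ?case using \<phi> by (simp add: map_le_def)
  next
    case (Suc k)
    have "gamma_endo G H \<pi> (\<lambda>x. \<phi> ((\<phi> ^^ Suc k) x))"
      using gamma_map_compose Suc \<phi> by blast
    moreover have "op_norm H (\<phi> ((\<phi> ^^ Suc k) x)) \<le> op_norm H (\<phi> x)" if "x \<in> bounded_ops H" for x
      using gamma_endo_contractive[OF \<phi>] gamma_endo_closed Suc that unfolding map_le_def
      by (blast intro: order_trans)
    ultimately show ?case by (simp add: map_le_def comp_def)
  qed
  define P where "P = \<phi> ^^ (n + 2)"
  have P: "gamma_endo G H \<pi> P" "map_le H P \<phi>"
    using pow[of "Suc n"] by (simp_all add: P_def del: funpow.simps)
  define t where "t = real (Suc n) / real (n + 2)"
  have t: "0 \<le> t" "t \<le> 1" by (auto simp: t_def)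
  define B where "B x = op_add H (op_scale H (of_real t) (A x)) (op_scale H (of_real (1 - t)) (P x))" for x
  have B: "gamma_endo G H \<pi> B"
    unfolding B_def using gamma_endo_convex[OF A(1) P(1) t] .
  moreover have "map_le H B \<phi>"
    unfolding map_le_def
  proof
    fix x assume x: "x \<in> bounded_ops H"
    have Ax: "A x \<in> bounded_ops H" "P x \<in> bounded_ops H" "\<phi> x \<in> bounded_ops H"
      using gamma_endo_closed A P \<phi> x by blast+
    have le: "op_norm H (A x) \<le> op_norm H (\<phi> x)" "op_norm H (P x) \<le> op_norm H (\<phi> x)"
      using A(2) P(2) x by (auto simp: map_le_def)
    show "op_norm H (B x) \<le> op_norm H (\<phi> x)"
    proof (rule op_norm_le, unfold op_bounds_def, intro CollectI conjI ballI)
      fix v assume v: "v \<in> carrier H"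
      have "hnorm H (B x v) \<le> t * hnorm H (A x v) + (1 - t) * hnorm H (P x v)"
        using hnorm_triangle[of "cscale H (of_real t) (A x v)" "cscale H (of_real (1 - t)) (P x v)"] Ax v t
        by (simp add: B_def op_add_eval op_scale_eval closed op_closed hnorm_scale del: of_real_diff)
      also have "\<dots> \<le> t * (op_norm H (\<phi> x) * hnorm H v) + (1 - t) * (op_norm H (\<phi> x) * hnorm H v)"
        using t Ax v le
        by (intro add_mono mult_left_mono order_trans[OF hnorm_op_le] mult_right_mono) (auto simp: hnorm_nonneg)
      finally show "hnorm H (B x v) \<le> op_norm H (\<phi> x) * hnorm H v" by (simp add: algebra_simps)
    qed (use Ax op_norm_nonneg in blast)
  qed
  moreover have "cscale H (of_nat (Suc (Suc n))) (B (op_add H x (op_scale H (- 1) (\<phi> x))) v)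
      = \<phi> x v - (\<phi> ^^ (Suc n + 2)) x v" if x: "x \<in> bounded_ops H" and v: "v \<in> carrier H" for x v
  proof -
    let ?y = "op_add H x (op_scale H (- 1) (\<phi> x))"
    have \<phi>x: "\<phi> x \<in> bounded_ops H" using gamma_endo_closed \<phi> x by blast
    have "P ?y v = P x v - P (\<phi> x) v"
      using gamma_endo_diff[OF P(1) x \<phi>x] v by (simp add: op_diff_apply_eq)
    moreover have "P (\<phi> x) = (\<phi> ^^ (Suc n + 2)) x"
      by (simp add: P_def funpow_Suc_right del: funpow.simps)
    moreover have "cscale H (of_nat (Suc (Suc n))) (B ?y v) = cscale H (of_nat (Suc n)) (A ?y v) + P ?y v"
    proof -
      have "real (Suc (Suc n)) * t = real (Suc n)" "real (Suc (Suc n)) * (1 - t) = 1"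
        by (simp_all add: t_def field_simps)
      then have "of_real (real (Suc (Suc n)) * t) = complex_of_nat (Suc n)"
        "of_real (real (Suc (Suc n)) * (1 - t)) = (1 :: complex)"
        by (simp_all only: of_real_of_nat_eq of_real_1)
      then have "complex_of_nat (Suc (Suc n)) * of_real t = of_nat (Suc n)"
        "complex_of_nat (Suc (Suc n)) * of_real (1 - t) = 1"
        by (simp_all only: of_real_mult of_real_of_nat_eq)
      then show ?thesis
        using v by (simp only: B_def op_add_eval op_scale_eval scale_add_right scale_scale scale_one)
    qed
    ultimately show ?thesis using A(3)[OF x v] by (simp add: P_def)
  qed
  ultimately show ?case by blast
qed

text \<open>
  By minimality \<open>\<phi> (x - \<phi> x)\<close> is not larger than the averages on \<open>x - \<phi> x\<close>, and these tend to \<open>0\<close>.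
\<close>

lemma minimal_gamma_endo_idempotent:
  assumes \<phi>: "minimal_gamma_endo G H \<pi> \<phi>" and x: "x \<in> bounded_ops H"
  shows "\<phi> (\<phi> x) = \<phi> x"
proof -
  have \<phi>e: "gamma_endo G H \<pi> \<phi>" using \<phi> by (simp add: minimal_gamma_endo_def)
  note c = gamma_endo_closed[OF \<phi>e]
  let ?y = "op_add H x (op_scale H (- 1) (\<phi> x))"
  have y: "?y \<in> bounded_ops H" using x c by (intro op_add_closed op_scale_closed)
  have "op_norm H (\<phi> ?y) \<le> 2 * op_norm H x / real (Suc n)" for n
  proof -
    obtain A where A: "gamma_endo G H \<pi> A" "map_le H A \<phi>"
      "\<And>x v. \<lbrakk>x \<in> bounded_ops H; v \<in> carrier H\<rbrakk> \<Longrightarrow>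
        cscale H (of_nat (Suc n)) (A (op_add H x (op_scale H (- 1) (\<phi> x))) v) = \<phi> x v - (\<phi> ^^ (n + 2)) x v"
      using gamma_endo_averages[OF \<phi>e] by metis
    have pow: "(\<phi> ^^ k) x \<in> bounded_ops H \<and> op_norm H ((\<phi> ^^ k) x) \<le> op_norm H x" for k
    proof (induction k)
      case (Suc k)
      then show ?case
        using c gamma_endo_contractive[OF \<phi>e, of "(\<phi> ^^ k) x"] by auto
    qed (use x in simp)
    have "op_norm H (\<phi> ?y) \<le> op_norm H (A ?y)"
      using \<phi> A y by (auto simp: minimal_gamma_endo_def map_le_def)
    also have "\<dots> \<le> 2 * op_norm H x / real (Suc n)"
    proof (rule op_norm_le, unfold op_bounds_def, intro CollectI conjI ballI)
      fix v assume v: "v \<in> carrier H"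
      have le: "hnorm H ((\<phi> ^^ k) x v) \<le> op_norm H x * hnorm H v" for k
        using pow[of k] v by (intro order_trans[OF hnorm_op_le] mult_right_mono) (auto simp: hnorm_nonneg)
      have Ay: "A ?y v \<in> carrier H"
        using gamma_endo_closed[OF A(1) y] v by (rule op_closed)
      have "real (Suc n) * hnorm H (A ?y v) = hnorm H (cscale H (of_nat (Suc n)) (A ?y v))"
        using Ay by (simp only: hnorm_scale norm_of_nat)
      also have "\<dots> = hnorm H ((\<phi> ^^ 1) x v - (\<phi> ^^ (n + 2)) x v)"
        using A(3)[OF x v] by simp
      also have "\<dots> \<le> hnorm H ((\<phi> ^^ 1) x v) + hnorm H ((\<phi> ^^ (n + 2)) x v)"
        by (intro hnorm_diff_triangle op_closed[OF conjunct1[OF pow] v])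
      also have "\<dots> \<le> op_norm H x * hnorm H v + op_norm H x * hnorm H v"
        by (intro add_mono le)
      finally show "hnorm H (A ?y v) \<le> 2 * op_norm H x / real (Suc n) * hnorm H v"
        by (simp add: field_simps)
    qed (use x op_norm_nonneg in simp)
    finally show ?thesis .
  qed
  moreover have "(\<lambda>n. 2 * op_norm H x / real (Suc n)) \<longlonglongrightarrow> 0"
    using LIMSEQ_Suc[OF lim_const_over_n[of "2 * op_norm H x"]] by simp
  ultimately have "op_norm H (\<phi> ?y) \<le> 0"
    by (intro LIMSEQ_le_const) auto
  then have "\<phi> ?y v = 0" if "v \<in> carrier H" for v
    using op_norm_eq_0_imp c[OF y] that by blast
  moreover have "\<phi> ?y v = \<phi> x v - \<phi> (\<phi> x) v" if "v \<in> carrier H" for v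
    using gamma_endo_diff[OF \<phi>e x c[OF x]] that by (simp add: op_diff_apply_eq)
  ultimately show ?thesis
    using x c by (intro op_eqI) auto
qed

text \<open>
  The rigidity of the boundary: every \<open>\<Gamma>\<close>-map, compressed by a minimal map \<open>\<phi>\<close>, is the identity on
  the range of \<open>\<phi>\<close>.
\<close>

theorem minimal_gamma_endo_rigid:
  assumes \<phi>: "minimal_gamma_endo G H \<pi> \<phi>" and \<theta>: "gamma_endo G H \<pi> \<theta>" and z: "z \<in> bounded_ops H"
  shows "\<phi> (\<theta> (\<phi> z)) = \<phi> z"
proof -
  have \<phi>e: "gamma_endo G H \<pi> \<phi>" using \<phi> by (simp add: minimal_gamma_endo_def)
  define \<eta> where "\<eta> = (\<lambda>x. \<phi> (\<theta> (\<phi> x)))"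
  have \<eta>e: "gamma_endo G H \<pi> \<eta>"
    unfolding \<eta>_def by (rule gamma_map_compose[OF gamma_map_compose[OF \<phi>e \<theta>] \<phi>e])
  note c = gamma_endo_closed[OF \<phi>e] gamma_endo_closed[OF \<theta>] gamma_endo_closed[OF \<eta>e]
  have "map_le H \<eta> \<phi>"
    using gamma_endo_contractive[OF \<phi>e] gamma_endo_contractive[OF \<theta>] c
    unfolding map_le_def \<eta>_def by (blast intro: order_trans)
  with \<phi> \<eta>e have le: "map_le H \<phi> \<eta>" by (simp add: minimal_gamma_endo_def)
  have "minimal_gamma_endo G H \<pi> \<eta>"
    using \<phi> \<eta>e \<open>map_le H \<eta> \<phi>\<close> unfolding minimal_gamma_endo_def map_le_def
    by (meson order_trans)
  then have \<eta>\<eta>: "\<eta> (\<eta> x) = \<eta> x" if "x \<in> bounded_ops H" for x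
    using minimal_gamma_endo_idempotent that by blast
  have \<phi>\<phi>: "\<phi> (\<phi> x) = \<phi> x" if "x \<in> bounded_ops H" for x
    using minimal_gamma_endo_idempotent[OF \<phi> that] .
  let ?y = "op_add H z (op_scale H (- 1) (\<eta> z))"
  have y: "?y \<in> bounded_ops H" using z c by (intro op_add_closed op_scale_closed)
  have "\<eta> ?y v = 0" if "v \<in> carrier H" for v
    using gamma_endo_diff[OF \<eta>e z c(3)[OF z]] \<eta>\<eta>[OF z] that by (simp add: op_diff_apply_eq)
  then have "op_norm H (\<eta> ?y) \<le> 0"
    by (intro op_norm_le) (simp add: op_bounds_def hnorm_zero)
  moreover have "op_norm H (\<phi> ?y) \<le> op_norm H (\<eta> ?y)"
    using le y by (simp add: map_le_def)
  ultimately have "op_norm H (\<phi> ?y) \<le> 0" by simp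
  then have "\<phi> ?y v = 0" if "v \<in> carrier H" for v
    using op_norm_eq_0_imp c(1)[OF y] that by blast
  moreover have "\<phi> (\<eta> z) = \<eta> z"
    unfolding \<eta>_def using z c by (intro \<phi>\<phi>) auto
  then have "\<phi> ?y v = \<phi> z v - \<eta> z v" if "v \<in> carrier H" for v
    using gamma_endo_diff[OF \<phi>e z c(3)[OF z]] that by (simp add: op_diff_apply_eq)
  ultimately have "\<eta> z = \<phi> z"
    using z c by (intro op_eqI) auto
  then show ?thesis by (simp add: \<eta>_def)
qed

end

text \<open>
  The boundaries of two representations are isomorphic as soon as there are \<open>\<Gamma>\<close>-maps in both
  directions between their operator algebras: by rigidity, the compressions of these maps to the
  boundaries are inverse to each other.
\<close>

theorem FH_boundary_isomorphic:
  assumes "unitary_rep G H \<pi>" and "unitary_rep G K \<rho>"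
    and \<alpha>: "gamma_map G H \<pi> (bounded_ops H) K \<rho> (bounded_ops K) \<alpha>"
    and \<beta>: "gamma_map G K \<rho> (bounded_ops K) H \<pi> (bounded_ops H) \<beta>"
    and "FH_boundary G K \<rho> B\<^sub>K" and "FH_boundary G H \<pi> B\<^sub>H"
  shows "\<exists>\<theta>. gamma_isomorphism G K \<rho> B\<^sub>K H \<pi> B\<^sub>H \<theta>"
proof -
  interpret H: unitary_rep G H \<pi> by fact
  interpret K: unitary_rep G K \<rho> by fact
  have hH: "hilbert_space H" and hK: "hilbert_space K"
    using H.hilbert_space_axioms K.hilbert_space_axioms .
  obtain \<phi> where \<phi>: "minimal_gamma_endo G H \<pi> \<phi>" and B\<^sub>H: "B\<^sub>H = \<phi> ` bounded_ops H"
    using assms by (auto simp: FH_boundary_def)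
  obtain \<psi> where \<psi>: "minimal_gamma_endo G K \<rho> \<psi>" and B\<^sub>K: "B\<^sub>K = \<psi> ` bounded_ops K"
    using assms by (auto simp: FH_boundary_def)
  have \<phi>e: "gamma_endo G H \<pi> \<phi>" and \<psi>e: "gamma_endo G K \<rho> \<psi>"
    using \<phi> \<psi> by (simp_all add: minimal_gamma_endo_def)
  define \<theta> where "\<theta> = (\<lambda>x. \<phi> (\<beta> x))"
  define \<kappa> where "\<kappa> = (\<lambda>x. \<psi> (\<alpha> x))"
  have \<theta>: "gamma_map G K \<rho> (bounded_ops K) H \<pi> (bounded_ops H) \<theta>"
    unfolding \<theta>_def by (rule gamma_map_compose[OF \<beta> \<phi>e])
  have \<kappa>: "gamma_map G H \<pi> (bounded_ops H) K \<rho> (bounded_ops K) \<kappa>"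
    unfolding \<kappa>_def by (rule gamma_map_compose[OF \<alpha> \<psi>e])
  have sub: "B\<^sub>H \<subseteq> bounded_ops H" "B\<^sub>K \<subseteq> bounded_ops K"
    unfolding B\<^sub>H B\<^sub>K using H.gamma_endo_closed[OF \<phi>e] K.gamma_endo_closed[OF \<psi>e] by auto
  have \<beta>c: "\<beta> x \<in> bounded_ops H" if "x \<in> bounded_ops K" for x
    using gamma_map.maps_to[OF \<beta>] that by auto
  have \<alpha>c: "\<alpha> x \<in> bounded_ops K" if "x \<in> bounded_ops H" for x
    using gamma_map.maps_to[OF \<alpha>] that by auto
  have into: "\<theta> x \<in> B\<^sub>H" if "x \<in> B\<^sub>K" for x
    using that sub \<beta>c by (auto simp: \<theta>_def B\<^sub>H)
  have into': "\<kappa> x \<in> B\<^sub>K" if "x \<in> B\<^sub>H" for x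
    using that sub \<alpha>c by (auto simp: \<kappa>_def B\<^sub>K)
  have \<theta>\<kappa>: "\<theta> (\<kappa> x) = x" if "x \<in> B\<^sub>H" for x
    using that H.minimal_gamma_endo_rigid[OF \<phi> gamma_map_compose[OF \<kappa> \<beta>]]
    by (auto simp: \<theta>_def B\<^sub>H)
  have \<kappa>\<theta>: "\<kappa> (\<theta> x) = x" if "x \<in> B\<^sub>K" for x
    using that K.minimal_gamma_endo_rigid[OF \<psi> gamma_map_compose[OF \<theta> \<alpha>]]
    by (auto simp: \<kappa>_def B\<^sub>K)
  have "gamma_map G K \<rho> B\<^sub>K H \<pi> B\<^sub>H \<theta>"
    by (rule gamma_map_restrict[OF \<theta> sub(2)]) (use into in auto)
  moreover have "bij_betw \<theta> B\<^sub>K B\<^sub>H"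
    by (rule bij_betw_byWitness[where f' = \<kappa>]) (use \<theta>\<kappa> \<kappa>\<theta> into into' in auto)
  moreover have "op_norm (hpower H n) (matrix_op H n (\<lambda>i j. \<theta> (a i j))) = op_norm (hpower K n) (matrix_op K n a)"
    if a: "\<And>i j. \<lbrakk>i < n; j < n\<rbrakk> \<Longrightarrow> a i j \<in> B\<^sub>K" for n a
  proof -
    have 1: "a i j \<in> bounded_ops K" "\<theta> (a i j) \<in> bounded_ops H" "\<kappa> (\<theta> (a i j)) = a i j"
      if "i < n" "j < n" for i j
      using a[OF that] sub into \<kappa>\<theta> by auto
    have "matrix_op K n (\<lambda>i j. \<kappa> (\<theta> (a i j))) = matrix_op K n a"
      unfolding matrix_op_def using 1(3) by (intro restrict_ext ext) (simp cong: sum.cong_simp)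
    then have "op_bounds (hpower H n) (matrix_op H n (\<lambda>i j. \<theta> (a i j))) = op_bounds (hpower K n) (matrix_op K n a)"
      using ucp_op_bounds[OF hK hH \<theta>, of n a] ucp_op_bounds[OF hH hK \<kappa>, of n "\<lambda>i j. \<theta> (a i j)"] 1
      by auto
    then show ?thesis by (simp add: op_norm_eq_Inf)
  qed
  ultimately show ?thesis
    unfolding gamma_isomorphism_def gamma_isomorphism_axioms_def by blast
qed

section \<open>The induced representation\<close>

text \<open>The multiset order and the left cosets share this symbol.\<close>

no_notation subset_mset (infix \<open><#\<close> 50)

text \<open>A group \<open>G\<close> with a subgroup \<open>\<Lambda>\<close>, acting on the set of left cosets by translation.\<close>

locale subgroup_pair = G: group G + subgroup \<Lambda> G for G :: "('g, 'm) monoid_scheme" (structure) and \<Lambda>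
begin

abbreviation cosets :: "'g set set" where "cosets \<equiv> lcosets \<Lambda>"

text \<open>The coset representatives that occur in the inner product of the induced space.\<close>

abbreviation coset_repr :: "'g set \<Rightarrow> 'g" where "coset_repr C \<equiv> SOME x. x \<in> C"

lemma is_subgroup: "subgroup \<Lambda> G"
  by (rule subgroup_axioms)

lemma coset_in_cosets: "x \<in> carrier G \<Longrightarrow> x <# \<Lambda> \<in> cosets"
  by (auto simp: LCOSETS_def)

lemma cosets_subset: "\<lbrakk>C \<in> cosets; x \<in> C\<rbrakk> \<Longrightarrow> x \<in> carrier G"
  using lcosets_carrier[OF G.group_axioms] by blast

lemma coset_eq: "\<lbrakk>C \<in> cosets; x \<in> C\<rbrakk> \<Longrightarrow> x <# \<Lambda> = C"
  using G.l_repr_independence[OF _ _ is_subgroup] by (auto simp: LCOSETS_def)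

lemma coset_self: "x \<in> carrier G \<Longrightarrow> x \<in> x <# \<Lambda>"
  using G.lcos_self is_subgroup by blast

lemma coset_repr_in: "C \<in> cosets \<Longrightarrow> coset_repr C \<in> C"
  by (rule someI_ex) (auto simp: LCOSETS_def intro: coset_self)

lemma coset_repr_closed: "C \<in> cosets \<Longrightarrow> coset_repr C \<in> carrier G"
  using coset_repr_in cosets_subset by blast

lemma coset_mult: "h \<in> \<Lambda> \<Longrightarrow> x \<in> carrier G \<Longrightarrow> (x \<otimes> h) <# \<Lambda> = x <# \<Lambda>"
  using coset_eq[OF coset_in_cosets, of x "x \<otimes> h"] by (auto simp: l_coset_def)

lemma translate_coset:
  "\<lbrakk>g \<in> carrier G; x \<in> carrier G\<rbrakk> \<Longrightarrow> g <# (x <# \<Lambda>) = (g \<otimes> x) <# \<Lambda>"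
  by (simp add: G.lcos_m_assoc subset)

lemma translate_cosets:
  assumes g: "g \<in> carrier G" and C: "C \<in> cosets"
  shows "g <# C \<in> cosets" "(inv g) <# (g <# C) = C" "g <# (inv g <# C) = C"
proof -
  obtain x where x: "x \<in> carrier G" "C = x <# \<Lambda>" using C by (auto simp: LCOSETS_def)
  show "g <# C \<in> cosets" using g x by (simp add: translate_coset coset_in_cosets)
  show "(inv g) <# (g <# C) = C" "g <# (inv g <# C) = C"
    using g x by (simp_all add: translate_coset flip: G.m_assoc)
qed

lemma bij_translate_cosets: "g \<in> carrier G \<Longrightarrow> bij_betw (\<lambda>C. g <# C) cosets cosets"
  by (rule bij_betw_byWitness[where f' = "\<lambda>C. inv g <# C"])
    (auto simp: translate_cosets)

lemma translate_mem: "\<lbrakk>g \<in> carrier G; C \<in> cosets; x \<in> C\<rbrakk> \<Longrightarrow> g \<otimes> x \<in> g <# C"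
  by (auto simp: l_coset_def)

end

text \<open>A unitary representation of \<open>G\<close>, to be restricted to \<open>\<Lambda>\<close> and then induced back to \<open>G\<close>.\<close>

locale subgroup_rep = unitary_rep G H \<pi> + subgroup_pair G \<Lambda>
  for G :: "('g, 'm) monoid_scheme" (structure) and H :: "'a::ab_group_add hilbert" and \<pi> \<Lambda>
begin

abbreviation Ind :: "('g \<Rightarrow> 'a) hilbert" where "Ind \<equiv> induced_space G \<Lambda> H (restrict \<pi> \<Lambda>)"

abbreviation ind_rep :: "'g \<Rightarrow> ('g \<Rightarrow> 'a) \<Rightarrow> 'g \<Rightarrow> 'a" where
  "ind_rep \<equiv> induced_rep G \<Lambda> H (restrict \<pi> \<Lambda>)"

lemma in_Ind_iff:
  "f \<in> carrier Ind \<longleftrightarrow> (\<forall>x. x \<notin> carrier G \<longrightarrow> f x = 0) \<and> (\<forall>x\<in>carrier G. f x \<in> carrier H) \<and>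
    (\<forall>x\<in>carrier G. \<forall>h\<in>\<Lambda>. f (x \<otimes> h) = \<pi> (inv h) (f x)) \<and>
    (\<lambda>C. (hnorm H (f (coset_repr C)))\<^sup>2) summable_on cosets"
  by (simp add: induced_space_def)

lemma cscale_Ind: "cscale Ind c f = (\<lambda>x. cscale H c (f x))"
  by (simp add: induced_space_def)

lemma cinner_Ind:
  "cinner Ind f f' = (\<Sum>\<^sub>\<infinity>C\<in>cosets. cinner H (f (coset_repr C)) (f' (coset_repr C)))"
  by (simp add: induced_space_def)

lemma Ind_outside: "\<lbrakk>f \<in> carrier Ind; x \<notin> carrier G\<rbrakk> \<Longrightarrow> f x = 0"
  and Ind_closed: "\<lbrakk>f \<in> carrier Ind; x \<in> carrier G\<rbrakk> \<Longrightarrow> f x \<in> carrier H"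
  and Ind_mult: "\<lbrakk>f \<in> carrier Ind; x \<in> carrier G; h \<in> \<Lambda>\<rbrakk> \<Longrightarrow> f (x \<otimes> h) = \<pi> (inv h) (f x)"
  and Ind_summable: "f \<in> carrier Ind \<Longrightarrow> (\<lambda>C. (hnorm H (f (coset_repr C)))\<^sup>2) summable_on cosets"
  by (auto simp: in_Ind_iff)

lemma Ind_repr_closed: "\<lbrakk>f \<in> carrier Ind; C \<in> cosets\<rbrakk> \<Longrightarrow> f (coset_repr C) \<in> carrier H"
  by (simp add: Ind_closed coset_repr_closed)

lemma Ind_cinner_repr:
  assumes f: "f \<in> carrier Ind" "f' \<in> carrier Ind" and C: "C \<in> cosets" and x: "x \<in> C"
  shows "cinner H (f (coset_repr C)) (f' (coset_repr C)) = cinner H (f x) (f' x)"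
proof -
  have xG: "x \<in> carrier G" using cosets_subset C x by blast
  have "coset_repr C \<in> x <# \<Lambda>" using coset_eq[OF C x] coset_repr_in[OF C] by simp
  then obtain h where "h \<in> \<Lambda>" "coset_repr C = x \<otimes> h" by (auto simp: l_coset_def)
  then show ?thesis
    using f xG by (simp add: Ind_mult isometric Ind_closed inv_closed)
qed

lemma Ind_hnorm_repr:
  "\<lbrakk>f \<in> carrier Ind; C \<in> cosets; x \<in> C\<rbrakk> \<Longrightarrow> hnorm H (f (coset_repr C)) = hnorm H (f x)"
  by (simp add: hnorm_def Ind_cinner_repr)

lemma Ind_cinner_summable:
  assumes f: "f \<in> carrier Ind" and f': "f' \<in> carrier Ind"
  shows "(\<lambda>C. cinner H (f (coset_repr C)) (f' (coset_repr C))) summable_on cosets"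
proof (rule abs_summable_summable, rule Infinite_Sum.abs_summable_on_comparison_test')
  show "(\<lambda>C. (hnorm H (f (coset_repr C)))\<^sup>2 + (hnorm H (f' (coset_repr C)))\<^sup>2) summable_on cosets"
    by (intro summable_on_add Ind_summable f f')
next
  fix C assume C: "C \<in> cosets"
  let ?a = "hnorm H (f (coset_repr C))" and ?b = "hnorm H (f' (coset_repr C))"
  have "cmod (cinner H (f (coset_repr C)) (f' (coset_repr C))) \<le> ?a * ?b"
    using C f f' by (intro cauchy_schwarz Ind_repr_closed)
  also have "\<dots> \<le> ?a\<^sup>2 + ?b\<^sup>2"
  proof -
    have "2 * (?a * ?b) \<le> ?a\<^sup>2 + ?b\<^sup>2" using sum_squares_bound[of ?a ?b] by simp
    moreover have "0 \<le> ?a * ?b" using C f f' by (simp add: hnorm_nonneg Ind_repr_closed)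
    ultimately show ?thesis by argo
  qed
  finally show "cmod (cinner H (f (coset_repr C)) (f' (coset_repr C))) \<le> ?a\<^sup>2 + ?b\<^sup>2" .
qed

lemma Ind_cinner_self:
  assumes f: "f \<in> carrier Ind"
  shows "cinner Ind f f = of_real (\<Sum>\<^sub>\<infinity>C\<in>cosets. (hnorm H (f (coset_repr C)))\<^sup>2)"
proof -
  have "((\<lambda>C. of_real ((hnorm H (f (coset_repr C)))\<^sup>2) :: complex) has_sum
      of_real (\<Sum>\<^sub>\<infinity>C\<in>cosets. (hnorm H (f (coset_repr C)))\<^sup>2)) cosets"
    unfolding has_sum_of_real_iff using Ind_summable[OF f] by (rule has_sum_infsum)
  then have "(\<Sum>\<^sub>\<infinity>C\<in>cosets. of_real ((hnorm H (f (coset_repr C)))\<^sup>2)) =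
      (of_real (\<Sum>\<^sub>\<infinity>C\<in>cosets. (hnorm H (f (coset_repr C)))\<^sup>2) :: complex)"
    by (rule infsumI)
  moreover have "cinner Ind f f = (\<Sum>\<^sub>\<infinity>C\<in>cosets. of_real ((hnorm H (f (coset_repr C)))\<^sup>2))"
    unfolding cinner_Ind using f by (intro infsum_cong cinner_self Ind_repr_closed)
  ultimately show ?thesis by simp
qed

lemma Ind_sum_nonneg: "0 \<le> (\<Sum>\<^sub>\<infinity>C\<in>cosets. (hnorm H (f (coset_repr C)))\<^sup>2)"
  by (rule infsum_nonneg) simp

lemma hnorm_Ind_power2:
  "f \<in> carrier Ind \<Longrightarrow> (hnorm Ind f)\<^sup>2 = (\<Sum>\<^sub>\<infinity>C\<in>cosets. (hnorm H (f (coset_repr C)))\<^sup>2)"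
  unfolding hnorm_def[of Ind] using Ind_sum_nonneg[of f] by (simp add: Ind_cinner_self)

lemma hnorm_Ind_nonneg: "f \<in> carrier Ind \<Longrightarrow> 0 \<le> hnorm Ind f"
  unfolding hnorm_def[of Ind] using Ind_sum_nonneg[of f] by (simp add: Ind_cinner_self)

lemma hnorm_le_hnorm_Ind:
  assumes f: "f \<in> carrier Ind" and x: "x \<in> carrier G"
  shows "hnorm H (f x) \<le> hnorm Ind f"
proof (rule power2_le_imp_le)
  have "(\<Sum>C\<in>{x <# \<Lambda>}. (hnorm H (f (coset_repr C)))\<^sup>2) \<le> (hnorm Ind f)\<^sup>2"
    unfolding hnorm_Ind_power2[OF f]
    using f x by (intro finite_sum_le_infsum Ind_summable) (auto simp: coset_in_cosets)
  then show "(hnorm H (f x))\<^sup>2 \<le> (hnorm Ind f)\<^sup>2"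
    using Ind_hnorm_repr[OF f coset_in_cosets[OF x] coset_self[OF x]] by simp
qed (rule hnorm_Ind_nonneg[OF f])

lemma Ind_add_closed:
  assumes f: "f \<in> carrier Ind" and f': "f' \<in> carrier Ind"
  shows "f + f' \<in> carrier Ind"
  unfolding in_Ind_iff
proof (intro conjI)
  show "(\<lambda>C. (hnorm H ((f + f') (coset_repr C)))\<^sup>2) summable_on cosets"
  proof (rule summable_on_comparison_test)
    show "(\<lambda>C. 2 * (hnorm H (f (coset_repr C)))\<^sup>2 + 2 * (hnorm H (f' (coset_repr C)))\<^sup>2) summable_on cosets"
      by (intro summable_on_add summable_on_cmult_right Ind_summable f f')
  qed (use f f' in \<open>auto simp: Ind_repr_closed hnorm_add_power2_le\<close>)
qed (use f f' in \<open>auto simp: Ind_outside Ind_closed Ind_mult rep_add inv_closed add_closed\<close>)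

lemma Ind_scale_closed:
  assumes f: "f \<in> carrier Ind"
  shows "cscale Ind c f \<in> carrier Ind"
  unfolding in_Ind_iff cscale_Ind
proof (intro conjI)
  have "(\<lambda>C. (cmod c)\<^sup>2 * (hnorm H (f (coset_repr C)))\<^sup>2) summable_on cosets"
    by (intro summable_on_cmult_right Ind_summable f)
  then show "(\<lambda>C. (hnorm H (cscale H c (f (coset_repr C))))\<^sup>2) summable_on cosets"
    by (rule summable_on_cong[THEN iffD1, rotated])
      (use f in \<open>simp add: hnorm_scale Ind_repr_closed power_mult_distrib\<close>)
qed (use f in \<open>auto simp: Ind_outside Ind_closed Ind_mult rep_scale inv_closed scale_closed scale_zero_right\<close>)

lemma Ind_zero_closed: "0 \<in> carrier Ind"
  using zero_closed rep_scale[OF _ zero_closed, of _ 0]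
  by (auto simp: in_Ind_iff hnorm_zero scale_zero_left rep_closed inv_closed)

lemma Ind_vector_space: "vector_space (cscale Ind)"
  by unfold_locales
    (auto simp: cscale_Ind fun_eq_iff scale_add_right scale_add_left scale_scale scale_one)

lemma Ind_subspace: "module.subspace (cscale Ind) (carrier Ind)"
proof -
  interpret V: vector_space "cscale Ind" by (rule Ind_vector_space)
  show ?thesis
    by (simp add: V.subspace_def Ind_zero_closed Ind_add_closed Ind_scale_closed)
qed

lemma Ind_diff_closed:
  assumes f: "f \<in> carrier Ind" and f': "f' \<in> carrier Ind"
  shows "f - f' \<in> carrier Ind"
proof -
  have eq: "f - f' = f + cscale Ind (- 1) f'"
    by (auto simp: cscale_Ind scale_minus_one)
  show ?thesis unfolding eq by (intro Ind_add_closed Ind_scale_closed f f')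
qed

text \<open>
  Evaluation at a point does not increase the norm, so a Cauchy sequence converges pointwise; the finite
  partial sums of the norm then bound the distance to the pointwise limit.
\<close>

lemma Ind_complete:
  assumes X: "\<And>n::nat. X n \<in> carrier Ind"
    and cauchy: "\<And>e. 0 < e \<Longrightarrow> \<exists>N. \<forall>m\<ge>N. \<forall>n\<ge>N. hnorm Ind (X m - X n) < e"
  shows "\<exists>l\<in>carrier Ind. (\<lambda>n. hnorm Ind (X n - l)) \<longlonglongrightarrow> 0"
proof -
  have "\<exists>l\<in>carrier H. (\<lambda>n. hnorm H (X n x - l)) \<longlonglongrightarrow> 0" if x: "x \<in> carrier G" for x
  proof (rule complete)
    show "X n x \<in> carrier H" for n using X x by (rule Ind_closed)
    have "hnorm H (X m x - X n x) \<le> hnorm Ind (X m - X n)" for m n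
      using hnorm_le_hnorm_Ind[OF Ind_diff_closed[OF X X] x, of m n] by simp
    then show "\<exists>N. \<forall>m\<ge>N. \<forall>n\<ge>N. hnorm H (X m x - X n x) < e" if "0 < e" for e
      using cauchy[OF that] by (meson le_less_trans)
  qed
  then obtain k where k: "\<And>x. x \<in> carrier G \<Longrightarrow> k x \<in> carrier H"
    "\<And>x. x \<in> carrier G \<Longrightarrow> (\<lambda>n. hnorm H (X n x - k x)) \<longlonglongrightarrow> 0"
    by metis
  define l where "l x = (if x \<in> carrier G then k x else 0)" for x
  have l: "l x \<in> carrier H" "(\<lambda>n. hnorm H (X n x - l x)) \<longlonglongrightarrow> 0" if "x \<in> carrier G" for x
    using k that by (simp_all add: l_def)
  have l_mult: "l (x \<otimes> h) = \<pi> (inv h) (l x)" if x: "x \<in> carrier G" and h: "h \<in> \<Lambda>" for x h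
  proof (rule norm_limit_unique)
    have xh: "x \<otimes> h \<in> carrier G" and hG: "inv h \<in> carrier G" using x h by auto
    show "X n (x \<otimes> h) \<in> carrier H" for n using X xh by (rule Ind_closed)
    show "l (x \<otimes> h) \<in> carrier H" "(\<lambda>n. hnorm H (X n (x \<otimes> h) - l (x \<otimes> h))) \<longlonglongrightarrow> 0"
      using l[OF xh] by auto
    show "\<pi> (inv h) (l x) \<in> carrier H" using l x hG by (simp add: rep_closed)
    have "hnorm H (X n (x \<otimes> h) - \<pi> (inv h) (l x)) = hnorm H (X n x - l x)" for n
    proof -
      have "X n (x \<otimes> h) - \<pi> (inv h) (l x) = \<pi> (inv h) (X n x - l x)"
        using rep_diff[OF hG Ind_closed[OF X x] l(1)[OF x]] Ind_mult[OF X x h] by simp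
      then show ?thesis
        using hnorm_rep[OF hG, of "X n x - l x"] Ind_closed[OF X x] l(1)[OF x] by (simp add: diff_closed)
    qed
    then show "(\<lambda>n. hnorm H (X n (x \<otimes> h) - \<pi> (inv h) (l x))) \<longlonglongrightarrow> 0"
      using l(2)[OF x] by simp
  qed
  have close: "l - X n \<in> carrier Ind \<and> hnorm Ind (l - X n) \<le> e"
    if e: "0 < e" and N: "\<And>m n. \<lbrakk>m \<ge> N; n \<ge> N\<rbrakk> \<Longrightarrow> hnorm Ind (X m - X n) < e" and n: "n \<ge> N" for e N n
  proof -
    have bound: "(\<Sum>C\<in>E. (hnorm H ((l - X n) (coset_repr C)))\<^sup>2) \<le> e\<^sup>2"
      if E: "finite E" "E \<subseteq> cosets" for E
    proof (rule LIMSEQ_le_const2)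
      show "(\<lambda>m. \<Sum>C\<in>E. (hnorm H (X m (coset_repr C) - X n (coset_repr C)))\<^sup>2)
        \<longlonglongrightarrow> (\<Sum>C\<in>E. (hnorm H ((l - X n) (coset_repr C)))\<^sup>2)"
      proof (intro tendsto_sum tendsto_power)
        fix C assume "C \<in> E"
        then have s: "coset_repr C \<in> carrier G" using E by (auto intro: coset_repr_closed)
        show "(\<lambda>m. hnorm H (X m (coset_repr C) - X n (coset_repr C))) \<longlonglongrightarrow> hnorm H ((l - X n) (coset_repr C))"
        proof (rule norm_limit_tendsto)
          show "(\<lambda>m. hnorm H (X m (coset_repr C) - X n (coset_repr C) - (l - X n) (coset_repr C))) \<longlonglongrightarrow> 0"
            using l(2)[OF s] by simp
        qed (use Ind_closed[OF X s] l(1)[OF s] in \<open>simp_all add: diff_closed\<close>)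
      qed
      have "(\<Sum>C\<in>E. (hnorm H (X m (coset_repr C) - X n (coset_repr C)))\<^sup>2) \<le> e\<^sup>2" if m: "m \<ge> N" for m
      proof -
        have "(\<Sum>C\<in>E. (hnorm H ((X m - X n) (coset_repr C)))\<^sup>2) \<le> (hnorm Ind (X m - X n))\<^sup>2"
          unfolding hnorm_Ind_power2[OF Ind_diff_closed[OF X X]]
          using E by (intro finite_sum_le_infsum Ind_summable Ind_diff_closed X) auto
        also have "\<dots> \<le> e\<^sup>2"
          using N[OF m n] hnorm_Ind_nonneg[OF Ind_diff_closed[OF X X]] by (intro power_mono) auto
        finally show ?thesis by simp
      qed
      then show "\<exists>N. \<forall>m\<ge>N. (\<Sum>C\<in>E. (hnorm H (X m (coset_repr C) - X n (coset_repr C)))\<^sup>2) \<le> e\<^sup>2"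
        by blast
    qed
    have summ: "(\<lambda>C. (hnorm H ((l - X n) (coset_repr C)))\<^sup>2) summable_on cosets"
      by (rule nonneg_bdd_above_summable_on) (use bound in \<open>auto simp: bdd_above_def\<close>)
    have mem: "l - X n \<in> carrier Ind"
      unfolding in_Ind_iff
    proof (intro conjI summ ballI allI impI)
      show "(l - X n) x = 0" if "x \<notin> carrier G" for x
        using that Ind_outside[OF X] by (simp add: l_def)
      show "(l - X n) x \<in> carrier H" if "x \<in> carrier G" for x
        using that l Ind_closed[OF X] by (simp add: diff_closed)
      show "(l - X n) (x \<otimes> h) = \<pi> (inv h) ((l - X n) x)" if "x \<in> carrier G" "h \<in> \<Lambda>" for x h
        using that l Ind_closed[OF X] Ind_mult[OF X] by (simp add: l_mult rep_diff inv_closed)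
    qed
    have "(hnorm Ind (l - X n))\<^sup>2 \<le> e\<^sup>2"
      unfolding hnorm_Ind_power2[OF mem] using summ bound by (rule infsum_le_finite_sums)
    then have "hnorm Ind (l - X n) \<le> e" by (rule power2_le_imp_le) (use e in simp)
    then show ?thesis using mem by blast
  qed
  obtain N where "\<forall>m\<ge>N. \<forall>n\<ge>N. hnorm Ind (X m - X n) < 1" using cauchy[of 1] by auto
  then have "l - X N \<in> carrier Ind" using close[of 1 N N] by auto
  then have lInd: "l \<in> carrier Ind" using Ind_add_closed[OF _ X, of "l - X N" N] by simp
  have swap: "hnorm Ind (X n - l) = hnorm Ind (l - X n)" for n
  proof -
    have "hnorm H ((X n - l) (coset_repr C)) = hnorm H ((l - X n) (coset_repr C))" if "C \<in> cosets" for C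
      using that Ind_repr_closed[OF X] Ind_repr_closed[OF lInd] by (simp add: hnorm_minus_commute)
    then have "(\<Sum>\<^sub>\<infinity>C\<in>cosets. (hnorm H ((X n - l) (coset_repr C)))\<^sup>2)
        = (\<Sum>\<^sub>\<infinity>C\<in>cosets. (hnorm H ((l - X n) (coset_repr C)))\<^sup>2)"
      by (intro infsum_cong) simp
    then show ?thesis
      using X lInd by (simp add: hnorm_def[of Ind] Ind_cinner_self Ind_diff_closed)
  qed
  have "(\<lambda>n. hnorm Ind (X n - l)) \<longlonglongrightarrow> 0"
  proof (rule LIMSEQ_I)
    fix r :: real assume r: "0 < r"
    obtain N where N: "\<forall>m\<ge>N. \<forall>n\<ge>N. hnorm Ind (X m - X n) < r / 2"
      using cauchy[of "r / 2"] r by auto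
    have "norm (hnorm Ind (X n - l) - 0) < r" if "n \<ge> N" for n
      using close[of "r / 2" N n] N that r hnorm_Ind_nonneg[of "l - X n"] unfolding swap by auto
    then show "\<exists>no. \<forall>n\<ge>no. norm (hnorm Ind (X n - l) - 0) < r" by blast
  qed
  then show ?thesis using lInd by blast
qed

theorem Ind_hilbert_space: "hilbert_space Ind"
proof (rule hilbert_space.intro)
  show "vector_space (cscale Ind)" by (rule Ind_vector_space)
  show "module.subspace (cscale Ind) (carrier Ind)" by (rule Ind_subspace)
  show "cinner Ind (x + y) z = cinner Ind x z + cinner Ind y z"
    if "x \<in> carrier Ind" "y \<in> carrier Ind" "z \<in> carrier Ind" for x y z
  proof -
    have "cinner Ind (x + y) z = (\<Sum>\<^sub>\<infinity>C\<in>cosets. cinner H (x (coset_repr C)) (z (coset_repr C))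
        + cinner H (y (coset_repr C)) (z (coset_repr C)))"
      unfolding cinner_Ind using that by (intro infsum_cong) (simp add: cinner_add Ind_repr_closed)
    then show ?thesis
      unfolding cinner_Ind using that by (simp add: infsum_add Ind_cinner_summable)
  qed
  show "cinner Ind (cscale Ind c x) y = c * cinner Ind x y"
    if "x \<in> carrier Ind" "y \<in> carrier Ind" for c x y
  proof -
    have "cinner Ind (cscale Ind c x) y
        = (\<Sum>\<^sub>\<infinity>C\<in>cosets. c * cinner H (x (coset_repr C)) (y (coset_repr C)))"
      unfolding cinner_Ind cscale_Ind using that by (intro infsum_cong) (simp add: cinner_scale Ind_repr_closed)
    then show ?thesis by (simp add: infsum_cmult_right' cinner_Ind)
  qed
  show "cinner Ind y x = cnj (cinner Ind x y)" if "x \<in> carrier Ind" "y \<in> carrier Ind" for x y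
    unfolding cinner_Ind infsum_cnj[symmetric]
    using that by (intro infsum_cong cinner_commute Ind_repr_closed)
  show "0 \<le> Re (cinner Ind x x)" if "x \<in> carrier Ind" for x
    using that Ind_sum_nonneg by (simp add: Ind_cinner_self)
  show "x = 0" if x: "x \<in> carrier Ind" and 0: "cinner Ind x x = 0" for x
  proof
    fix g
    show "x g = 0 g"
    proof (cases "g \<in> carrier G")
      case True
      have "hnorm H (x g) \<le> 0"
        using hnorm_le_hnorm_Ind[OF x True] 0 by (simp add: hnorm_def[of Ind])
      then show ?thesis
        using hnorm_nonneg[OF Ind_closed[OF x True]] hnorm_eq_0_iff[OF Ind_closed[OF x True]] by simp
    qed (use x in \<open>simp add: Ind_outside\<close>)
  qed
qed (rule Ind_complete)

lemma ind_rep_apply: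
  "\<lbrakk>f \<in> carrier Ind; x \<in> carrier G\<rbrakk> \<Longrightarrow> ind_rep g f x = f (inv g \<otimes> x)"
  by (simp add: induced_rep_def)

lemma ind_rep_outside: "\<lbrakk>f \<in> carrier Ind; x \<notin> carrier G\<rbrakk> \<Longrightarrow> ind_rep g f x = 0"
  by (simp add: induced_rep_def)

lemma ind_rep_repr:
  assumes f: "f \<in> carrier Ind" "f' \<in> carrier Ind" and g: "g \<in> carrier G" and C: "C \<in> cosets"
  shows "cinner H (ind_rep g f (coset_repr C)) (ind_rep g f' (coset_repr C))
    = cinner H (f (coset_repr (inv g <# C))) (f' (coset_repr (inv g <# C)))"
  using Ind_cinner_repr[OF f, of "inv g <# C" "inv g \<otimes> coset_repr C"] f g C
  by (simp add: ind_rep_apply coset_repr_closed translate_cosets translate_mem coset_repr_in)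

lemma ind_rep_closed:
  assumes f: "f \<in> carrier Ind" and g: "g \<in> carrier G"
  shows "ind_rep g f \<in> carrier Ind"
  unfolding in_Ind_iff
proof (intro conjI ballI allI impI)
  have "(\<lambda>C. (hnorm H (f (coset_repr (inv g <# C))))\<^sup>2) summable_on cosets"
    using summable_on_reindex_bij_betw[OF bij_translate_cosets[of "inv g"],
        where f = "\<lambda>C. (hnorm H (f (coset_repr C)))\<^sup>2"] Ind_summable[OF f] g by simp
  then show "(\<lambda>C. (hnorm H (ind_rep g f (coset_repr C)))\<^sup>2) summable_on cosets"
    by (rule summable_on_cong[THEN iffD1, rotated]) (simp add: hnorm_def ind_rep_repr f g)
qed (use f g in \<open>simp_all add: ind_rep_apply ind_rep_outside Ind_closed Ind_mult flip: G.m_assoc\<close>)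

lemma ind_rep_isometric:
  assumes f: "f \<in> carrier Ind" "f' \<in> carrier Ind" and g: "g \<in> carrier G"
  shows "cinner Ind (ind_rep g f) (ind_rep g f') = cinner Ind f f'"
proof -
  have "cinner Ind (ind_rep g f) (ind_rep g f')
      = (\<Sum>\<^sub>\<infinity>C\<in>cosets. cinner H (f (coset_repr (inv g <# C))) (f' (coset_repr (inv g <# C))))"
    unfolding cinner_Ind using f g by (intro infsum_cong ind_rep_repr)
  also have "\<dots> = cinner Ind f f'"
    unfolding cinner_Ind using g by (intro infsum_reindex_bij_betw bij_translate_cosets) simp
  finally show ?thesis .
qed

lemma ind_rep_mult:
  assumes f: "f \<in> carrier Ind" and g: "g \<in> carrier G" and h: "h \<in> carrier G"
  shows "ind_rep (g \<otimes> h) f = ind_rep g (ind_rep h f)"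
proof
  fix x
  show "ind_rep (g \<otimes> h) f x = ind_rep g (ind_rep h f) x"
    using assms by (cases "x \<in> carrier G")
      (simp_all add: ind_rep_apply ind_rep_outside ind_rep_closed G.inv_mult_group G.m_assoc)
qed

lemma ind_rep_one:
  assumes f: "f \<in> carrier Ind"
  shows "ind_rep \<one> f = f"
proof
  fix x
  show "ind_rep \<one> f x = f x"
    using assms by (cases "x \<in> carrier G") (simp_all add: ind_rep_apply ind_rep_outside Ind_outside)
qed

theorem induced_rep_unitary: "unitary_rep G Ind ind_rep"
proof -
  have inv: "ind_rep (inv g) (ind_rep g f) = f" "ind_rep g (ind_rep (inv g) f) = f"
    if "g \<in> carrier G" "f \<in> carrier Ind" for g f
    using that by (simp_all add: ind_rep_one flip: ind_rep_mult)
  have Bij: "ind_rep g \<in> Bij (carrier Ind)" if g: "g \<in> carrier G" for g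
    unfolding Bij_def
  proof (intro IntI CollectI)
    show "ind_rep g \<in> extensional (carrier Ind)" by (simp add: induced_rep_def)
    show "bij_betw (ind_rep g) (carrier Ind) (carrier Ind)"
      by (rule bij_betw_byWitness[where f' = "ind_rep (inv g)"])
        (use g inv ind_rep_closed in auto)
  qed
  have mult: "ind_rep (g \<otimes> h) = compose (carrier Ind) (ind_rep g) (ind_rep h)"
    if "g \<in> carrier G" "h \<in> carrier G" for g h
  proof (rule extensionalityI)
    show "ind_rep (g \<otimes> h) \<in> extensional (carrier Ind)" by (simp add: induced_rep_def)
    show "ind_rep (g \<otimes> h) f = compose (carrier Ind) (ind_rep g) (ind_rep h) f" if "f \<in> carrier Ind" for f
      using ind_rep_mult[OF that \<open>g \<in> carrier G\<close> \<open>h \<in> carrier G\<close>] that by (simp only: compose_eq)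
  qed (rule compose_extensional)
  interpret Ind: hilbert_space Ind by (rule Ind_hilbert_space)
  have act: "group_action G (carrier Ind) ind_rep"
    by (intro group_action.intro group_hom.intro group_BijGroup group_G group_hom_axioms.intro homI)
      (use Bij mult in \<open>auto simp: BijGroup_def\<close>)
  interpret group_action G "carrier Ind" ind_rep by (rule act)
  show ?thesis
  proof
    show "clinear_on Ind (ind_rep g)" if "g \<in> carrier G" for g
      unfolding clinear_on_def
    proof (intro conjI ballI allI ext)
      show "ind_rep g (f + f') x = (ind_rep g f + ind_rep g f') x"
        if "f \<in> carrier Ind" "f' \<in> carrier Ind" for f f' x
        using that by (cases "x \<in> carrier G")
          (simp_all add: ind_rep_apply ind_rep_outside Ind_add_closed)
      show "ind_rep g (cscale Ind c f) x = cscale Ind c (ind_rep g f) x"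
        if "f \<in> carrier Ind" for c f x
        using that Ind_scale_closed[OF that, of c] by (cases "x \<in> carrier G")
          (simp_all add: ind_rep_apply ind_rep_outside cscale_Ind scale_zero_right)
    qed
  qed (rule ind_rep_isometric)
qed

end

section \<open>Operators on \<open>H\<close> act on the induced space\<close>

lemma infsum_finite_sum:
  fixes f :: "'i \<Rightarrow> 'x \<Rightarrow> 'b::{topological_comm_monoid_add, t2_space}"
  assumes "finite I" "\<And>i. i \<in> I \<Longrightarrow> f i summable_on A"
  shows "(\<lambda>x. \<Sum>i\<in>I. f i x) summable_on A"
    and "(\<Sum>\<^sub>\<infinity>x\<in>A. \<Sum>i\<in>I. f i x) = (\<Sum>i\<in>I. \<Sum>\<^sub>\<infinity>x\<in>A. f i x)"
proof -
  have "(\<lambda>x. \<Sum>i\<in>I. f i x) summable_on A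
      \<and> (\<Sum>\<^sub>\<infinity>x\<in>A. \<Sum>i\<in>I. f i x) = (\<Sum>i\<in>I. \<Sum>\<^sub>\<infinity>x\<in>A. f i x)"
    using assms by (induction I rule: finite_induct) (simp_all add: summable_on_add infsum_add)
  then show "(\<lambda>x. \<Sum>i\<in>I. f i x) summable_on A"
    and "(\<Sum>\<^sub>\<infinity>x\<in>A. \<Sum>i\<in>I. f i x) = (\<Sum>i\<in>I. \<Sum>\<^sub>\<infinity>x\<in>A. f i x)"
    by blast+
qed

sublocale subgroup_rep \<subseteq> Ind: unitary_rep G Ind ind_rep
  by (rule induced_rep_unitary)

context subgroup_rep
begin

text \<open>
  Under the identification of the induced space with the tensor product of \<open>\<ell>\<^sup>2(G/\<Lambda>)\<close> and \<open>H\<close>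
  given by \<open>f \<mapsto> (\<lambda>x. \<pi> x (f x))\<close>, this is the operator \<open>1 \<otimes> T\<close>.
\<close>

definition amplify :: "('a \<Rightarrow> 'a) \<Rightarrow> ('g \<Rightarrow> 'a) \<Rightarrow> 'g \<Rightarrow> 'a" where
  "amplify T = (\<lambda>f\<in>carrier Ind. \<lambda>x. if x \<in> carrier G then \<pi> (inv x) (T (\<pi> x (f x))) else 0)"

lemma amplify_apply:
  "\<lbrakk>f \<in> carrier Ind; x \<in> carrier G\<rbrakk> \<Longrightarrow> amplify T f x = \<pi> (inv x) (T (\<pi> x (f x)))"
  by (simp add: amplify_def)

lemma amplify_outside: "\<lbrakk>f \<in> carrier Ind; x \<notin> carrier G\<rbrakk> \<Longrightarrow> amplify T f x = 0"
  by (simp add: amplify_def)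

lemma amplify_closed:
  assumes T: "T \<in> bounded_ops H"
  shows "amplify T \<in> bounded_ops Ind"
proof -
  obtain M where M: "0 \<le> M" "\<And>x. x \<in> carrier H \<Longrightarrow> hnorm H (T x) \<le> M * hnorm H x"
    using bounded_opsE[OF T] by blast
  have cl: "\<pi> x (f x) \<in> carrier H" "T (\<pi> x (f x)) \<in> carrier H" "amplify T f x \<in> carrier H"
    if "f \<in> carrier Ind" "x \<in> carrier G" for f x
    using that by (simp_all add: amplify_apply rep_closed Ind_closed op_closed[OF T] inv_closed)
  have le: "(hnorm H (amplify T f x))\<^sup>2 \<le> M\<^sup>2 * (hnorm H (f x))\<^sup>2" if f: "f \<in> carrier Ind" and x: "x \<in> carrier G" for f x
  proof -
    have "hnorm H (amplify T f x) \<le> M * hnorm H (f x)"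
      using M(2)[OF cl(1)[OF f x]] cl[OF f x] f x
      by (simp add: amplify_apply hnorm_rep inv_closed Ind_closed)
    then show ?thesis
      using power_mono[OF _ hnorm_nonneg[OF cl(3)[OF f x]], of "M * hnorm H (f x)" 2]
      by (simp add: power_mult_distrib)
  qed
  have summ: "(\<lambda>C. M\<^sup>2 * (hnorm H (f (coset_repr C)))\<^sup>2) summable_on cosets" if "f \<in> carrier Ind" for f
    using that by (intro summable_on_cmult_right Ind_summable)
  have mem: "amplify T f \<in> carrier Ind" if f: "f \<in> carrier Ind" for f
    unfolding in_Ind_iff
  proof (intro conjI ballI allI impI)
    show "(\<lambda>C. (hnorm H (amplify T f (coset_repr C)))\<^sup>2) summable_on cosets"
      by (rule summable_on_comparison_test[OF summ[OF f]]) (simp_all add: le f coset_repr_closed)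
    show "amplify T f (x \<otimes> h) = \<pi> (inv h) (amplify T f x)" if x: "x \<in> carrier G" and h: "h \<in> \<Lambda>" for x h
    proof -
      have hG: "h \<in> carrier G" using h by (rule mem_carrier)
      have "\<pi> (x \<otimes> h) (f (x \<otimes> h)) = \<pi> x (f x)"
        using f x h hG Ind_mult[OF f x h]
        by (simp add: composition_rule rep_closed inv_closed Ind_closed rep_inv')
      then show ?thesis
        using f x hG cl[OF f x] by (simp add: amplify_apply G.inv_mult_group composition_rule)
    qed
  qed (use f cl in \<open>auto simp: amplify_outside\<close>)
  have eq: "amplify T = restrict (amplify T) (carrier Ind)" by (simp add: amplify_def)
  show ?thesis
  proof (subst eq, rule Ind.bounded_opsI[where M = M])
    show "amplify T (f + f') = amplify T f + amplify T f'" if "f \<in> carrier Ind" "f' \<in> carrier Ind" for f f'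
    proof
      fix x
      show "amplify T (f + f') x = (amplify T f + amplify T f') x"
        using that cl[OF that(1)] cl[OF that(2)] Ind_closed[OF that(1)] Ind_closed[OF that(2)]
        by (cases "x \<in> carrier G")
          (simp_all add: amplify_apply amplify_outside Ind.add_closed rep_add op_add_apply[OF T] inv_closed)
    qed
    show "amplify T (cscale Ind c f) = cscale Ind c (amplify T f)" if "f \<in> carrier Ind" for c f
    proof
      fix x
      show "amplify T (cscale Ind c f) x = cscale Ind c (amplify T f) x"
        using that cl[OF that] Ind_closed[OF that] Ind.scale_closed[OF that, of c]
        by (cases "x \<in> carrier G")
          (simp_all add: amplify_apply amplify_outside cscale_Ind rep_scale op_scale_apply[OF T]
            inv_closed scale_zero_right)
    qed
    show "hnorm Ind (amplify T f) \<le> M * hnorm Ind f" if f: "f \<in> carrier Ind" for f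
    proof (rule power2_le_imp_le)
      have "(hnorm Ind (amplify T f))\<^sup>2 \<le> (\<Sum>\<^sub>\<infinity>C\<in>cosets. M\<^sup>2 * (hnorm H (f (coset_repr C)))\<^sup>2)"
        unfolding hnorm_Ind_power2[OF mem[OF f]]
        by (intro infsum_mono Ind_summable mem summ f le coset_repr_closed)
      then show "(hnorm Ind (amplify T f))\<^sup>2 \<le> (M * hnorm Ind f)\<^sup>2"
        by (simp add: infsum_cmult_right' power_mult_distrib hnorm_Ind_power2[OF f])
    qed (use M f in \<open>simp add: hnorm_Ind_nonneg\<close>)
  qed (rule mem)
qed

lemma matrix_form_amplify:
  assumes a: "\<And>i j. \<lbrakk>i < n; j < n\<rbrakk> \<Longrightarrow> a i j \<in> bounded_ops H" and f: "\<And>i. i < n \<Longrightarrow> f i \<in> carrier Ind"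
  shows "matrix_form Ind n (\<lambda>i j. amplify (a i j)) f f
    = (\<Sum>\<^sub>\<infinity>C\<in>cosets. matrix_form H n a (\<lambda>i. \<pi> (coset_repr C) (f i (coset_repr C)))
        (\<lambda>i. \<pi> (coset_repr C) (f i (coset_repr C))))"
    and "(\<lambda>C. matrix_form H n a (\<lambda>i. \<pi> (coset_repr C) (f i (coset_repr C)))
        (\<lambda>i. \<pi> (coset_repr C) (f i (coset_repr C)))) summable_on cosets"
proof -
  define t where "t i j C = cinner H (amplify (a i j) (f j) (coset_repr C)) (f i (coset_repr C))" for i j C
  have am: "amplify (a i j) (f j) \<in> carrier Ind" if "i < n" "j < n" for i j
    using Ind.op_closed[OF amplify_closed[OF a] f] that by blast
  have t: "t i j summable_on cosets" if "i < n" "j < n" for i j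
    unfolding t_def using that by (intro Ind_cinner_summable am f)
  have tt: "t i j C = cinner H (a i j (\<pi> (coset_repr C) (f j (coset_repr C)))) (\<pi> (coset_repr C) (f i (coset_repr C)))"
    if "i < n" "j < n" "C \<in> cosets" for i j C
  proof -
    have s: "coset_repr C \<in> carrier G" by (rule coset_repr_closed[OF that(3)])
    have "\<pi> (coset_repr C) (f j (coset_repr C)) \<in> carrier H"
      using s f[OF that(2)] by (simp add: rep_closed Ind_closed)
    then have "a i j (\<pi> (coset_repr C) (f j (coset_repr C))) \<in> carrier H"
      by (rule op_closed[OF a[OF that(1,2)]])
    then show ?thesis
      using s f that by (simp add: t_def amplify_apply cinner_rep_left inv_closed Ind_closed)
  qed
  have form: "matrix_form H n a (\<lambda>i. \<pi> (coset_repr C) (f i (coset_repr C)))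
      (\<lambda>i. \<pi> (coset_repr C) (f i (coset_repr C))) = (\<Sum>i<n. \<Sum>j<n. t i j C)" if "C \<in> cosets" for C
    using that tt by (simp add: matrix_form_def)
  have inner1: "(\<lambda>C. \<Sum>j<n. t i j C) summable_on cosets" if "i < n" for i
    by (rule infsum_finite_sum(1)) (use t that in auto)
  have inner2: "(\<Sum>\<^sub>\<infinity>C\<in>cosets. \<Sum>j<n. t i j C) = (\<Sum>j<n. infsum (t i j) cosets)" if "i < n" for i
    by (rule infsum_finite_sum(2)) (use t that in auto)
  have outer1: "(\<lambda>C. \<Sum>i<n. \<Sum>j<n. t i j C) summable_on cosets"
    by (rule infsum_finite_sum(1)) (use inner1 in auto)
  have outer2: "(\<Sum>\<^sub>\<infinity>C\<in>cosets. \<Sum>i<n. \<Sum>j<n. t i j C) = (\<Sum>i<n. \<Sum>\<^sub>\<infinity>C\<in>cosets. \<Sum>j<n. t i j C)"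
    by (rule infsum_finite_sum(2)) (use inner1 in auto)
  have "matrix_form Ind n (\<lambda>i j. amplify (a i j)) f f = (\<Sum>i<n. \<Sum>j<n. infsum (t i j) cosets)"
    by (simp add: matrix_form_def cinner_Ind t_def[abs_def])
  also have "\<dots> = (\<Sum>\<^sub>\<infinity>C\<in>cosets. \<Sum>i<n. \<Sum>j<n. t i j C)"
    unfolding outer2 by (intro sum.cong refl) (simp add: inner2)
  also have "\<dots> = (\<Sum>\<^sub>\<infinity>C\<in>cosets. matrix_form H n a (\<lambda>i. \<pi> (coset_repr C) (f i (coset_repr C)))
        (\<lambda>i. \<pi> (coset_repr C) (f i (coset_repr C))))"
    by (intro infsum_cong) (simp add: form)
  finally show "matrix_form Ind n (\<lambda>i j. amplify (a i j)) f f
    = (\<Sum>\<^sub>\<infinity>C\<in>cosets. matrix_form H n a (\<lambda>i. \<pi> (coset_repr C) (f i (coset_repr C)))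
        (\<lambda>i. \<pi> (coset_repr C) (f i (coset_repr C))))" .
  show "(\<lambda>C. matrix_form H n a (\<lambda>i. \<pi> (coset_repr C) (f i (coset_repr C)))
        (\<lambda>i. \<pi> (coset_repr C) (f i (coset_repr C)))) summable_on cosets"
    using outer1 by (rule summable_on_cong[THEN iffD1, rotated]) (simp add: form)
qed

theorem amplify_gamma_map: "gamma_map G H \<pi> (bounded_ops H) Ind ind_rep (bounded_ops Ind) amplify"
proof
  show "amplify \<in> bounded_ops H \<rightarrow> bounded_ops Ind" using amplify_closed by blast
  show "amplify (op_add H S T) = op_add Ind (amplify S) (amplify T)"
    if S: "S \<in> bounded_ops H" and T: "T \<in> bounded_ops H" for S T
  proof (intro Ind.op_eqI amplify_closed op_add_closed Ind.op_add_closed S T ext)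
    fix f x assume f: "f \<in> carrier Ind"
    show "amplify (op_add H S T) f x = op_add Ind (amplify S) (amplify T) f x"
      using f Ind_closed[OF f]
      by (cases "x \<in> carrier G")
        (simp_all add: amplify_apply amplify_outside op_add_eval rep_closed rep_add inv_closed
          op_closed[OF S] op_closed[OF T])
  qed
  show "amplify (op_scale H c T) = op_scale Ind c (amplify T)" if T: "T \<in> bounded_ops H" for T c
  proof (intro Ind.op_eqI amplify_closed op_scale_closed Ind.op_scale_closed T ext)
    fix f x assume f: "f \<in> carrier Ind"
    show "amplify (op_scale H c T) f x = op_scale Ind c (amplify T) f x"
      using f Ind_closed[OF f]
      by (cases "x \<in> carrier G")
        (simp_all add: amplify_apply amplify_outside op_scale_eval cscale_Ind rep_closed rep_scale
          inv_closed op_closed[OF T] scale_zero_right)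
  qed
  show "amplify (op_one H) = op_one Ind"
  proof (intro Ind.op_eqI amplify_closed op_one_closed Ind.op_one_closed ext)
    fix f x assume f: "f \<in> carrier Ind"
    show "amplify (op_one H) f x = op_one Ind f x"
      using f Ind_closed[OF f]
      by (cases "x \<in> carrier G")
        (simp_all add: amplify_apply amplify_outside op_one_eval rep_closed rep_inv Ind_outside)
  qed
  show "amplify (op_action G H \<pi> g T) = op_action G Ind ind_rep g (amplify T)"
    if g: "g \<in> carrier G" and T: "T \<in> bounded_ops H" for g T
  proof (intro Ind.op_eqI amplify_closed op_action_closed Ind.op_action_closed g T ext)
    fix f x assume f: "f \<in> carrier Ind"
    have f': "ind_rep (inv g) f \<in> carrier Ind" using f g by (simp add: ind_rep_closed)
    have Tf: "amplify T (ind_rep (inv g) f) \<in> carrier Ind"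
      using Ind.op_closed[OF amplify_closed[OF T] f'] .
    show "amplify (op_action G H \<pi> g T) f x = op_action G Ind ind_rep g (amplify T) f x"
    proof (cases "x \<in> carrier G")
      case True
      have fx: "f x \<in> carrier H" "T (\<pi> (inv g \<otimes> x) (f x)) \<in> carrier H"
        using f g True by (simp_all add: Ind_closed op_closed[OF T] rep_closed)
      have "g \<otimes> (inv g \<otimes> x) = x" using g True by (simp flip: G.m_assoc)
      then have "op_action G Ind ind_rep g (amplify T) f x
          = \<pi> (inv (inv g \<otimes> x)) (T (\<pi> (inv g \<otimes> x) (f x)))"
        using f g True f' Tf by (simp add: Ind.op_action_apply ind_rep_apply amplify_apply)
      also have "\<dots> = \<pi> (inv x) (\<pi> g (T (\<pi> (inv g) (\<pi> x (f x)))))"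
        using g True fx by (simp add: G.inv_mult_group composition_rule)
      also have "\<dots> = amplify (op_action G H \<pi> g T) f x"
        using f g True fx by (simp add: amplify_apply op_action_apply rep_closed)
      finally show ?thesis by simp
    qed (use f g f' Tf in \<open>simp add: amplify_outside Ind.op_action_apply ind_rep_outside\<close>)
  qed
  show "positive_op (hpower Ind n) (matrix_op Ind n (\<lambda>i j. amplify (a i j)))"
    if a: "\<And>i j. \<lbrakk>i < n; j < n\<rbrakk> \<Longrightarrow> a i j \<in> bounded_ops H"
      and pos: "positive_op (hpower H n) (matrix_op H n a)" for n a
  proof (subst Ind.positive_matrix_op_iff)
    show "amplify (a i j) \<in> bounded_ops Ind" if "i < n" "j < n" for i j
      using a[OF that] by (rule amplify_closed)
    have nn: "0 \<le> matrix_form H n a x x" if "\<forall>i<n. x i \<in> carrier H" for x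
      using positive_matrix_op_iff[of n a] a pos that
      by (auto simp: complex_nonneg_Reals_iff less_eq_complex_def)
    show "\<forall>f. (\<forall>i<n. f i \<in> carrier Ind) \<longrightarrow> matrix_form Ind n (\<lambda>i j. amplify (a i j)) f f \<in> \<real>\<^sub>\<ge>\<^sub>0"
    proof (intro allI impI)
      fix f assume f: "\<forall>i<n. f i \<in> carrier Ind"
      have "0 \<le> (\<Sum>\<^sub>\<infinity>C\<in>cosets. matrix_form H n a (\<lambda>i. \<pi> (coset_repr C) (f i (coset_repr C)))
        (\<lambda>i. \<pi> (coset_repr C) (f i (coset_repr C))))"
      proof (rule infsum_nonneg_complex)
        show "(\<lambda>C. matrix_form H n a (\<lambda>i. \<pi> (coset_repr C) (f i (coset_repr C)))
          (\<lambda>i. \<pi> (coset_repr C) (f i (coset_repr C)))) summable_on cosets"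
          by (rule matrix_form_amplify(2)) (use a f in auto)
        show "0 \<le> matrix_form H n a (\<lambda>i. \<pi> (coset_repr C) (f i (coset_repr C)))
          (\<lambda>i. \<pi> (coset_repr C) (f i (coset_repr C)))" if "C \<in> cosets" for C
          using f that by (intro nn) (auto simp: rep_closed Ind_closed coset_repr_closed)
      qed
      moreover have "matrix_form Ind n (\<lambda>i j. amplify (a i j)) f f
        = (\<Sum>\<^sub>\<infinity>C\<in>cosets. matrix_form H n a (\<lambda>i. \<pi> (coset_repr C) (f i (coset_repr C)))
          (\<lambda>i. \<pi> (coset_repr C) (f i (coset_repr C))))"
        by (rule matrix_form_amplify(1)) (use a f in auto)
      ultimately show "matrix_form Ind n (\<lambda>i j. amplify (a i j)) f f \<in> \<real>\<^sub>\<ge>\<^sub>0"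
        by (simp add: complex_nonneg_Reals_iff less_eq_complex_def)
    qed
  qed
qed

end

section \<open>Almost invariant vectors\<close>

text \<open>
  This follows from the identity \<open>\<bar>\<Sum> a\<^sub>k\<bar>\<^sup>2 + (\<Sum> \<bar>a\<^sub>i - a\<^sub>j\<bar>\<^sup>2) / 2 = card F * \<Sum> \<bar>a\<^sub>k\<bar>\<^sup>2\<close>, the second
  sum being over all pairs: each unordered pair occurs in it twice.
\<close>

lemma norm_sum_power2_add_norm_diff_power2_le:
  fixes a :: "'i \<Rightarrow> complex"
  assumes F: "finite F" and g: "g \<in> F" and h: "h \<in> F"
  shows "(cmod (\<Sum>k\<in>F. a k))\<^sup>2 + (cmod (a g - a h))\<^sup>2 \<le> real (card F) * (\<Sum>k\<in>F. (cmod (a k))\<^sup>2)"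
proof -
  define A where "A = (\<Sum>k\<in>F. (cmod (a k))\<^sup>2)"
  define d where "d i j = (cmod (a i - a j))\<^sup>2" for i j
  have d: "d i j = (cmod (a i))\<^sup>2 + (cmod (a j))\<^sup>2 - 2 * Re (a i * cnj (a j))" for i j
    unfolding d_def cmod_power2 by (simp add: power2_eq_square algebra_simps)
  have "(\<Sum>i\<in>F. \<Sum>j\<in>F. Re (a i * cnj (a j))) = Re ((\<Sum>k\<in>F. a k) * cnj (\<Sum>k\<in>F. a k))"
    by (simp only: sum_product cnj_sum Re_sum)
  also have "\<dots> = (cmod (\<Sum>k\<in>F. a k))\<^sup>2"
    by (simp only: complex_norm_square[symmetric] Re_complex_of_real)
  finally have tot: "(\<Sum>i\<in>F. \<Sum>j\<in>F. d i j) = 2 * (real (card F) * A) - 2 * (cmod (\<Sum>k\<in>F. a k))\<^sup>2"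
    by (simp add: d sum.distrib sum_subtractf A_def sum_distrib_left[symmetric])
  have "2 * d g h \<le> (\<Sum>i\<in>F. \<Sum>j\<in>F. d i j)"
  proof (cases "g = h")
    case True
    then show ?thesis by (simp add: d_def sum_nonneg)
  next
    case False
    have "d g h + d h g = (\<Sum>p\<in>{(g, h), (h, g)}. d (fst p) (snd p))" using False by simp
    also have "\<dots> \<le> (\<Sum>p\<in>F \<times> F. d (fst p) (snd p))"
      using F g h by (intro sum_mono2) (auto simp: d_def)
    also have "\<dots> = (\<Sum>i\<in>F. \<Sum>j\<in>F. d i j)"
      by (simp add: sum.cartesian_product case_prod_beta)
    finally show ?thesis by (simp add: d_def norm_minus_commute)
  qed
  then show ?thesis unfolding tot by (simp add: d_def A_def)
qed

lemma carrier_ell2: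
  "u \<in> carrier (ell2 X) \<longleftrightarrow> (\<forall>x. x \<notin> X \<longrightarrow> u x = 0) \<and> (\<lambda>x. (cmod (u x))\<^sup>2) summable_on X"
  by (simp add: ell2_def)

lemma cscale_ell2: "cscale (ell2 X) c u = (\<lambda>x. c * u x)"
  by (simp add: ell2_def)

text \<open>The square of the norm in \<^term>\<open>ell2 X\<close>.\<close>

definition ell2_sum :: "'x set \<Rightarrow> ('x \<Rightarrow> complex) \<Rightarrow> real" where
  "ell2_sum X u = (\<Sum>\<^sub>\<infinity>x\<in>X. (cmod (u x))\<^sup>2)"

lemma ell2_sum_nonneg: "0 \<le> ell2_sum X u"
  unfolding ell2_sum_def by (rule infsum_nonneg) simp

lemma cinner_ell2_self:
  assumes "u \<in> carrier (ell2 X)"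
  shows "(\<Sum>\<^sub>\<infinity>x\<in>X. u x * cnj (u x)) = of_real (ell2_sum X u)"
proof -
  have "((\<lambda>x. of_real ((cmod (u x))\<^sup>2) :: complex) has_sum of_real (ell2_sum X u)) X"
    unfolding has_sum_of_real_iff ell2_sum_def
    using assms by (intro has_sum_infsum) (simp add: carrier_ell2)
  then have "((\<lambda>x. u x * cnj (u x)) has_sum of_real (ell2_sum X u)) X"
    by (simp only: complex_norm_square)
  then show ?thesis by (rule infsumI)
qed

lemma hnorm_ell2: "u \<in> carrier (ell2 X) \<Longrightarrow> hnorm (ell2 X) u = sqrt (ell2_sum X u)"
  using cinner_ell2_self[of u X] by (simp add: hnorm_def ell2_def)

lemma ell2_add_closed:
  assumes u: "u \<in> carrier (ell2 X)" and v: "v \<in> carrier (ell2 X)"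
  shows "(\<lambda>x. u x + v x) \<in> carrier (ell2 X)"
  unfolding carrier_ell2
proof (intro conjI)
  show "(\<lambda>x. (cmod (u x + v x))\<^sup>2) summable_on X"
  proof (rule summable_on_comparison_test)
    show "(\<lambda>x. 2 * (cmod (u x))\<^sup>2 + 2 * (cmod (v x))\<^sup>2) summable_on X"
      using u v by (intro summable_on_add summable_on_cmult_right) (auto simp: carrier_ell2)
    show "(cmod (u x + v x))\<^sup>2 \<le> 2 * (cmod (u x))\<^sup>2 + 2 * (cmod (v x))\<^sup>2" for x
    proof -
      have "(cmod (u x + v x))\<^sup>2 \<le> (cmod (u x) + cmod (v x))\<^sup>2"
        by (intro power_mono norm_triangle_ineq) simp
      also have "\<dots> \<le> 2 * (cmod (u x))\<^sup>2 + 2 * (cmod (v x))\<^sup>2"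
        using sum_squares_bound[of "cmod (u x)" "cmod (v x)"] by (simp add: power2_sum)
      finally show ?thesis .
    qed
  qed simp
qed (use u v in \<open>auto simp: carrier_ell2\<close>)

lemma ell2_scale_closed:
  assumes u: "u \<in> carrier (ell2 X)"
  shows "(\<lambda>x. c * u x) \<in> carrier (ell2 X)"
  using u summable_on_cmult_right[of "\<lambda>x. (cmod (u x))\<^sup>2" X "(cmod c)\<^sup>2"]
  by (auto simp: carrier_ell2 norm_mult power_mult_distrib)

lemma ell2_diff_closed:
  assumes u: "u \<in> carrier (ell2 X)" and v: "v \<in> carrier (ell2 X)"
  shows "(\<lambda>x. u x - v x) \<in> carrier (ell2 X)"
  using ell2_add_closed[OF u ell2_scale_closed[OF v, of "- 1"]] by simp

lemma ell2_sum_closed: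
  "finite I \<Longrightarrow> (\<And>i. i \<in> I \<Longrightarrow> v i \<in> carrier (ell2 X)) \<Longrightarrow> (\<lambda>x. \<Sum>i\<in>I. v i x) \<in> carrier (ell2 X)"
  by (induction I rule: finite_induct) (simp_all add: ell2_add_closed, simp add: carrier_ell2)

lemma ell2_sum_scale: "ell2_sum X (\<lambda>x. c * u x) = (cmod c)\<^sup>2 * ell2_sum X u"
  by (simp add: ell2_sum_def norm_mult power_mult_distrib infsum_cmult_right')

lemma sum_apply_fun: "(\<Sum>i\<in>I. v i) x = (\<Sum>i\<in>I. v i x)" for v :: "'i \<Rightarrow> 'x \<Rightarrow> 'b::comm_monoid_add"
  by (induction I rule: infinite_finite_induct) auto

lemma op_norm_trivial_rep_ge:
  assumes F: "finite F"
  shows "real (card F) \<le> op_norm complex_line (group_algebra_op complex_line trivial_rep F (\<lambda>_. 1))"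
proof -
  have T: "group_algebra_op complex_line trivial_rep F (\<lambda>_. 1) = (\<lambda>x. of_nat (card F) * x)"
    by (auto simp: group_algebra_op_def complex_line_def trivial_rep_def)
  have n: "hnorm complex_line z = cmod z" for z
    by (simp add: hnorm_def complex_line_def cmod_def power2_eq_square)
  have c: "carrier complex_line = UNIV" by (simp add: complex_line_def)
  show ?thesis
    unfolding op_norm_def T n c
  proof (rule cInf_greatest)
    show "{M. 0 \<le> M \<and> (\<forall>x\<in>UNIV. cmod (of_nat (card F) * x) \<le> M * cmod x)} \<noteq> {}"
      by (auto intro!: exI[of _ "real (card F)"] simp: norm_mult)
    show "real (card F) \<le> M"
      if "M \<in> {M. 0 \<le> M \<and> (\<forall>x\<in>UNIV. cmod (of_nat (card F) * x) \<le> M * cmod x)}" for M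
      using that by (auto dest: spec[of _ 1])
  qed
qed

context subgroup_pair
begin

abbreviation ell2_cosets :: "('g set \<Rightarrow> complex) hilbert" where "ell2_cosets \<equiv> ell2 cosets"

lemma quasi_regular_apply:
  "\<lbrakk>u \<in> carrier ell2_cosets; C \<in> cosets\<rbrakk> \<Longrightarrow> quasi_regular G \<Lambda> g u C = u (inv g <# C)"
  by (simp add: quasi_regular_def)

lemma quasi_regular_outside:
  "\<lbrakk>u \<in> carrier ell2_cosets; C \<notin> cosets\<rbrakk> \<Longrightarrow> quasi_regular G \<Lambda> g u C = 0"
  by (simp add: quasi_regular_def)

lemma quasi_regular_closed:
  assumes u: "u \<in> carrier ell2_cosets" and g: "g \<in> carrier G"
  shows "quasi_regular G \<Lambda> g u \<in> carrier ell2_cosets"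
proof -
  have "(\<lambda>C. (cmod (u (inv g <# C)))\<^sup>2) summable_on cosets"
    using summable_on_reindex_bij_betw[OF bij_translate_cosets[of "inv g"],
        where f = "\<lambda>C. (cmod (u C))\<^sup>2"] u g by (simp add: carrier_ell2)
  then have "(\<lambda>C. (cmod (quasi_regular G \<Lambda> g u C))\<^sup>2) summable_on cosets"
    by (rule summable_on_cong[THEN iffD1, rotated]) (simp add: quasi_regular_apply u)
  then show ?thesis using u unfolding carrier_ell2[of "quasi_regular G \<Lambda> g u"]
    by (simp add: quasi_regular_outside)
qed

lemma ell2_sum_quasi_regular:
  assumes u: "u \<in> carrier ell2_cosets" and g: "g \<in> carrier G"
  shows "ell2_sum cosets (quasi_regular G \<Lambda> g u) = ell2_sum cosets u"
proof -
  have "ell2_sum cosets (quasi_regular G \<Lambda> g u) = (\<Sum>\<^sub>\<infinity>C\<in>cosets. (cmod (u (inv g <# C)))\<^sup>2)"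
    unfolding ell2_sum_def by (intro infsum_cong) (simp add: quasi_regular_apply u)
  also have "\<dots> = ell2_sum cosets u"
    unfolding ell2_sum_def using g by (intro infsum_reindex_bij_betw bij_translate_cosets) simp
  finally show ?thesis .
qed

lemma quasi_regular_scale:
  assumes "u \<in> carrier ell2_cosets"
  shows "quasi_regular G \<Lambda> g (\<lambda>C. c * u C) = (\<lambda>C. c * quasi_regular G \<Lambda> g u C)"
proof
  fix C
  show "quasi_regular G \<Lambda> g (\<lambda>C. c * u C) C = c * quasi_regular G \<Lambda> g u C"
    using assms by (cases "C \<in> cosets")
      (simp_all add: quasi_regular_apply quasi_regular_outside ell2_scale_closed)
qed

lemma quasi_regular_one:
  assumes "u \<in> carrier ell2_cosets"
  shows "quasi_regular G \<Lambda> \<one> u = u"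
proof
  fix C
  show "quasi_regular G \<Lambda> \<one> u C = u C"
  proof (cases "C \<in> cosets")
    case True
    then have "\<one> <# C = C" using translate_cosets(2)[of \<one> C] translate_coset[of \<one>] by (auto simp: LCOSETS_def)
    then show ?thesis using True assms by (simp add: quasi_regular_apply)
  qed (use assms in \<open>simp_all add: quasi_regular_outside carrier_ell2\<close>)
qed

text \<open>
  Let \<open>F\<close> contain \<open>\<one>\<close>.  Weak containment of the trivial representation yields a vector \<open>u\<close> such that the
  norm of the sum of its translates over \<open>F\<close> is almost \<open>card F\<close> times the norm of \<open>u\<close>; these
  translates are then almost equal.
\<close>

theorem co_amenable_almost_invariant:
  assumes co: "co_amenable G \<Lambda>" and F: "finite F" "F \<subseteq> carrier G" and e: "0 < e"
  shows "\<exists>u\<in>carrier ell2_cosets. ell2_sum cosets u = 1 \<and>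
    (\<forall>g\<in>F. ell2_sum cosets (\<lambda>C. quasi_regular G \<Lambda> g u C - u C) < e)"
proof -
  define F' where "F' = insert \<one> F"
  have F': "finite F'" "F' \<subseteq> carrier G" "\<one> \<in> F'" "F \<subseteq> F'" using F by (auto simp: F'_def)
  define n where "n = real (card F')"
  have n: "0 < n" using F' by (auto simp: n_def card_gt_0_iff)
  \<comment> \<open>The constant is less than \<open>n\<close>, but so close to it that \<open>n\<^sup>2 - M\<^sup>2 \<le> e\<close>.\<close>
  define M where "M = sqrt (max 0 (n\<^sup>2 - e))"
  have M2: "M\<^sup>2 = max 0 (n\<^sup>2 - e)" by (simp add: M_def)
  have M: "0 \<le> M" "M < n"
    using n e by (simp add: M_def, simp add: M_def real_sqrt_less_iff real_less_lsqrt)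
  define T where "T = group_algebra_op ell2_cosets (quasi_regular G \<Lambda>) F' (\<lambda>_. 1)"
  have "n \<le> op_norm ell2_cosets T"
    using order_trans[OF op_norm_trivial_rep_ge[OF F'(1)]] co F'
    unfolding co_amenable_def weakly_contained_def T_def n_def by blast
  then have "M \<notin> op_bounds ell2_cosets T"
    using op_norm_le[of M ell2_cosets T] M by auto
  then obtain u where u: "u \<in> carrier ell2_cosets" and Mu: "M * hnorm ell2_cosets u < hnorm ell2_cosets (T u)"
    using M by (auto simp: op_bounds_def not_le)
  define v where "v g = quasi_regular G \<Lambda> g u" for g
  have v: "v g \<in> carrier ell2_cosets" "ell2_sum cosets (v g) = ell2_sum cosets u" if "g \<in> F'" for g
    using that F' u by (auto simp: v_def quasi_regular_closed ell2_sum_quasi_regular)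
  have Tu: "T u = (\<lambda>C. \<Sum>g\<in>F'. v g C)"
    using u by (auto simp: T_def group_algebra_op_def v_def cscale_ell2 sum_apply_fun)
  have Tu_closed: "T u \<in> carrier ell2_cosets"
    unfolding Tu using F' v by (intro ell2_sum_closed) auto
  have "M * sqrt (ell2_sum cosets u) < sqrt (ell2_sum cosets (T u))"
    using Mu u Tu_closed by (simp add: hnorm_ell2)
  then have "(M * sqrt (ell2_sum cosets u))\<^sup>2 < (sqrt (ell2_sum cosets (T u)))\<^sup>2"
    using M by (intro power_strict_mono) (auto simp: ell2_sum_nonneg)
  then have big: "M\<^sup>2 * ell2_sum cosets u < ell2_sum cosets (T u)"
    by (simp add: power_mult_distrib ell2_sum_nonneg)
  have small: "ell2_sum cosets (\<lambda>C. v g C - u C) < (n\<^sup>2 - M\<^sup>2) * ell2_sum cosets u" if gF: "g \<in> F'" for g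
  proof -
    have vu: "(\<lambda>C. v g C - u C) \<in> carrier ell2_cosets" using v[OF gF] u by (intro ell2_diff_closed)
    have s: "(\<lambda>C. (cmod (w C))\<^sup>2) summable_on cosets" if "w \<in> carrier ell2_cosets" for w
      using that by (simp add: carrier_ell2)
    have sv: "(\<lambda>C. (cmod (v g C))\<^sup>2) summable_on cosets" if "g \<in> F'" for g
      using s v that by blast
    have "ell2_sum cosets (T u) + ell2_sum cosets (\<lambda>C. v g C - u C)
        = (\<Sum>\<^sub>\<infinity>C\<in>cosets. (cmod (T u C))\<^sup>2 + (cmod (v g C - u C))\<^sup>2)"
      unfolding ell2_sum_def using s[OF Tu_closed] s[OF vu] by (simp add: infsum_add)
    also have "\<dots> \<le> (\<Sum>\<^sub>\<infinity>C\<in>cosets. n * (\<Sum>k\<in>F'. (cmod (v k C))\<^sup>2))"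
    proof (rule infsum_mono)
      show "(\<lambda>C. (cmod (T u C))\<^sup>2 + (cmod (v g C - u C))\<^sup>2) summable_on cosets"
        by (intro summable_on_add s Tu_closed vu)
      show "(\<lambda>C. n * (\<Sum>k\<in>F'. (cmod (v k C))\<^sup>2)) summable_on cosets"
        by (intro summable_on_cmult_right infsum_finite_sum(1) F' sv)
      show "(cmod (T u C))\<^sup>2 + (cmod (v g C - u C))\<^sup>2 \<le> n * (\<Sum>k\<in>F'. (cmod (v k C))\<^sup>2)" for C
        using norm_sum_power2_add_norm_diff_power2_le[OF F'(1) gF F'(3), of "\<lambda>k. v k C"] u
        by (simp add: Tu n_def v_def quasi_regular_one)
    qed
    also have "\<dots> = n * (\<Sum>k\<in>F'. \<Sum>\<^sub>\<infinity>C\<in>cosets. (cmod (v k C))\<^sup>2)"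
      unfolding infsum_cmult_right' using F' sv by (subst infsum_finite_sum(2)) auto
    also have "\<dots> = n * (\<Sum>k\<in>F'. ell2_sum cosets u)"
      using v(2) by (simp add: ell2_sum_def[symmetric])
    also have "\<dots> = n\<^sup>2 * ell2_sum cosets u"
      by (simp add: n_def power2_eq_square)
    finally show ?thesis using big by (simp add: algebra_simps)
  qed
  define r where "r = ell2_sum cosets u"
  have "r \<noteq> 0"
    using small[OF F'(3)] ell2_sum_nonneg[of cosets "\<lambda>C. v \<one> C - u C"] by (auto simp: r_def)
  then have r: "0 < r" using ell2_sum_nonneg[of cosets u] by (simp add: r_def)
  define c where "c = complex_of_real (1 / sqrt r)"
  have c: "(cmod c)\<^sup>2 = 1 / r" using r by (simp add: c_def norm_divide power_divide)
  show ?thesis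
  proof (intro bexI conjI ballI)
    show "(\<lambda>C. c * u C) \<in> carrier ell2_cosets" by (rule ell2_scale_closed[OF u])
    show "ell2_sum cosets (\<lambda>C. c * u C) = 1"
      using r by (simp add: ell2_sum_scale c flip: r_def)
    fix g assume g: "g \<in> F"
    have "ell2_sum cosets (\<lambda>C. quasi_regular G \<Lambda> g (\<lambda>C. c * u C) C - c * u C)
        = ell2_sum cosets (\<lambda>C. c * (v g C - u C))"
      by (simp add: quasi_regular_scale[OF u] v_def right_diff_distrib)
    also have "\<dots> = 1 / r * ell2_sum cosets (\<lambda>C. v g C - u C)"
      by (simp add: ell2_sum_scale c)
    also have "\<dots> < 1 / r * ((n\<^sup>2 - M\<^sup>2) * r)"
      using small[of g] g F'(4) r by (intro mult_strict_left_mono) (auto simp: r_def)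
    also have "\<dots> = n\<^sup>2 - M\<^sup>2" using r by simp
    also have "\<dots> \<le> e" by (simp add: M2)
    finally show "ell2_sum cosets (\<lambda>C. quasi_regular G \<Lambda> g (\<lambda>C. c * u C) C - c * u C) < e" .
  qed
qed

text \<open>
  The sets of \<open>(g, \<epsilon>)\<close>-invariant unit vectors have the finite intersection property, so they generate
  a proper filter.
\<close>

corollary co_amenable_invariant_filter:
  assumes co: "co_amenable G \<Lambda>"
  obtains F where "F \<noteq> bot"
    and "eventually (\<lambda>u. u \<in> carrier ell2_cosets \<and> ell2_sum cosets u = 1) F"
    and "\<And>g. g \<in> carrier G \<Longrightarrow> ((\<lambda>u. ell2_sum cosets (\<lambda>C. quasi_regular G \<Lambda> g u C - u C)) \<longlongrightarrow> 0) F"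
proof -
  define U where "U p = {u \<in> carrier ell2_cosets. ell2_sum cosets u = 1 \<and>
    ell2_sum cosets (\<lambda>C. quasi_regular G \<Lambda> (fst p) u C - u C) < snd p}" for p :: "'g \<times> real"
  define F where "F = (INF p\<in>carrier G \<times> {0<..}. principal (U p))"
  have le: "F \<le> principal (U (g, e))" if "g \<in> carrier G" "0 < e" for g e
    unfolding F_def using that by (intro INF_lower) auto
  show thesis
  proof (rule that)
    show "F \<noteq> bot"
      unfolding F_def
    proof (rule INF_filter_not_bot)
      fix P :: "('g \<times> real) set"
      assume P: "P \<subseteq> carrier G \<times> {0<..}" "finite P"
      define e where "e = Min (insert 1 (snd ` P))"
      have e: "0 < e" "\<And>p. p \<in> P \<Longrightarrow> e \<le> snd p"
        using P by (auto simp: e_def)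
      have P': "fst ` P \<subseteq> carrier G" using P by auto
      obtain u where "u \<in> carrier ell2_cosets" "ell2_sum cosets u = 1"
        "\<And>g. g \<in> fst ` P \<Longrightarrow> ell2_sum cosets (\<lambda>C. quasi_regular G \<Lambda> g u C - u C) < e"
        using co_amenable_almost_invariant[OF co finite_imageI[OF P(2)] P' e(1)] by blast
      then have "u \<in> (\<Inter>p\<in>P. U p)" using e by (force simp: U_def)
      then show "(INF p\<in>P. principal (U p)) \<noteq> bot"
        using P by (auto simp: INF_principal_finite principal_eq_bot_iff)
    qed
    show "eventually (\<lambda>u. u \<in> carrier ell2_cosets \<and> ell2_sum cosets u = 1) F"
      by (rule filter_leD[OF le[of \<one> 1]]) (auto simp: eventually_principal U_def)
    show "((\<lambda>u. ell2_sum cosets (\<lambda>C. quasi_regular G \<Lambda> g u C - u C)) \<longlongrightarrow> 0) F"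
      if g: "g \<in> carrier G" for g
    proof (rule tendstoI)
      fix e :: real assume e: "0 < e"
      show "\<forall>\<^sub>F u in F. dist (ell2_sum cosets (\<lambda>C. quasi_regular G \<Lambda> g u C - u C)) 0 < e"
        by (rule filter_leD[OF le[OF g e]])
          (auto simp: eventually_principal U_def dist_norm ell2_sum_nonneg)
    qed
  qed
qed

end


section \<open>Limits along a finer filter\<close>

text \<open>By Tychonoff's theorem, a bounded family of functions converges pointwise along a finer filter.\<close>

lemma bounded_family_converges:
  fixes b :: "'i \<Rightarrow> 't \<Rightarrow> complex"
  assumes F: "F \<noteq> bot" and bdd: "eventually (\<lambda>i. \<forall>t. cmod (b i t) \<le> M t) F"
  obtains F' l where "F' \<le> F" "F' \<noteq> bot" "\<And>t. ((\<lambda>i. b i t) \<longlongrightarrow> l t) F'"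
proof -
  define K where "K = PiE UNIV (\<lambda>t. cball (0 :: complex) (M t))"
  have "compactin (product_topology (\<lambda>_. euclidean) UNIV) K"
    unfolding K_def compactin_PiE by simp
  then have "compact K" by (simp add: euclidean_product_topology)
  moreover have "eventually (\<lambda>f. f \<in> K) (filtermap b F)"
    unfolding eventually_filtermap by (rule eventually_mono[OF bdd]) (auto simp: K_def)
  moreover have "filtermap b F \<noteq> bot" using F by (simp add: filtermap_bot_iff)
  ultimately obtain l where l: "inf (nhds l) (filtermap b F) \<noteq> bot"
    unfolding compact_filter by blast
  \<comment> \<open>\<open>l\<close> is only a cluster point; it becomes the limit along the traces of its neighbourhoods.\<close>
  define F' where "F' = inf F (filtercomap b (nhds l))"
  have "F' \<noteq> bot"
  proof
    assume "F' = bot"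
    then have "eventually (\<lambda>_. False) F'" by simp
    then obtain P Q where P: "eventually P F" and Q: "eventually Q (nhds l)"
      and PQ: "\<And>i. P i \<Longrightarrow> Q (b i) \<Longrightarrow> False"
      unfolding F'_def eventually_inf eventually_filtercomap by blast
    have "eventually (\<lambda>f. \<not> Q f) (filtermap b F)"
      unfolding eventually_filtermap using P by (rule eventually_mono) (use PQ in blast)
    then have "eventually (\<lambda>_. False) (inf (nhds l) (filtermap b F))"
      unfolding eventually_inf using Q by blast
    then show False using l by (simp add: trivial_limit_def)
  qed
  moreover have "((\<lambda>i. b i t) \<longlongrightarrow> l t) F'" for t
  proof -
    have lim: "filterlim b (nhds l) F'"
      unfolding F'_def by (rule filterlim_mono[OF filterlim_filtercomap]) auto
    show ?thesis
      using continuous_on_tendsto_compose[OF continuous_on_product_coordinates lim, of t] by simp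
  qed
  ultimately show thesis using that[of F' l] by (simp add: F'_def)
qed

section \<open>Compressing operators on the induced space\<close>

context subgroup_rep
begin

text \<open>
  Under the identification of the induced space with \<open>\<ell>\<^sup>2(G/\<Lambda>) \<otimes> H\<close>, this is the vector
  \<open>u \<otimes> \<xi>\<close>.
\<close>

definition elementary :: "('g set \<Rightarrow> complex) \<Rightarrow> 'a \<Rightarrow> 'g \<Rightarrow> 'a" where
  "elementary u \<xi> = (\<lambda>x. if x \<in> carrier G then cscale H (u (x <# \<Lambda>)) (\<pi> (inv x) \<xi>) else 0)"

lemma elementary_repr:
  "C \<in> cosets \<Longrightarrow> elementary u \<xi> (coset_repr C) = cscale H (u C) (\<pi> (inv (coset_repr C)) \<xi>)"
  by (simp add: elementary_def coset_repr_closed coset_eq coset_repr_in)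

lemma elementary_closed:
  assumes u: "u \<in> carrier ell2_cosets" and \<xi>: "\<xi> \<in> carrier H"
  shows "elementary u \<xi> \<in> carrier Ind"
  unfolding in_Ind_iff
proof (intro conjI ballI allI impI)
  have "(\<lambda>C. (cmod (u C))\<^sup>2 * (hnorm H \<xi>)\<^sup>2) summable_on cosets"
    using u by (intro summable_on_cmult_left) (simp add: carrier_ell2)
  then show "(\<lambda>C. (hnorm H (elementary u \<xi> (coset_repr C)))\<^sup>2) summable_on cosets"
    by (rule summable_on_cong[THEN iffD1, rotated])
      (simp add: elementary_repr hnorm_scale hnorm_rep rep_closed inv_closed coset_repr_closed \<xi> power_mult_distrib)
  show "elementary u \<xi> (x \<otimes> h) = \<pi> (inv h) (elementary u \<xi> x)" if x: "x \<in> carrier G" and h: "h \<in> \<Lambda>" for x h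
  proof -
    have hG: "h \<in> carrier G" using h by (rule mem_carrier)
    show ?thesis
      using x h hG \<xi>
      by (simp add: elementary_def coset_mult G.inv_mult_group composition_rule rep_scale rep_closed inv_closed)
  qed
qed (use \<xi> in \<open>auto simp: elementary_def scale_closed rep_closed inv_closed\<close>)

lemma cinner_elementary:
  assumes u: "u \<in> carrier ell2_cosets" and \<xi>: "\<xi> \<in> carrier H" and \<eta>: "\<eta> \<in> carrier H"
  shows "cinner Ind (elementary u \<xi>) (elementary u \<eta>) = of_real (ell2_sum cosets u) * cinner H \<xi> \<eta>"
proof -
  have "cinner Ind (elementary u \<xi>) (elementary u \<eta>) = (\<Sum>\<^sub>\<infinity>C\<in>cosets. (u C * cnj (u C)) * cinner H \<xi> \<eta>)"
    unfolding cinner_Ind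
    by (intro infsum_cong) (simp add: elementary_repr cinner_scale cinner_scale_right isometric
        rep_closed scale_closed inv_closed coset_repr_closed \<xi> \<eta>)
  then show ?thesis
    using cinner_ell2_self[OF u] by (simp add: infsum_cmult_left')
qed

lemma hnorm_elementary:
  assumes "u \<in> carrier ell2_cosets" "\<xi> \<in> carrier H"
  shows "hnorm Ind (elementary u \<xi>) = sqrt (ell2_sum cosets u) * hnorm H \<xi>"
  using assms by (simp add: hnorm_def cinner_elementary real_sqrt_mult)

lemma elementary_add:
  "\<lbrakk>\<xi> \<in> carrier H; \<eta> \<in> carrier H\<rbrakk> \<Longrightarrow> elementary u (\<xi> + \<eta>) = elementary u \<xi> + elementary u \<eta>"
  by (auto simp: elementary_def rep_add inv_closed scale_add_right)

lemma elementary_scale: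
  "\<xi> \<in> carrier H \<Longrightarrow> elementary u (cscale H c \<xi>) = cscale Ind c (elementary u \<xi>)"
  by (auto simp: elementary_def cscale_Ind rep_scale inv_closed scale_scale scale_zero_right mult.commute)

lemma elementary_diff:
  "elementary (\<lambda>C. u C - v C) \<xi> = elementary u \<xi> - elementary v \<xi>"
proof
  fix x
  show "elementary (\<lambda>C. u C - v C) \<xi> x = (elementary u \<xi> - elementary v \<xi>) x"
    using scale_add_left[of "u (x <# \<Lambda>) - v (x <# \<Lambda>)" "v (x <# \<Lambda>)" "\<pi> (inv x) \<xi>"]
    by (simp add: elementary_def algebra_simps)
qed

lemma ind_rep_elementary:
  assumes u: "u \<in> carrier ell2_cosets" and \<xi>: "\<xi> \<in> carrier H" and g: "g \<in> carrier G"
  shows "ind_rep g (elementary u \<xi>) = elementary (quasi_regular G \<Lambda> g u) (\<pi> g \<xi>)"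
proof
  fix x
  show "ind_rep g (elementary u \<xi>) x = elementary (quasi_regular G \<Lambda> g u) (\<pi> g \<xi>) x"
  proof (cases "x \<in> carrier G")
    case True
    then show ?thesis
      using g u \<xi> elementary_closed[OF u \<xi>]
      by (simp add: ind_rep_apply)
        (simp add: elementary_def quasi_regular_apply coset_in_cosets translate_coset
          G.inv_mult_group composition_rule)
  qed (use elementary_closed[OF u \<xi>] in \<open>simp add: ind_rep_outside elementary_def\<close>)
qed

lemma cmod_cinner_op_elementary_le:
  assumes S: "S \<in> bounded_ops Ind" and u: "u \<in> carrier ell2_cosets" and v: "v \<in> carrier ell2_cosets"
    and \<xi>: "\<xi> \<in> carrier H" and \<eta>: "\<eta> \<in> carrier H"
  shows "cmod (cinner Ind (S (elementary u \<xi>)) (elementary v \<eta>))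
    \<le> op_norm Ind S * (sqrt (ell2_sum cosets u) * hnorm H \<xi>) * (sqrt (ell2_sum cosets v) * hnorm H \<eta>)"
proof -
  have e: "elementary u \<xi> \<in> carrier Ind" "elementary v \<eta> \<in> carrier Ind"
    using elementary_closed u v \<xi> \<eta> by blast+
  have "cmod (cinner Ind (S (elementary u \<xi>)) (elementary v \<eta>))
      \<le> hnorm Ind (S (elementary u \<xi>)) * hnorm Ind (elementary v \<eta>)"
    by (rule Ind.cauchy_schwarz[OF Ind.op_closed[OF S e(1)] e(2)])
  also have "\<dots> \<le> op_norm Ind S * hnorm Ind (elementary u \<xi>) * hnorm Ind (elementary v \<eta>)"
    by (intro mult_right_mono Ind.hnorm_op_le S e Ind.hnorm_nonneg)
  finally show ?thesis using u v \<xi> \<eta> by (simp add: hnorm_elementary)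
qed

text \<open>
  A limit of the compressions of \<open>S\<close> to the copies \<open>u \<otimes> H\<close> of \<open>H\<close>, where \<open>u\<close> runs through unit
  vectors that become more and more invariant; the latter gives equivariance.
\<close>

theorem compression_gamma_map:
  assumes co: "co_amenable G \<Lambda>"
  shows "\<exists>\<beta>. gamma_map G Ind ind_rep (bounded_ops Ind) H \<pi> (bounded_ops H) \<beta>"
proof -
  obtain F0 where F0: "F0 \<noteq> bot"
    and unit0: "eventually (\<lambda>u. u \<in> carrier ell2_cosets \<and> ell2_sum cosets u = 1) F0"
    and inv0: "\<And>g. g \<in> carrier G \<Longrightarrow>
      ((\<lambda>u. ell2_sum cosets (\<lambda>C. quasi_regular G \<Lambda> g u C - u C)) \<longlongrightarrow> 0) F0"
    using co_amenable_invariant_filter[OF co] by blast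
  \<comment> \<open>All forms \<open>\<langle>S (u \<otimes> \<xi>), u \<otimes> \<eta>\<rangle>\<close> are to converge along the same filter, so they are treated
    as one family indexed by the triples \<open>(S, \<xi>, \<eta>)\<close>.\<close>
  define D where "D t \<longleftrightarrow> fst t \<in> bounded_ops Ind \<and> fst (snd t) \<in> carrier H \<and> snd (snd t) \<in> carrier H"
    for t :: "(('g \<Rightarrow> 'a) \<Rightarrow> 'g \<Rightarrow> 'a) \<times> 'a \<times> 'a"
  define b where "b u t = (if D t then cinner Ind (fst t (elementary u (fst (snd t)))) (elementary u (snd (snd t))) else 0)"
    for u t
  define M where "M t = (if D t then op_norm Ind (fst t) * hnorm H (fst (snd t)) * hnorm H (snd (snd t)) else 0)"
    for t
  have bound: "cmod (cinner Ind (S (elementary u \<xi>)) (elementary u \<eta>)) \<le> op_norm Ind S * hnorm H \<xi> * hnorm H \<eta>"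
    if "S \<in> bounded_ops Ind" "u \<in> carrier ell2_cosets" "ell2_sum cosets u = 1" "\<xi> \<in> carrier H" "\<eta> \<in> carrier H"
    for S u \<xi> \<eta>
    using cmod_cinner_op_elementary_le[OF that(1,2,2,4,5)] that(3) by simp
  have "eventually (\<lambda>u. \<forall>t. cmod (b u t) \<le> M t) F0"
  proof (rule eventually_mono[OF unit0], intro allI, elim conjE)
    fix u t assume u: "u \<in> carrier ell2_cosets" "ell2_sum cosets u = 1"
    show "cmod (b u t) \<le> M t"
      using bound[OF _ u, of "fst t" "fst (snd t)" "snd (snd t)"] by (simp add: b_def M_def D_def)
  qed
  then obtain F l where F: "F \<le> F0" "F \<noteq> bot" and l: "\<And>t. ((\<lambda>u. b u t) \<longlongrightarrow> l t) F"
    by (rule bounded_family_converges[OF F0]) (rule that)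
  have unit: "eventually (\<lambda>u. u \<in> carrier ell2_cosets \<and> ell2_sum cosets u = 1) F"
    using filter_leD[OF F(1) unit0] .
  define L where "L S \<xi> \<eta> = l (S, \<xi>, \<eta>)" for S \<xi> \<eta>
  have L: "((\<lambda>u. cinner Ind (S (elementary u \<xi>)) (elementary u \<eta>)) \<longlongrightarrow> L S \<xi> \<eta>) F"
    if "S \<in> bounded_ops Ind" "\<xi> \<in> carrier H" "\<eta> \<in> carrier H" for S \<xi> \<eta>
    using l[of "(S, \<xi>, \<eta>)"] that by (simp add: b_def D_def L_def)
  have L_eqI: "L S \<xi> \<eta> = z"
    if "S \<in> bounded_ops Ind" "\<xi> \<in> carrier H" "\<eta> \<in> carrier H" and "(f \<longlongrightarrow> z) F"
      and eq: "\<And>u. u \<in> carrier ell2_cosets \<Longrightarrow> ell2_sum cosets u = 1 \<Longrightarrow>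
        f u = cinner Ind (S (elementary u \<xi>)) (elementary u \<eta>)" for S \<xi> \<eta> f z
  proof (rule tendsto_unique[OF F(2) L[OF that(1-3)]])
    show "((\<lambda>u. cinner Ind (S (elementary u \<xi>)) (elementary u \<eta>)) \<longlongrightarrow> z) F"
      by (rule Lim_transform_eventually[OF that(4)])
        (rule eventually_mono[OF unit], use eq in blast)
  qed
  note e_closed = elementary_closed
  have S_closed: "S (elementary u \<xi>) \<in> carrier Ind"
    if "S \<in> bounded_ops Ind" "u \<in> carrier ell2_cosets" "\<xi> \<in> carrier H" for S u \<xi>
    using Ind.op_closed[OF that(1) e_closed[OF that(2,3)]] .
  have "\<exists>T\<in>bounded_ops H. \<forall>\<xi>\<in>carrier H. \<forall>\<eta>\<in>carrier H. cinner H (T \<xi>) \<eta> = L S \<xi> \<eta>"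
    if S: "S \<in> bounded_ops Ind" for S
  proof (rule form_operator[where M = "op_norm Ind S"])
    note Sc = S_closed[OF S]
    show "L S (x + y) z = L S x z + L S y z" if "x \<in> carrier H" "y \<in> carrier H" "z \<in> carrier H" for x y z
      by (rule L_eqI[OF S _ _ tendsto_add[OF L[OF S that(1,3)] L[OF S that(2,3)]]])
        (use that in \<open>simp_all add: add_closed elementary_add Ind.op_add_apply[OF S] e_closed Sc Ind.cinner_add\<close>)
    show "L S (cscale H c x) z = c * L S x z" if "x \<in> carrier H" "z \<in> carrier H" for c x z
      by (rule L_eqI[OF S _ _ tendsto_mult[OF tendsto_const L[OF S that]]])
        (use that in \<open>simp_all add: scale_closed elementary_scale Ind.op_scale_apply[OF S] e_closed Sc Ind.cinner_scale\<close>)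
    show "L S x (y + z) = L S x y + L S x z" if "x \<in> carrier H" "y \<in> carrier H" "z \<in> carrier H" for x y z
      by (rule L_eqI[OF S _ _ tendsto_add[OF L[OF S that(1,2)] L[OF S that(1,3)]]])
        (use that in \<open>simp_all add: add_closed elementary_add e_closed Sc Ind.cinner_add_right\<close>)
    show "L S x (cscale H c z) = cnj c * L S x z" if "x \<in> carrier H" "z \<in> carrier H" for c x z
      by (rule L_eqI[OF S _ _ tendsto_mult[OF tendsto_const L[OF S that]]])
        (use that in \<open>simp_all add: scale_closed elementary_scale e_closed Sc Ind.cinner_scale_right\<close>)
    show "cmod (L S x y) \<le> op_norm Ind S * hnorm H x * hnorm H y" if "x \<in> carrier H" "y \<in> carrier H" for x y
    proof (rule tendsto_upperbound[OF tendsto_norm[OF L[OF S that]] _ F(2)])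
      show "\<forall>\<^sub>F u in F. cmod (cinner Ind (S (elementary u x)) (elementary u y)) \<le> op_norm Ind S * hnorm H x * hnorm H y"
        by (rule eventually_mono[OF unit]) (use bound[OF S _ _ that] in blast)
    qed
  qed
  then obtain \<beta> where \<beta>: "\<And>S. S \<in> bounded_ops Ind \<Longrightarrow> \<beta> S \<in> bounded_ops H"
    and form: "\<And>S \<xi> \<eta>. \<lbrakk>S \<in> bounded_ops Ind; \<xi> \<in> carrier H; \<eta> \<in> carrier H\<rbrakk> \<Longrightarrow> cinner H (\<beta> S \<xi>) \<eta> = L S \<xi> \<eta>"
    by metis
  have "gamma_map G Ind ind_rep (bounded_ops Ind) H \<pi> (bounded_ops H) \<beta>"
  proof
    show "\<beta> \<in> bounded_ops Ind \<rightarrow> bounded_ops H" using \<beta> by blast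
    show "\<beta> (op_add Ind S T) = op_add H (\<beta> S) (\<beta> T)"
      if S: "S \<in> bounded_ops Ind" and T: "T \<in> bounded_ops Ind" for S T
    proof (intro op_eqI_inner \<beta> op_add_closed Ind.op_add_closed S T)
      fix \<xi> \<eta> assume c: "\<xi> \<in> carrier H" "\<eta> \<in> carrier H"
      have "L (op_add Ind S T) \<xi> \<eta> = L S \<xi> \<eta> + L T \<xi> \<eta>"
        by (rule L_eqI[OF Ind.op_add_closed[OF S T] c tendsto_add[OF L[OF S c] L[OF T c]]])
          (simp add: op_add_eval e_closed c S_closed[OF S] S_closed[OF T] Ind.cinner_add)
      then show "cinner H (\<beta> (op_add Ind S T) \<xi>) \<eta> = cinner H (op_add H (\<beta> S) (\<beta> T) \<xi>) \<eta>"
        using c S T by (simp add: form Ind.op_add_closed op_add_eval cinner_add op_closed[OF \<beta>])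
    qed
    show "\<beta> (op_scale Ind k S) = op_scale H k (\<beta> S)" if S: "S \<in> bounded_ops Ind" for S k
    proof (intro op_eqI_inner \<beta> op_scale_closed Ind.op_scale_closed S)
      fix \<xi> \<eta> assume c: "\<xi> \<in> carrier H" "\<eta> \<in> carrier H"
      have "L (op_scale Ind k S) \<xi> \<eta> = k * L S \<xi> \<eta>"
        by (rule L_eqI[OF Ind.op_scale_closed[OF S] c tendsto_mult[OF tendsto_const L[OF S c]]])
          (simp add: op_scale_eval e_closed c S_closed[OF S] Ind.cinner_scale)
      then show "cinner H (\<beta> (op_scale Ind k S) \<xi>) \<eta> = cinner H (op_scale H k (\<beta> S) \<xi>) \<eta>"
        using c S by (simp add: form Ind.op_scale_closed op_scale_eval cinner_scale op_closed[OF \<beta>])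
    qed
    show "\<beta> (op_one Ind) = op_one H"
    proof (intro op_eqI_inner \<beta> op_one_closed Ind.op_one_closed)
      fix \<xi> \<eta> assume c: "\<xi> \<in> carrier H" "\<eta> \<in> carrier H"
      have "L (op_one Ind) \<xi> \<eta> = cinner H \<xi> \<eta>"
        by (rule L_eqI[OF Ind.op_one_closed c tendsto_const])
          (simp add: op_one_eval e_closed c cinner_elementary)
      then show "cinner H (\<beta> (op_one Ind) \<xi>) \<eta> = cinner H (op_one H \<xi>) \<eta>"
        using c by (simp add: form Ind.op_one_closed op_one_eval)
    qed
    show "\<beta> (op_action G Ind ind_rep g S) = op_action G H \<pi> g (\<beta> S)"
      if g: "g \<in> carrier G" and S: "S \<in> bounded_ops Ind" for g S
    proof (intro op_eqI_inner \<beta> op_action_closed Ind.op_action_closed g S)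
      fix \<xi> \<eta> assume c: "\<xi> \<in> carrier H" "\<eta> \<in> carrier H"
      define h where "h = inv g"
      have h: "h \<in> carrier G" using g by (simp add: h_def)
      define \<xi>' where "\<xi>' = \<pi> h \<xi>"
      define \<eta>' where "\<eta>' = \<pi> h \<eta>"
      have c': "\<xi>' \<in> carrier H" "\<eta>' \<in> carrier H" using c h by (simp_all add: \<xi>'_def \<eta>'_def rep_closed)
      define w where "w u = quasi_regular G \<Lambda> h u" for u
      define d where "d u = (\<lambda>C. w u C - u C)" for u
      define B where "B = op_norm Ind S * hnorm H \<xi>' * hnorm H \<eta>'"
      define f where "f u = cinner Ind (S (elementary u \<xi>')) (elementary u \<eta>')" for u
      define f' where "f' u = cinner Ind (S (elementary (w u) \<xi>')) (elementary (w u) \<eta>')" for u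
      have "((\<lambda>u. f' u - f u) \<longlongrightarrow> 0) F"
      proof (rule Lim_null_comparison)
        have "((\<lambda>u. ell2_sum cosets (d u)) \<longlongrightarrow> 0) F"
          unfolding d_def w_def by (rule tendsto_mono[OF F(1) inv0[OF h]])
        then have "((\<lambda>u. 2 * B * sqrt (ell2_sum cosets (d u))) \<longlongrightarrow> 2 * B * sqrt 0) F"
          by (intro tendsto_intros)
        then show "((\<lambda>u. 2 * B * sqrt (ell2_sum cosets (d u))) \<longlongrightarrow> 0) F" by simp
        show "\<forall>\<^sub>F u in F. norm (f' u - f u) \<le> 2 * B * sqrt (ell2_sum cosets (d u))"
        proof (rule eventually_mono[OF unit], elim conjE)
          fix u assume u: "u \<in> carrier ell2_cosets" and u1: "ell2_sum cosets u = 1"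
          have w: "w u \<in> carrier ell2_cosets" "ell2_sum cosets (w u) = 1"
            using u u1 h by (simp_all add: w_def quasi_regular_closed ell2_sum_quasi_regular)
          have du: "d u \<in> carrier ell2_cosets"
            unfolding d_def by (rule ell2_diff_closed[OF w(1) u])
          have ed: "elementary (d u) \<zeta> = elementary (w u) \<zeta> - elementary u \<zeta>" for \<zeta>
            unfolding d_def by (rule elementary_diff)
          note cl = e_closed[OF u c'(1)] e_closed[OF u c'(2)] e_closed[OF w(1) c'(1)] e_closed[OF w(1) c'(2)]
          have "f' u - f u = cinner Ind (S (elementary (d u) \<xi>')) (elementary (w u) \<eta>')
              + cinner Ind (S (elementary u \<xi>')) (elementary (d u) \<eta>')"
            unfolding ed f_def f'_def
            using cl Ind.op_closed[OF S cl(1)] Ind.op_closed[OF S cl(3)]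
            by (simp add: Ind.op_diff_apply[OF S] Ind.cinner_diff_left Ind.cinner_diff_right)
          also have "cmod \<dots> \<le> B * sqrt (ell2_sum cosets (d u)) + B * sqrt (ell2_sum cosets (d u))"
            using cmod_cinner_op_elementary_le[OF S du w(1) c'] cmod_cinner_op_elementary_le[OF S u du c'] u1 w(2)
            by (intro norm_triangle_mono) (simp_all add: B_def mult_ac)
          finally show "norm (f' u - f u) \<le> 2 * B * sqrt (ell2_sum cosets (d u))" by simp
        qed
      qed
      then have "((\<lambda>u. (f' u - f u) + f u) \<longlongrightarrow> 0 + L S \<xi>' \<eta>') F"
        unfolding f_def by (intro tendsto_add L[OF S c'])
      then have lim: "(f' \<longlongrightarrow> L S \<xi>' \<eta>') F" by simp
      have "L (op_action G Ind ind_rep g S) \<xi> \<eta> = L S \<xi>' \<eta>'"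
      proof (rule L_eqI[OF Ind.op_action_closed[OF g S] c lim])
        fix u assume u: "u \<in> carrier ell2_cosets"
        have e: "ind_rep h (elementary u \<xi>) = elementary (w u) \<xi>'" "ind_rep h (elementary u \<eta>) = elementary (w u) \<eta>'"
          using u c h by (simp_all add: ind_rep_elementary w_def \<xi>'_def \<eta>'_def)
        have w: "w u \<in> carrier ell2_cosets" using u h by (simp add: w_def quasi_regular_closed)
        show "f' u = cinner Ind (op_action G Ind ind_rep g S (elementary u \<xi>)) (elementary u \<eta>)"
          using g u c S_closed[OF S w c'(1)]
          by (simp add: Ind.op_action_apply e_closed Ind.cinner_rep_left f'_def flip: h_def e)
      qed
      then show "cinner H (\<beta> (op_action G Ind ind_rep g S) \<xi>) \<eta> = cinner H (op_action G H \<pi> g (\<beta> S) \<xi>) \<eta>"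
        using c c' g S op_closed[OF \<beta>[OF S] c'(1)]
        by (simp add: form Ind.op_action_closed op_action_apply cinner_rep_left \<xi>'_def \<eta>'_def h_def)
    qed
    show "positive_op (hpower H n) (matrix_op H n (\<lambda>i j. \<beta> (a i j)))"
      if a: "\<And>i j. \<lbrakk>i < n; j < n\<rbrakk> \<Longrightarrow> a i j \<in> bounded_ops Ind"
        and pos: "positive_op (hpower Ind n) (matrix_op Ind n a)" for n a
    proof (subst positive_matrix_op_iff)
      have form_nonneg: "matrix_form Ind n a y y \<in> \<real>\<^sub>\<ge>\<^sub>0" if "\<forall>i<n. y i \<in> carrier Ind" for y
        using pos that by (subst (asm) Ind.positive_matrix_op_iff) (use a in auto)
      show "\<beta> (a i j) \<in> bounded_ops H" if "i < n" "j < n" for i j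
        using a[OF that] by (rule \<beta>)
      show "\<forall>x. (\<forall>i<n. x i \<in> carrier H) \<longrightarrow> matrix_form H n (\<lambda>i j. \<beta> (a i j)) x x \<in> \<real>\<^sub>\<ge>\<^sub>0"
      proof (intro allI impI)
        fix x assume x: "\<forall>i<n. x i \<in> carrier H"
        have "((\<lambda>u. matrix_form Ind n a (\<lambda>i. elementary u (x i)) (\<lambda>i. elementary u (x i)))
            \<longlongrightarrow> matrix_form H n (\<lambda>i j. \<beta> (a i j)) x x) F"
          unfolding matrix_form_def
        proof (intro tendsto_sum)
          fix i j assume "i \<in> {..<n}" "j \<in> {..<n}"
          then show "((\<lambda>u. cinner Ind (a i j (elementary u (x j))) (elementary u (x i)))
              \<longlongrightarrow> cinner H (\<beta> (a i j) (x j)) (x i)) F"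
            using L[OF a, of i j "x j" "x i"] form[OF a, of i j "x j" "x i"] x by simp
        qed
        moreover have "\<forall>\<^sub>F u in F. matrix_form Ind n a (\<lambda>i. elementary u (x i)) (\<lambda>i. elementary u (x i)) \<in> \<real>\<^sub>\<ge>\<^sub>0"
        proof (rule eventually_mono[OF unit])
          fix u assume "u \<in> carrier ell2_cosets \<and> ell2_sum cosets u = 1"
          then have "\<forall>i<n. elementary u (x i) \<in> carrier Ind" using x e_closed by blast
          then show "matrix_form Ind n a (\<lambda>i. elementary u (x i)) (\<lambda>i. elementary u (x i)) \<in> \<real>\<^sub>\<ge>\<^sub>0"
            by (rule form_nonneg)
        qed
        ultimately show "matrix_form H n (\<lambda>i j. \<beta> (a i j)) x x \<in> \<real>\<^sub>\<ge>\<^sub>0"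
          by (intro Lim_in_closed_set[OF closed_nonneg_Reals_complex _ F(2)])
      qed
    qed
  qed
  then show ?thesis by blast
qed

end


section \<open>The boundary of the induced representation\<close>

theorem theorem3p26:
  fixes G :: "('g, 'm) monoid_scheme" and \<Lambda> :: "'g set"
    and H :: "'h::ab_group_add hilbert" and \<pi> :: "'g \<Rightarrow> 'h \<Rightarrow> 'h"
    and B_ind :: "(('g \<Rightarrow> 'h) \<Rightarrow> 'g \<Rightarrow> 'h) set" and B_pi :: "('h \<Rightarrow> 'h) set"
  assumes "group G"
    and "subgroup \<Lambda> G"
    and "co_amenable G \<Lambda>"
    and "unitary_rep G H \<pi>"
    and "FH_boundary G (induced_space G \<Lambda> H (restrict \<pi> \<Lambda>)) (induced_rep G \<Lambda> H (restrict \<pi> \<Lambda>)) B_ind"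
    and "FH_boundary G H \<pi> B_pi"
  shows "\<exists>\<theta>. gamma_isomorphism G
           (induced_space G \<Lambda> H (restrict \<pi> \<Lambda>)) (induced_rep G \<Lambda> H (restrict \<pi> \<Lambda>)) B_ind
           H \<pi> B_pi \<theta>"
proof -
  interpret subgroup_rep G H \<pi> \<Lambda>
    using assms by (intro subgroup_rep.intro subgroup_pair.intro)
  obtain \<beta> where "gamma_map G Ind ind_rep (bounded_ops Ind) H \<pi> (bounded_ops H) \<beta>"
    using compression_gamma_map[OF assms(3)] by blast
  then show ?thesis
    using FH_boundary_isomorphic[OF assms(4) induced_rep_unitary amplify_gamma_map] assms(5,6) by blast
qed

end
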